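(* Let $X$ be a compact metrizable group and $\alpha\colon X\to X$ a continuous group automorphism. Then the $\mathbb{Z}$-system $(X,\alpha)$ is not CAM.
   Context: A $\mathbb{Z}$-system $(X,T)$ is a compact metric space $X$ with a homeomorphism $T$. It is topologically transitive if for all nonempty open $U,V$ there is $n$ with $T^nU\cap V\neq\emptyset$; the action is faithful if $T^n=\mathrm{id}$ only for $n=0$. A point is periodic if its orbit is finite. The system is chaotic almost minimal (CAM) if: (1) it is topologically transitive and the action is faithful; (2) the periodic points are dense in $X$; (3) every proper closed $T$-invariant subset of $X$ is finite. *)

theory Defs
  imports "HOL-Analysis.Analysis" "HOL-Algebra.Group"
begin

definition zit :: "'a set \<Rightarrow> ('a \<Rightarrow> 'a) \<Rightarrow> int \<Rightarrow> 'a \<Rightarrow> 'a" where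
  "zit S f n = (if 0 \<le> n then f ^^ nat n else inv_into S f ^^ nat (- n))"

definition zsystem :: "'a topology \<Rightarrow> ('a \<Rightarrow> 'a) \<Rightarrow> bool" where
  "zsystem X f \<longleftrightarrow> compact_space X \<and> metrizable_space X \<and> homeomorphic_map X X f"

definition top_transitive :: "'a topology \<Rightarrow> ('a \<Rightarrow> 'a) \<Rightarrow> bool" where
  "top_transitive X f \<longleftrightarrow>
     (\<forall>U V. openin X U \<and> openin X V \<and> U \<noteq> {} \<and> V \<noteq> {} \<longrightarrow>
        (\<exists>n::int. zit (topspace X) f n ` U \<inter> V \<noteq> {}))"

definition faithful_action :: "'a topology \<Rightarrow> ('a \<Rightarrow> 'a) \<Rightarrow> bool" where
  "faithful_action X f \<longleftrightarrow>
     (\<forall>n::int. (\<forall>x\<in>topspace X. zit (topspace X) f n x = x) \<longrightarrow> n = 0)"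

definition periodic_point :: "'a topology \<Rightarrow> ('a \<Rightarrow> 'a) \<Rightarrow> 'a \<Rightarrow> bool" where
  "periodic_point X f x \<longleftrightarrow> x \<in> topspace X \<and> finite {zit (topspace X) f n x | n::int. True}"

definition CAM :: "'a topology \<Rightarrow> ('a \<Rightarrow> 'a) \<Rightarrow> bool" where
  "CAM X f \<longleftrightarrow> zsystem X f \<and>
     top_transitive X f \<and> faithful_action X f \<and>
     X closure_of {x. periodic_point X f x} = topspace X \<and>
     (\<forall>A. closedin X A \<and> f ` A = A \<and> A \<noteq> topspace X \<longrightarrow> finite A)"

definition topological_group :: "('a, 'b) monoid_scheme \<Rightarrow> 'a topology \<Rightarrow> bool" where
  "topological_group G X \<longleftrightarrow> group G \<and> topspace X = carrier G \<and>
     continuous_map (prod_topology X X) X (\<lambda>p. fst p \<otimes>\<^bsub>G\<^esub> snd p) \<and>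
     continuous_map X X (\<lambda>x. inv\<^bsub>G\<^esub> x)"

end

theory Submission
  imports Defs "HOL-Algebra.Multiplicative_Group" "HOL-Computational_Algebra.Computational_Algebra"
begin

text \<open>
  Suppose \<open>(X, \<alpha>)\<close> is CAM. The fixed point groups \<open>F n\<close> of \<open>\<alpha>\<close> to the power \<open>n!\<close> are finite, increasing,
  and have dense union. Since the conjugates of \<open>F n\<close> form a closed invariant set, \<open>F n\<close> is central, so \<open>X\<close>
  is abelian. Fourier analysis on the groups \<open>F n\<close> and a compactness argument yield a nontrivial continuous
  character \<open>\<theta>\<close> of \<open>X\<close>, and averaging over the \<open>F n\<close> shows that the itineraries \<open>n \<mapsto> \<theta> (\<alpha>\<^sup>n x)\<close> are exactly
  the circle-valued sequences satisfying all integral relations between the translates of \<open>\<theta>\<close>.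

  These relations form an ideal of integer polynomials. If \<open>\<theta>\<close> has prime order \<open>p\<close>, either all relations vanish
  modulo \<open>p\<close> and a single-spike sequence is an itinerary, or a recurrence makes \<open>X\<close> finite. Otherwise the
  ideal is zero or generated by a primitive \<open>f\<close>. A root of \<open>f\<close> on the unit circle gives infinitely many
  points whose itineraries stay in a half plane; without such a root, \<open>1 / f\<close> has a decaying Laurent
  expansion, which reduced modulo 1 is an itinerary tending to 1 in both directions. The orbit of such
  a homoclinic point is infinite but not dense, a contradiction.
\<close>

text \<open>The finite groups \<open>F n\<close> do the work of Haar measure: sums over them,
  divided by their order, replace the integral, and \<open>F_meets_open\<close> (a nonempty open set
  eventually contains a fixed proportion of \<open>F n\<close>) replaces the positivity of the
  measure on open sets. The obstacle in building a character of X is that characters of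
  \<open>F n\<close> need not extend to X, and that a pointwise limit of characters may be
  discontinuous or trivial. Both are met by taking the component of one fixed continuous function g
  along a character of \<open>F n\<close>: the components inherit the modulus of continuity of g on
  all of X, and g is a difference b(x) - b(x s), so that a large component keeps the character away
  from 1 at s. Torsion is excluded before the relation ideal is examined, because Z[t] is not a
  principal ideal ring: torsion-freeness makes the ideal saturated, and this is what lets a
  primitive element of least degree generate it.\<close>

hide_const (open) up_ring.monom up_ring.coeff module.smult Polynomial.order

section \<open>Characters of finite abelian groups\<close>

text \<open>Extensionality makes each character a single function, so that the dual of a finite
  group is a finite set over which sums can range.\<close>

definition circle_chars :: "('a, 'b) monoid_scheme \<Rightarrow> ('a \<Rightarrow> complex) set" where
  "circle_chars G = {\<theta> \<in> extensional (carrier G). (\<forall>x\<in>carrier G. cmod (\<theta> x) = 1) \<and>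
     (\<forall>x\<in>carrier G. \<forall>y\<in>carrier G. \<theta> (x \<otimes>\<^bsub>G\<^esub> y) = \<theta> x * \<theta> y)}"

lemma circle_charsD:
  assumes "\<theta> \<in> circle_chars G"
  shows "\<theta> \<in> extensional (carrier G)"
    and "x \<in> carrier G \<Longrightarrow> cmod (\<theta> x) = 1"
    and "x \<in> carrier G \<Longrightarrow> y \<in> carrier G \<Longrightarrow> \<theta> (x \<otimes>\<^bsub>G\<^esub> y) = \<theta> x * \<theta> y"
  using assms by (auto simp: circle_chars_def)

lemma (in group) circle_chars_one:
  assumes "\<theta> \<in> circle_chars G"
  shows "\<theta> \<one> = 1"
proof -
  have "\<theta> \<one> * \<theta> \<one> = \<theta> \<one>" using circle_charsD(3)[OF assms, of \<one> \<one>] by simp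
  moreover have "\<theta> \<one> \<noteq> 0" using circle_charsD(2)[OF assms, of \<one>] by auto
  ultimately show ?thesis by simp
qed

lemma (in group) circle_chars_pow:
  assumes "\<theta> \<in> circle_chars G" "x \<in> carrier G"
  shows "\<theta> (x [^] (k::nat)) = \<theta> x ^ k"
  by (induction k) (use assms in \<open>auto simp: circle_chars_one circle_charsD(3)\<close>)

lemma (in group) circle_chars_inv:
  assumes "\<theta> \<in> circle_chars G" "x \<in> carrier G"
  shows "\<theta> (inv x) = cnj (\<theta> x)"
proof -
  have "\<theta> (inv x) * \<theta> x = 1"
    using circle_charsD(3)[OF assms(1), of "inv x" x] assms circle_chars_one[OF assms(1)] by simp
  moreover have "cnj (\<theta> x) * \<theta> x = 1"
    using circle_charsD(2)[OF assms] by (simp add: complex_norm_square[symmetric] mult.commute)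
  moreover have "\<theta> x \<noteq> 0" using circle_charsD(2)[OF assms] by auto
  ultimately show ?thesis by (metis mult_right_cancel)
qed

lemma (in group) finite_circle_chars:
  assumes "finite (carrier G)"
  shows "finite (circle_chars G)"
proof (rule finite_subset)
  show "circle_chars G \<subseteq> PiE (carrier G) (\<lambda>_. {z. z ^ order G = 1})"
  proof
    fix \<theta> assume \<theta>: "\<theta> \<in> circle_chars G"
    have "\<theta> x ^ order G = 1" if "x \<in> carrier G" for x
      using circle_chars_pow[OF \<theta> that, of "order G"] pow_order_eq_1[OF that] circle_chars_one[OF \<theta>] by simp
    then show "\<theta> \<in> PiE (carrier G) (\<lambda>_. {z. z ^ order G = 1})"
      using circle_charsD(1)[OF \<theta>] by (auto simp: PiE_def)
  qed
  show "finite (PiE (carrier G) (\<lambda>_. {z::complex. z ^ order G = 1}))"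
    using assms by (intro finite_PiE finite_roots_unity) (auto simp: order_gt_0_iff_finite Suc_le_eq)
qed

text \<open>Up to a factor, the sum is the projection of \<open>u\<close> onto an eigenspace of
  translation by \<open>a\<close>. At \<open>x0\<close> it is a polynomial in \<open>z\<close> of
  degree below \<open>order G\<close> with constant term \<open>u x0\<close>, so it cannot vanish at
  every root of unity of that order.\<close>

lemma (in comm_group) exists_translation_eigenfunction:
  fixes u :: "'a \<Rightarrow> complex"
  assumes fin: "finite (carrier G)" and a: "a \<in> carrier G"
    and x0: "x0 \<in> carrier G" "u x0 \<noteq> 0"
  obtains z where "cmod z = 1"
    and "(\<Sum>k<order G. z ^ k * u (a [^] k \<otimes> x0)) \<noteq> 0"
    and "\<And>y. y \<in> carrier G \<Longrightarrow>
       (\<Sum>k<order G. z ^ k * u (a [^] k \<otimes> (a \<otimes> y))) = inverse z * (\<Sum>k<order G. z ^ k * u (a [^] k \<otimes> y))"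
proof -
  let ?m = "order G"
  have m: "?m > 0" using fin by (simp add: order_gt_0_iff_finite)
  define p where "p = (\<Sum>k<?m. monom (u (a [^] k \<otimes> x0)) k)"
  have "coeff p 0 = u x0" using m x0 by (simp add: p_def coeff_sum sum.delta)
  then have p0: "p \<noteq> 0" using x0 by auto
  have "degree p < ?m"
  proof (rule le_less_trans)
    show "degree p \<le> ?m - 1" unfolding p_def
      by (rule degree_sum_le) (auto intro: order_trans[OF degree_monom_le])
  qed (use m in simp)
  then have "card {z. poly p z = 0} < card {z::complex. z ^ ?m = 1}"
    using card_poly_roots_bound[OF p0] card_roots_unity_eq[OF m] by simp
  then have "\<not> {z::complex. z ^ ?m = 1} \<subseteq> {z. poly p z = 0}"
    using card_mono[OF poly_roots_finite[OF p0]] by (metis leD)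
  then obtain z where z: "z ^ ?m = 1" "poly p z \<noteq> 0" by auto
  have nz: "cmod z = 1" using z(1) m by (metis norm_ge_zero norm_one norm_power power_eq_1_iff zero_less_iff_neq_zero)
  show ?thesis
  proof (rule that[OF nz])
    show "(\<Sum>k<?m. z ^ k * u (a [^] k \<otimes> x0)) \<noteq> 0"
      using z(2) by (simp add: p_def poly_sum poly_monom mult.commute)
    fix y assume y: "y \<in> carrier G"
    have "z * (\<Sum>k<?m. z ^ k * u (a [^] k \<otimes> (a \<otimes> y))) = (\<Sum>k<?m. z ^ Suc k * u (a [^] Suc k \<otimes> y))"
      unfolding sum_distrib_left by (rule sum.cong) (use a y in \<open>auto simp: m_assoc\<close>)
    also have "\<dots> = (\<Sum>k<?m. z ^ k * u (a [^] k \<otimes> y))"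
    proof -
      have "(\<Sum>k<Suc ?m. z ^ k * u (a [^] k \<otimes> y))
          = z ^ 0 * u (a [^] (0::nat) \<otimes> y) + (\<Sum>k<?m. z ^ Suc k * u (a [^] Suc k \<otimes> y))"
        by (rule sum.lessThan_Suc_shift)
      moreover have "z ^ ?m * u (a [^] ?m \<otimes> y) = z ^ 0 * u (a [^] (0::nat) \<otimes> y)"
        using z a by (simp add: pow_order_eq_1)
      ultimately show ?thesis by simp
    qed
    finally have "inverse z * (z * (\<Sum>k<?m. z ^ k * u (a [^] k \<otimes> (a \<otimes> y)))) = inverse z * (\<Sum>k<?m. z ^ k * u (a [^] k \<otimes> y))" by simp
    moreover have "z \<noteq> 0" using nz by auto
    ultimately show "(\<Sum>k<?m. z ^ k * u (a [^] k \<otimes> (a \<otimes> y))) = inverse z * (\<Sum>k<?m. z ^ k * u (a [^] k \<otimes> y))"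
      by (simp only: mult.assoc[symmetric] left_inverse mult_1 simp_thms)
  qed
qed

text \<open>The eigenvalues of a common eigenfunction of all translations form a character. The
  eigenfunction is built by diagonalising one translation at a time; the condition that sums over
  the powers of \<open>x\<close> vanish is preserved, and it excludes the eigenvalue 1 at
  \<open>x\<close>.\<close>

lemma (in comm_group) circle_chars_separate:
  assumes fin: "finite (carrier G)" and x: "x \<in> carrier G" "x \<noteq> \<one>"
  obtains \<theta> where "\<theta> \<in> circle_chars G" "\<theta> x \<noteq> 1"
proof -
  let ?m = "order G"
  have m: "?m > 0" using fin by (simp add: order_gt_0_iff_finite)
  have "\<exists>v::'a \<Rightarrow> complex. (\<exists>y\<in>carrier G. v y \<noteq> 0) \<and>
      (\<forall>y\<in>carrier G. (\<Sum>k<?m. v (x [^] k \<otimes> y)) = 0) \<and>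
      (\<forall>a\<in>T. \<exists>z. cmod z = 1 \<and> (\<forall>y\<in>carrier G. v (a \<otimes> y) = z * v y))"
    if "finite T" "T \<subseteq> carrier G" for T
    using that
  proof (induction T)
    case empty
    define u where "u y = (if y = \<one> then 1 else 0 :: complex)" for y
    \<comment> \<open>A difference along \<open>x\<close> telescopes to zero over the powers of
      \<open>x\<close>, which starts the induction.\<close>
    define v where "v y = u (x \<otimes> y) - u y" for y
    have "v \<one> \<noteq> 0" using x by (simp add: v_def u_def)
    moreover have "(\<Sum>k<?m. v (x [^] k \<otimes> y)) = 0" if y: "y \<in> carrier G" for y
    proof -
      have "(\<Sum>k<?m. v (x [^] k \<otimes> y)) = (\<Sum>k<?m. u (x [^] Suc k \<otimes> y) - u (x [^] k \<otimes> y))"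
        by (rule sum.cong) (use x y in \<open>auto simp: v_def m_assoc[symmetric] m_comm\<close>)
      also have "\<dots> = u (x [^] ?m \<otimes> y) - u (x [^] (0::nat) \<otimes> y)"
        by (rule sum_lessThan_telescope)
      finally show ?thesis using x y by (simp add: pow_order_eq_1)
    qed
    ultimately show ?case by auto
  next
    case (insert a T)
    then obtain u :: "'a \<Rightarrow> complex" and x0 where x0: "x0 \<in> carrier G" "u x0 \<noteq> 0"
      and us: "\<And>y. y \<in> carrier G \<Longrightarrow> (\<Sum>k<?m. u (x [^] k \<otimes> y)) = 0"
      and uT: "\<And>a. a \<in> T \<Longrightarrow> \<exists>z. cmod z = 1 \<and> (\<forall>y\<in>carrier G. u (a \<otimes> y) = z * u y)" by auto
    have a: "a \<in> carrier G" using insert by auto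
    obtain z where z: "cmod z = 1" "(\<Sum>k<?m. z ^ k * u (a [^] k \<otimes> x0)) \<noteq> 0"
      and ze: "\<And>y. y \<in> carrier G \<Longrightarrow> (\<Sum>k<?m. z ^ k * u (a [^] k \<otimes> (a \<otimes> y))) = inverse z * (\<Sum>k<?m. z ^ k * u (a [^] k \<otimes> y))"
      using exists_translation_eigenfunction[of a x0 u, OF fin a x0] by blast
    define v where "v y = (\<Sum>k<?m. z ^ k * u (a [^] k \<otimes> y))" for y
    have "v x0 \<noteq> 0" using z by (simp add: v_def)
    moreover have "(\<Sum>k<?m. v (x [^] k \<otimes> y)) = 0" if y: "y \<in> carrier G" for y
    proof -
      have "(\<Sum>k<?m. v (x [^] k \<otimes> y)) = (\<Sum>j<?m. \<Sum>k<?m. z ^ j * u (a [^] j \<otimes> (x [^] k \<otimes> y)))"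
        unfolding v_def by (rule sum.swap)
      also have "\<dots> = (\<Sum>j<?m. z ^ j * (\<Sum>k<?m. u (x [^] k \<otimes> (a [^] j \<otimes> y))))"
        unfolding sum_distrib_left using a x y
        by (intro sum.cong refl) (simp add: m_lcomm)
      also have "\<dots> = 0" using us a y by simp
      finally show ?thesis .
    qed
    moreover have "\<exists>z. cmod z = 1 \<and> (\<forall>y\<in>carrier G. v (b \<otimes> y) = z * v y)" if b: "b \<in> insert a T" for b
    proof (cases "b = a")
      case True
      then show ?thesis using ze z(1) by (intro exI[of _ "inverse z"]) (auto simp: v_def norm_inverse)
    next
      case False
      then obtain w where w: "cmod w = 1" "\<And>y. y \<in> carrier G \<Longrightarrow> u (b \<otimes> y) = w * u y" using uT[of b] b by blast
      have bc: "b \<in> carrier G" using b insert by auto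
      have "v (b \<otimes> y) = w * v y" if y: "y \<in> carrier G" for y
        unfolding v_def sum_distrib_left
      proof (rule sum.cong[OF refl])
        fix k :: nat
        have "u (a [^] k \<otimes> (b \<otimes> y)) = u (b \<otimes> (a [^] k \<otimes> y))" using a bc y by (simp add: m_lcomm)
        also have "\<dots> = w * u (a [^] k \<otimes> y)" using w(2)[of "a [^] k \<otimes> y"] a y by simp
        finally show "z ^ k * u (a [^] k \<otimes> (b \<otimes> y)) = w * (z ^ k * u (a [^] k \<otimes> y))" by simp
      qed
      then show ?thesis using w(1) by blast
    qed
    ultimately show ?case using x0(1) by (intro exI[of _ v]) blast
  qed
  from this[OF fin order_refl] obtain v :: "'a \<Rightarrow> complex" and y where y: "y \<in> carrier G" "v y \<noteq> 0"
    and vs: "\<And>y. y \<in> carrier G \<Longrightarrow> (\<Sum>k<?m. v (x [^] k \<otimes> y)) = 0"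
    and ve: "\<And>a. a \<in> carrier G \<Longrightarrow> \<exists>z. cmod z = 1 \<and> (\<forall>y\<in>carrier G. v (a \<otimes> y) = z * v y)" by auto
  define \<theta> where "\<theta> = restrict (\<lambda>a. v (a \<otimes> y) / v y) (carrier G)"
  have \<theta>: "cmod (\<theta> a) = 1" "\<And>w. w \<in> carrier G \<Longrightarrow> v (a \<otimes> w) = \<theta> a * v w" if a: "a \<in> carrier G" for a
  proof -
    obtain z where z: "cmod z = 1" "\<forall>y\<in>carrier G. v (a \<otimes> y) = z * v y" using ve[OF a] by blast
    then have "\<theta> a = z" using a y by (simp add: \<theta>_def)
    then show "cmod (\<theta> a) = 1" "\<And>w. w \<in> carrier G \<Longrightarrow> v (a \<otimes> w) = \<theta> a * v w" using z by auto
  qed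
  have mult: "\<theta> (a \<otimes> b) = \<theta> a * \<theta> b" if a: "a \<in> carrier G" and b: "b \<in> carrier G" for a b
  proof -
    have "\<theta> (a \<otimes> b) * v y = \<theta> a * \<theta> b * v y"
      using \<theta>(2)[of "a \<otimes> b" y] \<theta>(2)[of a "b \<otimes> y"] \<theta>(2)[of b y] a b y by (simp add: m_assoc)
    then show ?thesis using y by simp
  qed
  have mem: "\<theta> \<in> circle_chars G"
    using \<theta>(1) mult by (auto simp: circle_chars_def \<theta>_def)
  have "\<theta> x \<noteq> 1"
  proof
    assume 1: "\<theta> x = 1"
    have "v (x [^] k \<otimes> y) = v y" for k :: nat
      using \<theta>(2)[of "x [^] k" y] circle_chars_pow[OF mem x(1), of k] 1 x y by simp
    then have "of_nat ?m * v y = 0" using vs[OF y(1)] by simp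
    then show False using y m by simp
  qed
  then show ?thesis using that mem by blast
qed

lemma (in comm_group) sum_circle_char:
  assumes fin: "finite (carrier G)" and \<theta>: "\<theta> \<in> circle_chars G" and s: "s \<in> carrier G" "\<theta> s \<noteq> 1"
  shows "(\<Sum>x\<in>carrier G. \<theta> x) = 0"
proof -
  have "(\<Sum>x\<in>carrier G. \<theta> x) = (\<Sum>x\<in>carrier G. \<theta> (s \<otimes> x))"
    by (rule sum.reindex_bij_betw[symmetric])
       (use s inj_on_cmult[of s] surj_const_mult[of s] in \<open>auto simp: bij_betw_def\<close>)
  also have "\<dots> = \<theta> s * (\<Sum>x\<in>carrier G. \<theta> x)"
    unfolding sum_distrib_left by (rule sum.cong) (use s circle_charsD(3)[OF \<theta>] in auto)
  finally have "(1 - \<theta> s) * (\<Sum>x\<in>carrier G. \<theta> x) = 0" by (simp add: algebra_simps)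
  then show ?thesis using s by simp
qed

lemma (in comm_group) circle_chars_mult_bij:
  assumes \<psi>: "\<psi> \<in> circle_chars G"
  shows "bij_betw (\<lambda>\<theta>. restrict (\<lambda>x. \<psi> x * \<theta> x) (carrier G)) (circle_chars G) (circle_chars G)"
proof (rule bij_betwI[where g = "\<lambda>\<theta>. restrict (\<lambda>x. cnj (\<psi> x) * \<theta> x) (carrier G)"])
  have c: "cnj (\<psi> x) * (\<psi> x * z) = z" "\<psi> x * (cnj (\<psi> x) * z) = z" if "x \<in> carrier G" for x z
  proof -
    have "cnj (\<psi> x) * \<psi> x = 1" using circle_charsD(2)[OF \<psi> that]
      by (simp add: complex_norm_square[symmetric] mult.commute)
    then show "cnj (\<psi> x) * (\<psi> x * z) = z" "\<psi> x * (cnj (\<psi> x) * z) = z"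
      by (metis mult.assoc mult_1, metis mult.assoc mult.commute mult_1)
  qed
  show "(\<lambda>\<theta>. \<lambda>x\<in>carrier G. \<psi> x * \<theta> x) \<in> circle_chars G \<rightarrow> circle_chars G"
    using \<psi> by (auto simp: circle_chars_def norm_mult)
  show "(\<lambda>\<theta>. \<lambda>x\<in>carrier G. cnj (\<psi> x) * \<theta> x) \<in> circle_chars G \<rightarrow> circle_chars G"
    using \<psi> by (auto simp: circle_chars_def norm_mult)
  fix \<theta> assume "\<theta> \<in> circle_chars G"
  then have e: "\<theta> \<in> extensional (carrier G)" by (rule circle_charsD)
  show "restrict (\<lambda>x. cnj (\<psi> x) * restrict (\<lambda>x. \<psi> x * \<theta> x) (carrier G) x) (carrier G) = \<theta>"
    using e by (intro extensionalityI[of _ "carrier G"]) (auto simp: c)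
  show "restrict (\<lambda>x. \<psi> x * restrict (\<lambda>x. cnj (\<psi> x) * \<theta> x) (carrier G) x) (carrier G) = \<theta>"
    using e by (intro extensionalityI[of _ "carrier G"]) (auto simp: c)
qed

text \<open>Away from the identity, multiplication by a character that is not 1 at \<open>x\<close>
  permutes the dual group and so kills the sum. At the identity the sum counts the characters;
  summing over group and dual in both orders shows that there are \<open>order G\<close> of
  them.\<close>

lemma (in comm_group) sum_over_circle_chars:
  assumes fin: "finite (carrier G)" and x: "x \<in> carrier G"
  shows "(\<Sum>\<theta>\<in>circle_chars G. \<theta> x) = (if x = \<one> then of_nat (order G) else 0)"
proof -
  have z: "(\<Sum>\<theta>\<in>circle_chars G. \<theta> x) = 0" if x: "x \<in> carrier G" "x \<noteq> \<one>" for x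
  proof -
    obtain \<psi> where \<psi>: "\<psi> \<in> circle_chars G" "\<psi> x \<noteq> 1" using circle_chars_separate[OF fin x] .
    have "(\<Sum>\<theta>\<in>circle_chars G. \<theta> x) = (\<Sum>\<theta>\<in>circle_chars G. restrict (\<lambda>x. \<psi> x * \<theta> x) (carrier G) x)"
      by (rule sum.reindex_bij_betw[OF circle_chars_mult_bij[OF \<psi>(1)], symmetric])
    also have "\<dots> = \<psi> x * (\<Sum>\<theta>\<in>circle_chars G. \<theta> x)" using x by (simp add: sum_distrib_left)
    finally have "(1 - \<psi> x) * (\<Sum>\<theta>\<in>circle_chars G. \<theta> x) = 0" by (simp add: algebra_simps)
    then show ?thesis using \<psi> by simp
  qed
  let ?t = "restrict (\<lambda>_. 1::complex) (carrier G)"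
  have t: "?t \<in> circle_chars G" by (auto simp: circle_chars_def)
  have one: "(\<Sum>\<theta>\<in>circle_chars G. \<theta> \<one>) = of_nat (card (circle_chars G))"
    by (simp add: circle_chars_one)
  have "(\<Sum>y\<in>carrier G. \<Sum>\<theta>\<in>circle_chars G. \<theta> y) = (\<Sum>y\<in>carrier G. if y = \<one> then of_nat (card (circle_chars G)) else 0)"
    by (rule sum.cong) (use z one in auto)
  also have "\<dots> = of_nat (card (circle_chars G))" using fin by simp
  finally have 1: "(\<Sum>y\<in>carrier G. \<Sum>\<theta>\<in>circle_chars G. \<theta> y) = (of_nat (card (circle_chars G)) :: complex)" .
  have "(\<Sum>\<theta>\<in>circle_chars G. \<Sum>y\<in>carrier G. \<theta> y) = (\<Sum>\<theta>\<in>circle_chars G. if \<theta> = ?t then of_nat (order G) else 0)"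
  proof (rule sum.cong[OF refl])
    fix \<theta> assume \<theta>: "\<theta> \<in> circle_chars G"
    show "(\<Sum>y\<in>carrier G. \<theta> y) = (if \<theta> = ?t then of_nat (order G) else 0)"
    proof (cases "\<theta> = ?t")
      case True then show ?thesis by (simp add: order_def)
    next
      case False
      then obtain s where "s \<in> carrier G" "\<theta> s \<noteq> 1"
        using circle_charsD(1)[OF \<theta>] extensionalityI[of \<theta> "carrier G" ?t] by auto
      then show ?thesis using False sum_circle_char[OF fin \<theta>] by simp
    qed
  qed
  also have "\<dots> = of_nat (order G)" using finite_circle_chars[OF fin] t by simp
  finally have "(of_nat (order G) :: complex) = of_nat (card (circle_chars G))"
    using 1 by (simp add: sum.swap[of _ "circle_chars G"])
  then show ?thesis using z[OF x] one by auto
qed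

lemma (in comm_group) parseval_circle_chars:
  fixes g :: "'a \<Rightarrow> complex"
  assumes fin: "finite (carrier G)"
  shows "(\<Sum>\<theta>\<in>circle_chars G. (cmod (\<Sum>x\<in>carrier G. g x * cnj (\<theta> x)))\<^sup>2)
    = real (order G) * (\<Sum>x\<in>carrier G. (cmod (g x))\<^sup>2)"
proof -
  have "complex_of_real (\<Sum>\<theta>\<in>circle_chars G. (cmod (\<Sum>x\<in>carrier G. g x * cnj (\<theta> x)))\<^sup>2)
    = (\<Sum>\<theta>\<in>circle_chars G. (\<Sum>x\<in>carrier G. g x * cnj (\<theta> x)) * cnj (\<Sum>y\<in>carrier G. g y * cnj (\<theta> y)))"
    by (simp only: of_real_sum complex_norm_square)
  also have "\<dots> = (\<Sum>\<theta>\<in>circle_chars G. \<Sum>x\<in>carrier G. \<Sum>y\<in>carrier G. g x * cnj (g y) * \<theta> (y \<otimes> inv x))"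
  proof (rule sum.cong[OF refl])
    fix \<theta> assume \<theta>: "\<theta> \<in> circle_chars G"
    have "(\<Sum>x\<in>carrier G. g x * cnj (\<theta> x)) * cnj (\<Sum>y\<in>carrier G. g y * cnj (\<theta> y))
       = (\<Sum>x\<in>carrier G. \<Sum>y\<in>carrier G. (g x * cnj (\<theta> x)) * cnj (g y * cnj (\<theta> y)))"
      by (simp add: sum_product)
    also have "\<dots> = (\<Sum>x\<in>carrier G. \<Sum>y\<in>carrier G. g x * cnj (g y) * \<theta> (y \<otimes> inv x))"
      by (intro sum.cong refl) (simp add: circle_charsD(3)[OF \<theta>] circle_chars_inv[OF \<theta>])
    finally show "(\<Sum>x\<in>carrier G. g x * cnj (\<theta> x)) * cnj (\<Sum>y\<in>carrier G. g y * cnj (\<theta> y)) = (\<Sum>x\<in>carrier G. \<Sum>y\<in>carrier G. g x * cnj (g y) * \<theta> (y \<otimes> inv x))" .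
  qed
  also have "\<dots> = (\<Sum>x\<in>carrier G. \<Sum>\<theta>\<in>circle_chars G. \<Sum>y\<in>carrier G. g x * cnj (g y) * \<theta> (y \<otimes> inv x))"
    by (rule sum.swap)
  also have "\<dots> = (\<Sum>x\<in>carrier G. \<Sum>y\<in>carrier G. \<Sum>\<theta>\<in>circle_chars G. g x * cnj (g y) * \<theta> (y \<otimes> inv x))"
    by (rule sum.cong[OF refl], rule sum.swap)
  also have "\<dots> = (\<Sum>x\<in>carrier G. \<Sum>y\<in>carrier G. if y = x then g x * cnj (g x) * of_nat (order G) else 0)"
  proof (intro sum.cong refl)
    fix x y assume x: "x \<in> carrier G" and y: "y \<in> carrier G"
    have "y \<otimes> inv x = \<one> \<longleftrightarrow> y = x"
      using x y by (metis inv_equality inv_inv r_inv inv_closed)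
    then show "(\<Sum>\<theta>\<in>circle_chars G. g x * cnj (g y) * \<theta> (y \<otimes> inv x)) = (if y = x then g x * cnj (g x) * of_nat (order G) else 0)"
      using sum_over_circle_chars[OF fin, of "y \<otimes> inv x"] x y by (simp flip: sum_distrib_left)
  qed
  also have "\<dots> = (\<Sum>x\<in>carrier G. g x * cnj (g x) * of_nat (order G))"
    using fin by (intro sum.cong) auto
  also have "\<dots> = complex_of_real (real (order G) * (\<Sum>x\<in>carrier G. (cmod (g x))\<^sup>2))"
    unfolding of_real_mult of_real_sum complex_norm_square
    by (simp add: sum_distrib_left mult.commute)
  finally show ?thesis by (simp only: of_real_eq_iff)
qed

text \<open>The Fourier coefficients of the autocorrelation of \<open>g\<close> are the squares of those of \<open>g\<close>,
  so comparing the two Parseval identities bounds the largest coefficient from below.\<close>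

lemma (in comm_group) exists_large_fourier_coefficient:
  fixes g :: "'a \<Rightarrow> complex"
  assumes fin: "finite (carrier G)"
  shows "\<exists>\<theta>\<in>circle_chars G.
    (\<Sum>x\<in>carrier G. (cmod (\<Sum>y\<in>carrier G. g (x \<otimes> y) * cnj (g y)))\<^sup>2)
      \<le> (cmod (\<Sum>x\<in>carrier G. g x * cnj (\<theta> x)))\<^sup>2 * (\<Sum>x\<in>carrier G. (cmod (g x))\<^sup>2)"
proof (rule ccontr)
  assume neg: "\<not> ?thesis"
  define a where "a \<theta> = (\<Sum>x\<in>carrier G. g x * cnj (\<theta> x))" for \<theta>
  define \<Phi> where "\<Phi> x = (\<Sum>y\<in>carrier G. g (x \<otimes> y) * cnj (g y))" for x
  let ?S = "\<Sum>x\<in>carrier G. (cmod (g x))\<^sup>2" and ?Q = "\<Sum>x\<in>carrier G. (cmod (\<Phi> x))\<^sup>2"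
  have lt: "(cmod (a \<theta>))\<^sup>2 * ?S < ?Q" if "\<theta> \<in> circle_chars G" for \<theta>
    using neg that unfolding a_def \<Phi>_def by (auto simp: not_le)
  have coeff: "(\<Sum>x\<in>carrier G. \<Phi> x * cnj (\<theta> x)) = a \<theta> * cnj (a \<theta>)" if \<theta>: "\<theta> \<in> circle_chars G" for \<theta>
  proof -
    have "(\<Sum>x\<in>carrier G. \<Phi> x * cnj (\<theta> x)) = (\<Sum>x\<in>carrier G. \<Sum>y\<in>carrier G. g (x \<otimes> y) * cnj (g y) * cnj (\<theta> x))"
      by (simp add: \<Phi>_def sum_distrib_right)
    also have "\<dots> = (\<Sum>y\<in>carrier G. \<Sum>x\<in>carrier G. g (y \<otimes> x) * cnj (g y) * cnj (\<theta> x))"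
      by (subst sum.swap) (intro sum.cong refl, simp add: m_comm)
    also have "\<dots> = (\<Sum>y\<in>carrier G. \<Sum>x\<in>carrier G. g x * cnj (g y) * cnj (\<theta> (inv y \<otimes> x)))"
    proof (rule sum.cong[OF refl])
      fix y assume y: "y \<in> carrier G"
      have "(\<Sum>x\<in>carrier G. g x * cnj (g y) * cnj (\<theta> (inv y \<otimes> x)))
         = (\<Sum>x\<in>carrier G. g (y \<otimes> x) * cnj (g y) * cnj (\<theta> (inv y \<otimes> (y \<otimes> x))))"
        by (rule sum.reindex_bij_betw[symmetric])
           (use y inj_on_cmult[of y] surj_const_mult[of y] in \<open>auto simp: bij_betw_def\<close>)
      also have "\<dots> = (\<Sum>x\<in>carrier G. g (y \<otimes> x) * cnj (g y) * cnj (\<theta> x))"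
        by (rule sum.cong) (use y in \<open>auto simp: m_assoc[symmetric]\<close>)
      finally show "(\<Sum>x\<in>carrier G. g (y \<otimes> x) * cnj (g y) * cnj (\<theta> x)) = (\<Sum>x\<in>carrier G. g x * cnj (g y) * cnj (\<theta> (inv y \<otimes> x)))" ..
    qed
    also have "\<dots> = (\<Sum>y\<in>carrier G. \<Sum>x\<in>carrier G. (g x * cnj (\<theta> x)) * cnj (g y * cnj (\<theta> y)))"
      by (intro sum.cong refl) (simp add: circle_charsD(3)[OF \<theta>] circle_chars_inv[OF \<theta>])
    also have "\<dots> = a \<theta> * cnj (a \<theta>)"
      by (subst sum.swap) (simp add: a_def sum_product)
    finally show ?thesis .
  qed
  have t: "restrict (\<lambda>_. 1::complex) (carrier G) \<in> circle_chars G" by (auto simp: circle_chars_def)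
  have "real (order G) * ?Q * ?S = (\<Sum>\<theta>\<in>circle_chars G. (cmod (a \<theta>))\<^sup>2 * ((cmod (a \<theta>))\<^sup>2 * ?S))"
  proof -
    have "real (order G) * ?Q = (\<Sum>\<theta>\<in>circle_chars G. (cmod (\<Sum>x\<in>carrier G. \<Phi> x * cnj (\<theta> x)))\<^sup>2)"
      by (rule parseval_circle_chars[OF fin, symmetric])
    also have "\<dots> = (\<Sum>\<theta>\<in>circle_chars G. (cmod (a \<theta>))\<^sup>2 * (cmod (a \<theta>))\<^sup>2)"
      by (rule sum.cong) (auto simp: coeff norm_mult power2_eq_square)
    finally show ?thesis by (simp add: sum_distrib_right mult.assoc)
  qed
  \<comment> \<open>Multiplying \<open>lt\<close> by a squared coefficient keeps it strict only
    where the coefficient is nonzero. If all coefficients vanished, so would the autocorrelation,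
    against \<open>lt\<close> at the trivial character.\<close>
  also have "\<dots> < (\<Sum>\<theta>\<in>circle_chars G. (cmod (a \<theta>))\<^sup>2 * ?Q)"
  proof (rule ccontr)
    assume ge: "\<not> ?thesis"
    have le: "(cmod (a \<theta>))\<^sup>2 * ((cmod (a \<theta>))\<^sup>2 * ?S) \<le> (cmod (a \<theta>))\<^sup>2 * ?Q" if "\<theta> \<in> circle_chars G" for \<theta>
      using lt[OF that] by (intro mult_left_mono) auto
    have a0: "a \<theta> = 0" if \<theta>: "\<theta> \<in> circle_chars G" for \<theta>
    proof (rule ccontr)
      assume "a \<theta> \<noteq> 0"
      then have "(cmod (a \<theta>))\<^sup>2 * ((cmod (a \<theta>))\<^sup>2 * ?S) < (cmod (a \<theta>))\<^sup>2 * ?Q"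
        using lt[OF \<theta>] by (intro mult_strict_left_mono) auto
      then have "(\<Sum>\<theta>\<in>circle_chars G. (cmod (a \<theta>))\<^sup>2 * ((cmod (a \<theta>))\<^sup>2 * ?S)) < (\<Sum>\<theta>\<in>circle_chars G. (cmod (a \<theta>))\<^sup>2 * ?Q)"
        using finite_circle_chars[OF fin] \<theta> le by (intro sum_strict_mono_ex1) auto
      then show False using ge by simp
    qed
    have "real (order G) * ?Q = (\<Sum>\<theta>\<in>circle_chars G. (cmod (\<Sum>x\<in>carrier G. \<Phi> x * cnj (\<theta> x)))\<^sup>2)"
      by (rule parseval_circle_chars[OF fin, symmetric])
    also have "\<dots> = 0" by (simp add: coeff a0)
    finally have "?Q = 0" using fin by (auto simp: order_def)
    then show False using lt[OF t] a0[OF t] by simp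
  qed
  also have "\<dots> = real (order G) * ?S * ?Q"
    using parseval_circle_chars[OF fin, of g] by (simp add: a_def sum_distrib_right[symmetric])
  finally show False by (simp add: mult_ac)
qed

section \<open>Convolution of bi-infinite sequences with polynomials\<close>

text \<open>This is \<open>f\<close> evaluated at the shift operator that sends w(n) to w(n + 1);
  hence products of polynomials become compositions.\<close>

definition seq_conv :: "'c::comm_semiring_1 poly \<Rightarrow> (int \<Rightarrow> 'c) \<Rightarrow> int \<Rightarrow> 'c" where
  "seq_conv f w n = (\<Sum>i\<le>degree f. coeff f i * w (n + int i))"

lemma seq_conv_altdef:
  assumes "degree f \<le> m"
  shows "seq_conv f w n = (\<Sum>i\<le>m. coeff f i * w (n + int i))"
  unfolding seq_conv_def
  by (rule sum.mono_neutral_left) (use assms in \<open>auto simp: coeff_eq_0\<close>)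

lemma seq_conv_0 [simp]: "seq_conv 0 w n = 0"
  by (simp add: seq_conv_def)

lemma seq_conv_pCons [simp]: "seq_conv (pCons c f) w n = c * w n + seq_conv f w (n + 1)"
proof -
  have "seq_conv (pCons c f) w n = (\<Sum>i\<le>Suc (degree f). coeff (pCons c f) i * w (n + int i))"
    by (rule seq_conv_altdef) (simp add: degree_pCons_le)
  also have "\<dots> = c * w n + (\<Sum>i\<le>degree f. coeff f i * w (n + 1 + int i))"
    by (simp add: sum.atMost_Suc_shift add_ac del: sum.atMost_Suc)
  finally show ?thesis by (simp add: seq_conv_def)
qed

lemma seq_conv_add: "seq_conv (f + g) w n = seq_conv f w n + seq_conv g w n"
  by (induction f g arbitrary: n rule: poly_induct2) (auto simp: algebra_simps)

lemma seq_conv_smult: "seq_conv (smult c f) w n = c * seq_conv f w n"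
  by (induction f arbitrary: n) (auto simp: algebra_simps)

lemma seq_conv_mult: "seq_conv (f * g) w n = seq_conv f (seq_conv g w) n"
  by (induction f arbitrary: n) (auto simp: seq_conv_add seq_conv_smult mult_pCons_left)

text \<open>On the integers a limit along \<open>cofinite\<close> is a limit at both ends at once,
  the form in which homoclinic itineraries appear.\<close>

lemma tendsto_cofinite_shift:
  fixes v :: "int \<Rightarrow> 'c::topological_space"
  assumes "(v \<longlongrightarrow> l) cofinite"
  shows "((\<lambda>n. v (n + k)) \<longlongrightarrow> l) cofinite"
proof (rule filterlim_compose[OF assms])
  show "filterlim (\<lambda>n. n + k) cofinite cofinite"
    unfolding filterlim_def le_filter_def
  proof (intro allI impI)
    fix P :: "int \<Rightarrow> bool" assume "eventually P cofinite"
    then have "finite ((\<lambda>n. n + k) -` {n. \<not> P n})"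
      by (intro finite_vimageI) (auto simp: eventually_cofinite inj_def)
    then show "eventually P (filtermap (\<lambda>n. n + k) cofinite)"
      by (simp add: eventually_filtermap eventually_cofinite vimage_def)
  qed
qed

lemma summable_geometric_mult_bounded:
  fixes v :: "nat \<Rightarrow> complex"
  assumes "cmod a < 1" "\<And>k. cmod (v k) \<le> B"
  shows "summable (\<lambda>k. a ^ k * v k)"
proof (rule summable_comparison_test')
  show "summable (\<lambda>k. B * cmod a ^ k)"
    using assms(1) by (intro summable_mult summable_geometric) simp
  show "norm (a ^ k * v k) \<le> B * cmod a ^ k" for k
    using assms(2)[of k] by (simp add: norm_mult norm_power mult.commute mult_right_mono)
qed

lemma bounded_if_tendsto_cofinite:
  fixes v :: "int \<Rightarrow> complex"
  assumes "(v \<longlongrightarrow> 0) cofinite"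
  obtains B where "\<And>n. cmod (v n) \<le> B"
proof -
  have "\<forall>\<^sub>F n in cofinite. dist (v n) 0 < 1" using assms by (rule tendstoD) simp
  then have fin: "finite {n. \<not> cmod (v n) < 1}" by (simp add: eventually_cofinite)
  have "cmod (v n) \<le> Max (insert 1 ((\<lambda>n. cmod (v n)) ` {n. \<not> cmod (v n) < 1}))" for n
  proof (cases "cmod (v n) < 1")
    case True
    have "cmod (v n) \<le> 1" using True by simp
    also have "1 \<le> Max (insert 1 ((\<lambda>n. cmod (v n)) ` {n. \<not> cmod (v n) < 1}))"
      using fin by (intro Max_ge) auto
    finally show ?thesis .
  next
    case False
    then show ?thesis using fin by (intro Max_ge) auto
  qed
  then show ?thesis by (rule that)
qed

text \<open>Tannery's theorem: each term tends to 0 and a geometric series dominates. The shifts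
  \<open>s\<close> are arbitrary so that expansions into the past and into the future are both
  covered.\<close>

lemma geometric_series_tendsto_cofinite:
  fixes v :: "int \<Rightarrow> complex" and s :: "nat \<Rightarrow> int"
  assumes v: "(v \<longlongrightarrow> 0) cofinite" and a: "cmod a < 1"
  shows "((\<lambda>n. \<Sum>k. a ^ k * v (n + s k)) \<longlongrightarrow> 0) cofinite"
proof -
  obtain B where B: "\<And>n. cmod (v n) \<le> B" using bounded_if_tendsto_cofinite[OF v] by blast
  have "((\<lambda>n. suminf (\<lambda>k. a ^ k * v (n + s k))) \<longlongrightarrow> suminf (\<lambda>_. 0)) cofinite"
  proof (rule tannerys_theorem[THEN conjunct2, THEN conjunct2])
    show "((\<lambda>n. a ^ k * v (n + s k)) \<longlongrightarrow> 0) cofinite" for k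
      using tendsto_mult_right_zero[OF tendsto_cofinite_shift[OF v]] by simp
    show "\<forall>\<^sub>F (k, n) in at_top \<times>\<^sub>F cofinite. norm (a ^ k * v (n + s k)) \<le> B * cmod a ^ k"
      by (rule always_eventually)
         (auto simp: norm_mult norm_power mult.commute[of B] intro!: mult_left_mono B)
    show "summable (\<lambda>k. B * cmod a ^ k)"
      using a by (intro summable_mult summable_geometric) simp
    show "cofinite \<noteq> (bot :: int filter)" by (simp add: cofinite_bot)
  qed
  then show ?thesis by simp
qed

text \<open>This inverts the operator shift - z on sequences that vanish at both ends. The geometric
  series runs over the past if |z| < 1 and over the future if |z| > 1; on the unit circle neither
  need converge.\<close>

lemma solve_linear_recurrence:
  fixes v :: "int \<Rightarrow> complex"
  assumes v: "(v \<longlongrightarrow> 0) cofinite" and z: "cmod z \<noteq> 1"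
  obtains u where "(u \<longlongrightarrow> 0) cofinite" "\<And>n. u (n + 1) - z * u n = v n"
proof -
  obtain B where B: "\<And>n. cmod (v n) \<le> B" using bounded_if_tendsto_cofinite[OF v] by blast
  show ?thesis
  proof (cases "cmod z < 1")
    case True
    define u where "u n = (\<Sum>k. z ^ k * v (n + (- 1 - int k)))" for n
    have "u (n + 1) - z * u n = v n" for n
    proof -
      have "summable (\<lambda>k. z ^ k * v (n - int k))"
        by (rule summable_geometric_mult_bounded[OF True B])
      from suminf_split_head[OF this]
      have "(\<Sum>k. z ^ Suc k * v (n - int (Suc k))) = u (n + 1) - v n"
        by (simp add: u_def)
      moreover have "(\<Sum>k. z ^ Suc k * v (n - int (Suc k))) = z * u n"
        unfolding u_def
        by (subst suminf_mult[symmetric])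
           (auto intro!: summable_geometric_mult_bounded[OF True B] simp: mult.assoc algebra_simps)
      ultimately show ?thesis by (simp add: algebra_simps)
    qed
    moreover have "(u \<longlongrightarrow> 0) cofinite" unfolding u_def
      by (rule geometric_series_tendsto_cofinite[OF v True])
    ultimately show ?thesis using that by blast
  next
    case False
    define y where "y = inverse z"
    have z0: "z \<noteq> 0" using False by auto
    have y: "cmod y < 1" using False z by (simp add: y_def norm_inverse inverse_less_1_iff)
    define u where "u n = - y * (\<Sum>k. y ^ k * v (n + int k))" for n
    have "u (n + 1) - z * u n = v n" for n
    proof -
      have "summable (\<lambda>k. y ^ k * v (n + int k))"
        by (rule summable_geometric_mult_bounded[OF y B])
      from suminf_split_head[OF this]
      have "(\<Sum>k. y ^ Suc k * v (n + int (Suc k))) = z * (- u n) - v n"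
        using z0 by (simp add: u_def y_def)
      moreover have "(\<Sum>k. y ^ Suc k * v (n + int (Suc k))) = - u (n + 1)"
        unfolding u_def
        by (simp, subst suminf_mult[symmetric])
           (auto intro!: summable_geometric_mult_bounded[OF y B] simp: mult.assoc algebra_simps)
      ultimately show ?thesis by (simp add: algebra_simps)
    qed
    moreover have "(u \<longlongrightarrow> 0) cofinite" unfolding u_def
      using tendsto_mult_right_zero[OF geometric_series_tendsto_cofinite[OF v y]] by blast
    ultimately show ?thesis using that by blast
  qed
qed

text \<open>Over the complex numbers \<open>f\<close> splits, and its linear factors are inverted
  one at a time; each solution again tends to 0, so the next factor can be treated.\<close>

lemma solve_seq_conv:
  fixes f :: "complex poly" and v :: "int \<Rightarrow> complex"
  assumes "f \<noteq> 0" "\<And>z. cmod z = 1 \<Longrightarrow> poly f z \<noteq> 0" "(v \<longlongrightarrow> 0) cofinite"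
  shows "\<exists>w. (w \<longlongrightarrow> 0) cofinite \<and> seq_conv f w = v"
  using assms
proof (induction "degree f" arbitrary: f v rule: less_induct)
  case less
  show ?case
  proof (cases "degree f = 0")
    case True
    then obtain c where c: "f = [:c:]" by (rule degree_eq_zeroE)
    then have "((\<lambda>n. inverse c * v n) \<longlongrightarrow> 0) cofinite" using tendsto_mult_right_zero[OF less.prems(3)] by blast
    moreover have "seq_conv f (\<lambda>n. inverse c * v n) = v" using c less.prems(1) by (auto simp: fun_eq_iff)
    ultimately show ?thesis by blast
  next
    case False
    then have "\<not> constant (poly f)" by (simp add: constant_degree)
    then obtain z where z: "poly f z = 0" using fundamental_theorem_of_algebra by blast
    then obtain q where q: "f = [:- z, 1:] * q" using poly_eq_0_iff_dvd by (metis dvdE)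
    have z1: "cmod z \<noteq> 1" using less.prems(2) z by blast
    have q0: "q \<noteq> 0" using q less.prems(1) by auto
    then have dq: "degree q < degree f" unfolding q by (subst degree_mult_eq) auto
    obtain u where u: "(u \<longlongrightarrow> 0) cofinite" "\<And>n. u (n + 1) - z * u n = v n"
      using solve_linear_recurrence[OF less.prems(3) z1] by blast
    have "\<And>z. cmod z = 1 \<Longrightarrow> poly q z \<noteq> 0" using less.prems(2) q by auto
    then obtain w where w: "(w \<longlongrightarrow> 0) cofinite" "seq_conv q w = u"
      using less.hyps[OF dq q0 _ u(1)] by blast
    have "seq_conv f w n = seq_conv [:- z, 1:] u n" for n
      unfolding q by (simp only: seq_conv_mult w(2))
    then have "seq_conv f w = v" using u(2) by (auto simp: fun_eq_iff)
    then show ?thesis using w(1) by blast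
  qed
qed

text \<open>The value w(-k) is the coefficient of t^k in the Laurent expansion of 1/f on the unit
  circle. Real parts of a complex solution solve the equation because \<open>f\<close> has real
  coefficients.\<close>

lemma int_poly_convolution_inverse:
  fixes f :: "int poly"
  assumes "f \<noteq> 0" "\<And>z::complex. cmod z = 1 \<Longrightarrow> poly (map_poly of_int f) z \<noteq> 0"
  obtains w :: "int \<Rightarrow> real" where "(w \<longlongrightarrow> 0) cofinite"
    "\<And>n. seq_conv (map_poly of_int f) w n = (if n = 0 then 1 else 0)"
proof -
  let ?f = "map_poly of_int f :: complex poly"
  have f0: "?f \<noteq> 0" using assms(1) by (simp add: map_poly_eq_0_iff)
  have "((\<lambda>n::int. if n = 0 then 1 else 0 :: complex) \<longlongrightarrow> 0) cofinite"
    by (rule tendsto_eventually) (auto simp: eventually_cofinite)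
  from solve_seq_conv[OF f0 assms(2) this]
  obtain w where w: "(w \<longlongrightarrow> 0) cofinite" "seq_conv ?f w = (\<lambda>n. if n = 0 then 1 else 0)" by blast
  have "seq_conv (map_poly of_int f) (\<lambda>n. Re (w n)) n = (if n = 0 then 1 else 0)" for n
  proof -
    have "seq_conv (map_poly of_int f) (\<lambda>n. Re (w n)) n = Re (seq_conv ?f w n)"
      by (simp add: seq_conv_def degree_map_poly coeff_map_poly Re_sum)
    then show ?thesis by (simp add: w(2))
  qed
  moreover have "((\<lambda>n. Re (w n)) \<longlongrightarrow> 0) cofinite" using tendsto_Re[OF w(1)] by simp
  ultimately show ?thesis using that by blast
qed

section \<open>Integer polynomials acting on sequences, additively and multiplicatively\<close>

definition iconv :: "int poly \<Rightarrow> (int \<Rightarrow> 'c::comm_ring_1) \<Rightarrow> int \<Rightarrow> 'c" where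
  "iconv f w n = (\<Sum>i\<le>degree f. of_int (coeff f i) * w (n + int i))"

lemma iconv_eq_seq_conv:
  fixes w :: "int \<Rightarrow> 'c::{comm_ring_1, ring_char_0}"
  shows "iconv f w n = seq_conv (map_poly of_int f) w n"
  by (simp add: iconv_def seq_conv_def degree_map_poly coeff_map_poly)

lemma iconv_0 [simp]: "iconv 0 w n = 0"
  by (simp add: iconv_def)

lemma iconv_pCons [simp]: "iconv (pCons c f) w n = of_int c * w n + iconv f w (n + 1)"
proof -
  have "iconv (pCons c f) w n = (\<Sum>i\<le>Suc (degree f). of_int (coeff (pCons c f) i) * w (n + int i))"
    unfolding iconv_def by (rule sum.mono_neutral_left) (use degree_pCons_le[of c f] in \<open>auto simp: coeff_eq_0\<close>)
  also have "\<dots> = of_int c * w n + (\<Sum>i\<le>degree f. of_int (coeff f i) * w (n + 1 + int i))"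
    by (simp add: sum.atMost_Suc_shift add_ac del: sum.atMost_Suc)
  finally show ?thesis by (simp add: iconv_def)
qed

lemma iconv_add: "iconv (f + g) w n = iconv f w n + iconv g w n"
  by (induction f g arbitrary: n rule: poly_induct2) (auto simp: algebra_simps)

lemma iconv_smult: "iconv (smult c f) w n = of_int c * iconv f w n"
  by (induction f arbitrary: n) (auto simp: algebra_simps)

lemma iconv_mult: "iconv (f * g) w n = iconv f (iconv g w) n"
  by (induction f arbitrary: n) (auto simp: iconv_add iconv_smult mult_pCons_left)

lemma iconv_Ints:
  assumes "\<And>n. w n \<in> \<int>"
  shows "iconv f w n \<in> \<int>"
  using assms by (induction f arbitrary: n) auto

lemma iconv_zero_fun [simp]: "iconv f (\<lambda>_. 0) n = 0"
  by (simp add: iconv_def)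

text \<open>Powers of \<open>z\<close> form an eigenvector of the shift with eigenvalue
  \<open>z\<close>, and integer coefficients commute with taking real parts. A root of
  \<open>f\<close> thus gives a bounded sequence killed by \<open>f\<close> if it lies on the unit
  circle.\<close>

lemma iconv_Re_powi:
  fixes z :: complex
  assumes "z \<noteq> 0"
  shows "iconv f (\<lambda>n. e * Re (z powi n)) n = e * Re (z powi n * poly (map_poly of_int f) z)"
proof (induction f arbitrary: n)
  case (pCons c f)
  let ?P = "poly (map_poly of_int f) z"
  have "z powi n * poly (map_poly of_int (pCons c f)) z = of_int c * z powi n + z powi (n + 1) * ?P"
    using assms pCons.hyps by (auto simp: map_poly_pCons power_int_add algebra_simps)
  then have "Re (z powi n * poly (map_poly of_int (pCons c f)) z) = of_int c * Re (z powi n) + Re (z powi (n + 1) * ?P)"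
    by (simp only: plus_complex.sel) simp
  then show ?case using pCons.IH[of "n + 1"] by (simp only: iconv_pCons) (simp only: algebra_simps)
qed simp

text \<open>The same action written multiplicatively, for circle-valued sequences;
  \<open>zev_cis\<close> is the translation. On an itinerary of a character it is the value of the
  product of the translated characters, with the coefficients as exponents.\<close>

definition zev :: "int poly \<Rightarrow> (int \<Rightarrow> complex) \<Rightarrow> int \<Rightarrow> complex" where
  "zev f y n = (\<Prod>i\<le>degree f. y (n + int i) powi coeff f i)"

lemma zev_0 [simp]: "zev 0 y n = 1"
  by (simp add: zev_def)

lemma zev_pCons [simp]: "zev (pCons c f) y n = y n powi c * zev f y (n + 1)"
proof -
  have "zev (pCons c f) y n = (\<Prod>i\<le>Suc (degree f). y (n + int i) powi coeff (pCons c f) i)"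
    unfolding zev_def by (rule prod.mono_neutral_left) (use degree_pCons_le[of c f] in \<open>auto simp: coeff_eq_0\<close>)
  also have "\<dots> = y n powi c * (\<Prod>i\<le>degree f. y (n + 1 + int i) powi coeff f i)"
    by (simp add: prod.atMost_Suc_shift add_ac del: prod.atMost_Suc)
  finally show ?thesis by (simp add: zev_def)
qed

lemma zev_add:
  assumes "\<And>n. y n \<noteq> 0"
  shows "zev (f + g) y n = zev f y n * zev g y n"
  by (induction f g arbitrary: n rule: poly_induct2) (auto simp: power_int_add assms)

lemma zev_smult: "zev (smult c f) y n = zev f y n powi c"
  by (induction f arbitrary: n) (auto simp: power_int_mult_distrib mult.commute[of c] power_int_mult)

lemma zev_monom [simp]: "zev (monom 1 k) y n = y (n + int k)"
  by (induction k arbitrary: n) (auto simp: monom_0 monom_Suc add_ac)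

lemma norm_zev: "(\<And>n. cmod (y n) = 1) \<Longrightarrow> cmod (zev f y n) = 1"
  by (induction f arbitrary: n) (auto simp: norm_mult norm_power_int)

lemma zev_cis: "zev f (\<lambda>n. cis (2 * pi * r n)) n = cis (2 * pi * iconv f r n)"
  by (induction f arbitrary: n) (auto simp: cis_power_int cis_mult algebra_simps)

lemma zev_cong: "(\<And>i. y (n + int i) = y' (m + int i)) \<Longrightarrow> zev f y n = zev f y' m"
  by (simp add: zev_def)

text \<open>Extreme terms cannot cancel: the product is nonzero at the top of the support of
  \<open>w\<close>, through the constant term, and at the bottom minus \<open>degree f\<close>,
  through the leading one. For the unit both indices are 0, which puts the bottom of the support
  above its top.\<close>

lemma finite_support_not_convolution_unit:
  fixes f :: "int poly" and w :: "int \<Rightarrow> real"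
  assumes fin: "finite {n. w n \<noteq> 0}" and deg: "degree f > 0" and f0: "coeff f 0 \<noteq> 0"
  shows "\<not> (\<forall>n. iconv f w n = (if n = 0 then 1 else 0))"
proof
  assume eq: "\<forall>n. iconv f w n = (if n = 0 then 1 else 0)"
  let ?S = "{n. w n \<noteq> 0}"
  have ne: "?S \<noteq> {}"
  proof
    assume "?S = {}"
    then have "w = (\<lambda>_. 0)" by auto
    then show False using eq[rule_format, of 0] by simp
  qed
  have "iconv f w (Max ?S) = of_int (coeff f 0) * w (Max ?S)"
  proof -
    have "w (Max ?S + int i) = 0" if "i \<noteq> 0" for i
      using Max_ge[OF fin, of "Max ?S + int i"] that by fastforce
    then have "iconv f w (Max ?S) = (\<Sum>i\<le>degree f. if i = 0 then of_int (coeff f 0) * w (Max ?S) else 0)"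
      unfolding iconv_def by (intro sum.cong) auto
    then show ?thesis by simp
  qed
  then have "iconv f w (Max ?S) \<noteq> 0" using Max_in[OF fin ne] f0 by simp
  then have Max: "Max ?S = 0" using eq by (metis)
  have "iconv f w (Min ?S - int (degree f)) = of_int (lead_coeff f) * w (Min ?S)"
  proof -
    have "w (Min ?S - int (degree f) + int i) = 0" if "i < degree f" for i
      using Min_le[OF fin, of "Min ?S - int (degree f) + int i"] that by fastforce
    then have "iconv f w (Min ?S - int (degree f)) = (\<Sum>i\<le>degree f. if i = degree f then of_int (lead_coeff f) * w (Min ?S) else 0)"
      unfolding iconv_def by (intro sum.cong) auto
    then show ?thesis by simp
  qed
  then have "iconv f w (Min ?S - int (degree f)) \<noteq> 0" using Min_in[OF fin ne] deg by auto
  then have "Min ?S = int (degree f)" using eq by (metis eq_iff_diff_eq_0)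
  moreover have "Min ?S \<le> Max ?S" by (rule Min_le[OF fin Max_in[OF fin ne]])
  ultimately show False using Max deg by simp
qed

text \<open>Gauss's lemma: contents multiply, so \<open>c\<close> divides the content of
  \<open>q\<close>.\<close>

lemma primitive_dvd_smult_cancel:
  fixes f g q :: "int poly"
  assumes "content f = 1" "c \<noteq> 0" "smult c g = f * q"
  obtains q' where "g = f * q'"
proof -
  have "[:c:] dvd smult c g" by (auto simp: const_poly_dvd_iff)
  then have "c dvd content (f * q)" by (simp add: assms(3) const_poly_dvd_iff_dvd_content)
  then have "c dvd content q" by (simp add: content_mult assms(1))
  then obtain q' where q': "q = [:c:] * q'" by (metis const_poly_dvd_iff_dvd_content dvdE)
  then have "smult c g = smult c (f * q')" using assms(3) by simp
  then have "g = f * q'" using assms(2) by (metis smult_cancel)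
  then show ?thesis by (rule that)
qed

section \<open>Compact abelian groups with dense locally finite subgroups\<close>

text \<open>Tychonoff's theorem for a product of discs. The index type may be uncountable, so a
  cluster point need not be the limit of a subsequence; a filter finer than
  \<open>sequentially\<close> takes its place.\<close>

lemma pointwise_cluster_point:
  fixes H :: "nat \<Rightarrow> 'a \<Rightarrow> complex"
  assumes bd: "\<And>n x. cmod (H n x) \<le> 1"
  obtains U h where "U \<le> sequentially" "U \<noteq> bot" "\<And>x. ((\<lambda>n. H n x) \<longlongrightarrow> h x) U"
proof -
  have "compactin (product_topology (\<lambda>_. euclidean) UNIV) (PiE UNIV (\<lambda>_::'a. cball (0::complex) 1))"
    by (subst compactin_PiE) auto
  then have cpt: "compact (PiE UNIV (\<lambda>_::'a. cball (0::complex) 1))"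
    by (simp add: euclidean_product_topology)
  define M where "M = filtermap H sequentially"
  have "M \<noteq> bot" by (simp add: M_def filtermap_bot_iff)
  moreover have "eventually (\<lambda>h. h \<in> PiE UNIV (\<lambda>_::'a. cball (0::complex) 1)) M"
    using bd by (auto simp: M_def eventually_filtermap PiE_def)
  ultimately obtain h where h: "inf (nhds h) M \<noteq> bot"
    using cpt unfolding compact_filter by blast
  define U where "U = inf sequentially (filtercomap H (nhds h))"
  have "U \<noteq> bot"
  proof
    assume "U = bot"
    then have "eventually (\<lambda>_. False) (inf sequentially (filtercomap H (nhds h)))" by (simp add: U_def)
    then obtain P Q where P: "eventually P sequentially" and Q: "eventually Q (nhds h)"
      and PQ: "\<And>n. P n \<Longrightarrow> Q (H n) \<Longrightarrow> False"
      by (auto simp: eventually_inf eventually_filtercomap)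
    have "eventually (\<lambda>k. \<not> Q k) M"
      unfolding M_def eventually_filtermap using P by eventually_elim (use PQ in blast)
    then have "eventually (\<lambda>_. False) (inf (nhds h) M)"
      unfolding eventually_inf using Q by blast
    then show False using h by (simp add: trivial_limit_def)
  qed
  moreover have "((\<lambda>n. H n x) \<longlongrightarrow> h x) U" for x
  proof -
    have "filterlim H (nhds h) U" unfolding U_def filterlim_def
      by (rule order_trans[OF filtermap_mono[OF inf_le2] filtermap_filtercomap])
    from continuous_on_tendsto_compose[OF continuous_on_product_coordinates[of x] this]
    show ?thesis by simp
  qed
  ultimately show ?thesis using that[of U h] unfolding U_def by simp
qed

text \<open>This isolates what harmonic analysis needs once commutativity is known; the automorphism
  does not occur in it.\<close>

locale compact_group_dense_finite = comm_group G for G (structure) +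
  fixes X :: "'a topology" and F :: "nat \<Rightarrow> 'a set"
  assumes tsp: "topspace X = carrier G"
    and mult_cont: "continuous_map (prod_topology X X) X (\<lambda>p. fst p \<otimes> snd p)"
    and compact: "compact_space X" and hausdorff: "Hausdorff_space X"
    and F_subgroup: "subgroup (F n) G" and F_finite: "finite (F n)" and F_Suc: "F n \<subseteq> F (Suc n)"
    and F_dense: "openin X U \<Longrightarrow> U \<noteq> {} \<Longrightarrow> \<exists>n. F n \<inter> U \<noteq> {}"
begin

lemma F_mono: "m \<le> n \<Longrightarrow> F m \<subseteq> F n"
  using F_Suc by (rule lift_Suc_mono_le)

lemma F_carrier: "x \<in> F n \<Longrightarrow> x \<in> carrier G"
  using F_subgroup subgroup.mem_carrier by metis

lemma card_F_pos: "card (F n) > 0"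
  using F_finite subgroup.one_closed[OF F_subgroup[of n]] by (auto simp: card_gt_0_iff)

lemma continuous_mult:
  assumes "continuous_map Z X u" "continuous_map Z X v"
  shows "continuous_map Z X (\<lambda>z. u z \<otimes> v z)"
  using continuous_map_compose[OF continuous_map_pairedI[OF assms] mult_cont] by (simp add: o_def)

lemma continuous_translation: "a \<in> carrier G \<Longrightarrow> continuous_map X X (\<lambda>x. a \<otimes> x)"
  by (rule continuous_mult) (auto simp: tsp)

lemma open_translate:
  assumes "openin X W" "a \<in> carrier G"
  shows "openin X {x \<in> carrier G. a \<otimes> x \<in> W}"
  using openin_continuous_map_preimage[OF continuous_translation[OF assms(2)] assms(1)] by (simp add: tsp)

lemma zero_on_F_imp_zero:
  fixes u :: "'a \<Rightarrow> complex"
  assumes "continuous_map X euclidean u" "\<And>n x. x \<in> F n \<Longrightarrow> u x = 0" "x \<in> carrier G"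
  shows "u x = 0"
proof (rule ccontr)
  assume "u x \<noteq> 0"
  moreover have "openin X {x \<in> topspace X. u x \<in> - {0}}"
    by (rule openin_continuous_map_preimage[OF assms(1)]) (simp add: open_Compl)
  ultimately obtain n where "F n \<inter> {x \<in> topspace X. u x \<in> - {0}} \<noteq> {}"
    using F_dense assms(3) tsp by blast
  then show False using assms(2) by auto
qed

text \<open>Translates of \<open>W\<close> by elements of the dense union cover X, and finitely many
  suffice. Once \<open>F n\<close> contains the translating elements, each translate holds at most
  as many points of \<open>F n\<close> as \<open>W\<close> does.\<close>

lemma F_meets_open:
  assumes W: "openin X W" "W \<noteq> {}"
  obtains K :: real where "K > 0" "\<forall>\<^sub>F n in sequentially. real (card (F n)) \<le> K * real (card (F n \<inter> W))"
proof -
  define V where "V p = {x \<in> carrier G. inv p \<otimes> x \<in> W}" for p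
  have WG: "W \<subseteq> carrier G" using openin_subset[OF W(1)] tsp by simp
  obtain w where w: "w \<in> W" using W by auto
  have "topspace X \<subseteq> \<Union> (V ` (\<Union>n. F n))"
  proof
    fix x assume "x \<in> topspace X"
    then have x: "x \<in> carrier G" by (simp add: tsp)
    have "openin X {q \<in> carrier G. x \<otimes> q \<in> W}" by (rule open_translate[OF W(1) x])
    moreover have "inv x \<otimes> w \<in> {q \<in> carrier G. x \<otimes> q \<in> W}" using x w WG by (auto simp: m_assoc[symmetric])
    ultimately obtain n q where q: "q \<in> F n" "x \<otimes> q \<in> W" using F_dense by blast
    have "inv (inv q) \<otimes> x \<in> W" using q x F_carrier by (simp add: m_comm)
    then have "x \<in> V (inv q)" using x by (simp add: V_def)
    moreover have "inv q \<in> F n" using q(1) subgroup.m_inv_closed[OF F_subgroup] by blast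
    ultimately show "x \<in> \<Union> (V ` (\<Union>n. F n))" by blast
  qed
  moreover have "\<And>U. U \<in> V ` (\<Union>n. F n) \<Longrightarrow> openin X U"
    unfolding V_def using F_carrier open_translate[OF W(1)] by auto
  ultimately obtain T' where T': "finite T'" "T' \<subseteq> V ` (\<Union>n. F n)" "topspace X \<subseteq> \<Union>T'"
    using compact unfolding compact_space_def compactin_def by meson
  obtain T where T: "finite T" "T \<subseteq> (\<Union>n. F n)" "T' = V ` T"
    using finite_subset_image[OF T'(1,2)] by blast
  have "\<exists>m. T \<subseteq> F m" using T(1,2)
  proof (induction T)
    case (insert p T)
    then obtain m k where "T \<subseteq> F m" "p \<in> F k" by auto
    then have "insert p T \<subseteq> F (max m k)" using F_mono[of m "max m k"] F_mono[of k "max m k"] by auto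
    then show ?case by blast
  qed simp
  then obtain m where m: "T \<subseteq> F m" by blast
  have "card (F n) \<le> card T * card (F n \<inter> W)" if n: "n \<ge> m" for n
  proof -
    have "F n \<subseteq> (\<Union>p\<in>T. {x \<in> F n. inv p \<otimes> x \<in> W})"
    proof
      fix x assume x: "x \<in> F n"
      then have "x \<in> \<Union> (V ` T)" using T'(3) T(3) F_carrier tsp by blast
      then show "x \<in> (\<Union>p\<in>T. {x \<in> F n. inv p \<otimes> x \<in> W})" using x by (auto simp: V_def)
    qed
    then have "card (F n) \<le> card (\<Union>p\<in>T. {x \<in> F n. inv p \<otimes> x \<in> W})"
      using T(1) F_finite by (intro card_mono) auto
    also have "\<dots> \<le> (\<Sum>p\<in>T. card {x \<in> F n. inv p \<otimes> x \<in> W})" by (rule card_UN_le[OF T(1)])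
    also have "\<dots> \<le> (\<Sum>p\<in>T. card (F n \<inter> W))"
    proof (rule sum_mono)
      fix p assume "p \<in> T"
      then have p: "p \<in> F n" using m F_mono[OF n] by auto
      show "card {x \<in> F n. inv p \<otimes> x \<in> W} \<le> card (F n \<inter> W)"
      proof (rule card_inj_on_le[where f = "\<lambda>x. inv p \<otimes> x"])
        show "inj_on (\<lambda>x. inv p \<otimes> x) {x \<in> F n. inv p \<otimes> x \<in> W}"
          using p F_carrier by (auto simp: inj_on_def)
        show "(\<lambda>x. inv p \<otimes> x) ` {x \<in> F n. inv p \<otimes> x \<in> W} \<subseteq> F n \<inter> W"
          using p subgroup.m_closed[OF F_subgroup] subgroup.m_inv_closed[OF F_subgroup] by auto
        show "finite (F n \<inter> W)" using F_finite by simp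
      qed
    qed
    finally show ?thesis by simp
  qed
  have "\<forall>\<^sub>F n in sequentially. real (card (F n)) \<le> (real (card T) + 1) * real (card (F n \<inter> W))"
  proof -
    have "real (card (F n)) \<le> (real (card T) + 1) * real (card (F n \<inter> W))" if "n \<ge> m" for n
    proof -
      have "real (card (F n)) \<le> real (card T * card (F n \<inter> W))"
        using \<open>\<And>n. n \<ge> m \<Longrightarrow> card (F n) \<le> card T * card (F n \<inter> W)\<close>[OF that] by (rule of_nat_mono)
      then show ?thesis by (simp add: distrib_right)
    qed
    then show ?thesis by (auto simp: eventually_sequentially)
  qed
  \<comment> \<open>The added 1 makes the constant positive without a separate proof that
    \<open>T\<close> is nonempty.\<close>
  then show ?thesis using that[of "real (card T) + 1"] by simp
qed

text \<open>The tube lemma around X times the identity: compactness of X yields one neighbourhood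
  \<open>W\<close> that serves all \<open>x\<close>.\<close>

lemma uniformly_continuous:
  fixes g :: "'a \<Rightarrow> complex"
  assumes g: "continuous_map X euclidean g" and e: "e > 0"
  obtains W where "openin X W" "\<one> \<in> W" "\<And>x w. x \<in> carrier G \<Longrightarrow> w \<in> W \<Longrightarrow> cmod (g (x \<otimes> w) - g x) < e"
proof -
  define N where "N = {p \<in> topspace (prod_topology X X). g (fst p \<otimes> snd p) - g (fst p) \<in> ball 0 e}"
  have "continuous_map (prod_topology X X) euclidean (\<lambda>p. g (fst p \<otimes> snd p) - g (fst p))"
    using continuous_map_compose[OF mult_cont g] continuous_map_compose[OF continuous_map_fst g, of X]
    by (intro continuous_map_diff) (auto simp: o_def)
  then have N: "openin (prod_topology X X) N" unfolding N_def
    by (rule openin_continuous_map_preimage) simp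
  have "topspace X \<times> {\<one>} \<subseteq> N" using e by (auto simp: N_def tsp)
  then obtain U W where UW: "openin X U" "openin X W" "topspace X \<subseteq> U" "{\<one>} \<subseteq> W" "U \<times> W \<subseteq> N"
    using Wallace_theorem_prod_topology[of X "topspace X" X "{\<one>}" N] N compact
    by (auto simp: compact_space_def tsp)
  have "cmod (g (x \<otimes> w) - g x) < e" if "x \<in> carrier G" "w \<in> W" for x w
  proof -
    have "(x, w) \<in> N" using UW that tsp by auto
    then show ?thesis by (simp add: N_def)
  qed
  then show ?thesis using that[of W] UW by auto
qed

text \<open>The bound is non-strict because only such bounds survive pointwise limits, to which this
  criterion is applied.\<close>

lemma continuous_if_uniform:
  fixes h :: "'a \<Rightarrow> complex"
  assumes "\<And>e. e > 0 \<Longrightarrow> \<exists>W. openin X W \<and> \<one> \<in> W \<and> (\<forall>x\<in>carrier G. \<forall>w\<in>W. cmod (h (x \<otimes> w) - h x) \<le> e)"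
  shows "continuous_map X euclidean h"
  unfolding continuous_map_def
proof (intro conjI allI impI)
  fix V :: "complex set" assume "openin euclidean V"
  then have V: "open V" by simp
  show "openin X {x \<in> topspace X. h x \<in> V}"
  proof (subst openin_subopen, intro ballI)
    fix x assume "x \<in> {x \<in> topspace X. h x \<in> V}"
    then have x: "x \<in> carrier G" "h x \<in> V" by (auto simp: tsp)
    obtain e where e: "e > 0" "ball (h x) e \<subseteq> V" using V x(2) open_contains_ball by blast
    obtain W where W: "openin X W" "\<one> \<in> W" "\<And>x w. x \<in> carrier G \<Longrightarrow> w \<in> W \<Longrightarrow> cmod (h (x \<otimes> w) - h x) \<le> e / 2"
      using assms[of "e / 2"] e by auto
    let ?T = "{y \<in> carrier G. inv x \<otimes> y \<in> W}"
    have "openin X ?T" using open_translate[OF W(1)] x by simp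
    moreover have "x \<in> ?T" using x W by simp
    moreover have "?T \<subseteq> {x \<in> topspace X. h x \<in> V}"
    proof
      fix y assume y: "y \<in> ?T"
      have "cmod (h (x \<otimes> (inv x \<otimes> y)) - h x) \<le> e / 2" using W(3) x y by blast
      then have "cmod (h y - h x) < e" using x y e by (simp add: m_assoc[symmetric])
      then have "h y \<in> ball (h x) e" by (simp add: dist_norm norm_minus_commute)
      then show "y \<in> {x \<in> topspace X. h x \<in> V}" using e y by (auto simp: tsp)
    qed
    ultimately show "\<exists>T. openin X T \<and> x \<in> T \<and> T \<subseteq> {x \<in> topspace X. h x \<in> V}" by blast
  qed
qed simp

end

section \<open>Construction of a nontrivial continuous character\<close>

lemma continuous_map_complex_mult:
  fixes f g :: "'a \<Rightarrow> complex"
  shows "continuous_map X euclidean f \<Longrightarrow> continuous_map X euclidean g \<Longrightarrow> continuous_map X euclidean (\<lambda>x. f x * g x)"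
  by (simp add: continuous_map_atin tendsto_mult)

context compact_group_dense_finite
begin

text \<open>Values outside the carrier are left free here, unlike in \<open>circle_chars\<close>:
  continuous characters are combined pointwise and never counted.\<close>

definition cchar :: "('a \<Rightarrow> complex) \<Rightarrow> bool" where
  "cchar \<theta> \<longleftrightarrow> continuous_map X euclidean \<theta> \<and> (\<forall>x\<in>carrier G. cmod (\<theta> x) = 1) \<and>
     (\<forall>x\<in>carrier G. \<forall>y\<in>carrier G. \<theta> (x \<otimes> y) = \<theta> x * \<theta> y)"

text \<open>The function \<open>h\<close> is the component of \<open>g\<close> along \<theta>: an
  eigenfunction for translations by \<open>F n\<close>, defined on all of X. None of the conclusions
  mentions \<theta>, so they can pass to a limit in which \<theta> varies with \<open>n\<close>;
  multiplicativity is therefore phrased through \<open>h\<close> alone. The last bound holds because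
  the coefficient of a difference along \<open>s\<close> carries the factor 1 - \<theta> s.\<close>

lemma averaged_eigenfunction:
  fixes b :: "'a \<Rightarrow> real"
  assumes s: "s \<in> F n" and b: "\<And>x. x \<in> carrier G \<Longrightarrow> \<bar>b x\<bar> \<le> 1"
    and \<theta>: "\<theta> \<in> circle_chars (G\<lparr>carrier := F n\<rparr>)"
    and g: "\<And>x. g x = complex_of_real (b x - b (x \<otimes> s))" and g1: "\<And>x. x \<in> carrier G \<Longrightarrow> cmod (g x) \<le> 1"
    and h: "h = (\<lambda>x. if x \<in> carrier G then (\<Sum>f\<in>F n. g (x \<otimes> f) * cnj (\<theta> f)) / of_nat (card (F n)) else 0)"
    and \<delta>: "\<delta> * real (card (F n)) \<le> cmod (\<Sum>f\<in>F n. g f * cnj (\<theta> f))" "\<delta> \<ge> 0"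
  shows "cmod (h x) \<le> 1" "\<delta> \<le> cmod (h \<one>)"
    "x \<in> carrier G \<Longrightarrow> f \<in> F n \<Longrightarrow> h (x \<otimes> f) * h \<one> = h x * h f"
    "f \<in> F n \<Longrightarrow> cmod (h f) = cmod (h \<one>)"
    "x \<in> carrier G \<Longrightarrow> w \<in> carrier G \<Longrightarrow> (\<And>x. x \<in> carrier G \<Longrightarrow> cmod (g (x \<otimes> w) - g x) \<le> e) \<Longrightarrow>
       cmod (h (x \<otimes> w) - h x) \<le> e"
    "\<delta>\<^sup>2 \<le> cmod (h s - h \<one>)"
proof -
  interpret S: subgroup "F n" G by (rule F_subgroup)
  let ?N = "card (F n)"
  have N: "?N > 0" by (rule card_F_pos)
  have cm: "cmod (\<theta> f) = 1" if "f \<in> F n" for f using circle_charsD(2)[OF \<theta>] that by simp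
  have mul: "\<theta> (f \<otimes> f') = \<theta> f * \<theta> f'" if "f \<in> F n" "f' \<in> F n" for f f'
    using circle_charsD(3)[OF \<theta>] that by simp
  have norm1: "\<theta> f * cnj (\<theta> f) = 1" if "f \<in> F n" for f
    using cm[OF that] by (simp add: complex_norm_square[symmetric])
  have shift: "(\<Sum>f\<in>F n. k (f \<otimes> f') * cnj (\<theta> f)) = \<theta> f' * (\<Sum>f\<in>F n. k f * cnj (\<theta> f))"
    if f': "f' \<in> F n" for k f'
  proof -
    have "bij_betw (\<lambda>f. f \<otimes> f') (F n) (F n)"
      by (rule bij_betwI[where g = "\<lambda>f. f \<otimes> inv f'"]) (use f' in \<open>auto simp: m_assoc\<close>)
    then have "(\<Sum>f\<in>F n. k f * cnj (\<theta> f)) = (\<Sum>f\<in>F n. k (f \<otimes> f') * cnj (\<theta> (f \<otimes> f')))"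
      by (rule sum.reindex_bij_betw[symmetric])
    also have "\<theta> f' * \<dots> = (\<Sum>f\<in>F n. k (f \<otimes> f') * cnj (\<theta> f) * (\<theta> f' * cnj (\<theta> f')))"
      unfolding sum_distrib_left by (rule sum.cong) (use f' in \<open>auto simp: mul mult_ac\<close>)
    also have "\<dots> = (\<Sum>f\<in>F n. k (f \<otimes> f') * cnj (\<theta> f))" by (simp add: norm1 f')
    finally show ?thesis by simp
  qed
  have hx: "h x = (\<Sum>f\<in>F n. g (x \<otimes> f) * cnj (\<theta> f)) / of_nat ?N" if "x \<in> carrier G" for x
    using that h by simp
  have h1: "h \<one> = (\<Sum>f\<in>F n. g f * cnj (\<theta> f)) / of_nat ?N"
    by (simp add: hx)
  have eig: "h (x \<otimes> f) = \<theta> f * h x" if x: "x \<in> carrier G" and f: "f \<in> F n" for x f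
  proof -
    have "h (x \<otimes> f) = (\<Sum>f'\<in>F n. g (x \<otimes> (f' \<otimes> f)) * cnj (\<theta> f')) / of_nat ?N"
    proof -
      have "x \<otimes> f \<otimes> f' = x \<otimes> (f' \<otimes> f)" if "f' \<in> F n" for f'
        using x f that by (simp add: m_assoc m_comm[of f f'])
      then show ?thesis using x f by (simp add: hx)
    qed
    then show ?thesis using shift[OF f, of "\<lambda>y. g (x \<otimes> y)"] by (simp add: hx x)
  qed
  have hf: "h f = \<theta> f * h \<one>" if "f \<in> F n" for f using eig[of \<one> f] that by simp
  show "h (x \<otimes> f) * h \<one> = h x * h f" if "x \<in> carrier G" "f \<in> F n"
    using eig[OF that] hf[OF that(2)] by simp
  show "cmod (h f) = cmod (h \<one>)" if "f \<in> F n" using hf[OF that] cm[OF that] by (simp add: norm_mult)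
  show le1: "cmod (h x) \<le> 1"
  proof (cases "x \<in> carrier G")
    case True
    have "cmod (\<Sum>f\<in>F n. g (x \<otimes> f) * cnj (\<theta> f)) \<le> (\<Sum>f\<in>F n. 1)"
      by (rule sum_norm_le) (use True in \<open>auto simp: norm_mult cm intro!: g1\<close>)
    then show ?thesis using N True by (simp add: hx norm_divide divide_le_eq)
  qed (simp add: h)
  show hd: "\<delta> \<le> cmod (h \<one>)" using \<delta> N by (simp add: h1 norm_divide le_divide_eq)
  show "cmod (h (x \<otimes> w) - h x) \<le> e"
    if x: "x \<in> carrier G" and w: "w \<in> carrier G" and le: "\<And>x. x \<in> carrier G \<Longrightarrow> cmod (g (x \<otimes> w) - g x) \<le> e"
  proof -
    have "(\<Sum>f\<in>F n. g (x \<otimes> w \<otimes> f) * cnj (\<theta> f)) - (\<Sum>f\<in>F n. g (x \<otimes> f) * cnj (\<theta> f))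
        = (\<Sum>f\<in>F n. (g (x \<otimes> f \<otimes> w) - g (x \<otimes> f)) * cnj (\<theta> f))"
      unfolding sum_subtractf[symmetric]
    proof (rule sum.cong[OF refl])
      fix f assume "f \<in> F n"
      then have "x \<otimes> w \<otimes> f = x \<otimes> f \<otimes> w" using x w by (simp add: m_assoc m_comm[of w f])
      then show "g (x \<otimes> w \<otimes> f) * cnj (\<theta> f) - g (x \<otimes> f) * cnj (\<theta> f) = (g (x \<otimes> f \<otimes> w) - g (x \<otimes> f)) * cnj (\<theta> f)"
        by (simp add: algebra_simps)
    qed
    moreover have "cmod \<dots> \<le> (\<Sum>f\<in>F n. e)"
      by (rule sum_norm_le) (use x w in \<open>auto simp: norm_mult cm intro!: le\<close>)
    ultimately have "cmod ((\<Sum>f\<in>F n. g (x \<otimes> w \<otimes> f) * cnj (\<theta> f)) - (\<Sum>f\<in>F n. g (x \<otimes> f) * cnj (\<theta> f))) \<le> e * real ?N"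
      by (simp add: mult.commute)
    then show ?thesis using N x w by (simp add: hx diff_divide_distrib[symmetric] norm_divide divide_le_eq)
  qed
  have "(\<Sum>f\<in>F n. g f * cnj (\<theta> f)) = (1 - \<theta> s) * (\<Sum>f\<in>F n. of_real (b f) * cnj (\<theta> f))"
    using shift[OF s, of "\<lambda>x. of_real (b x)"] by (simp add: g algebra_simps sum_subtractf)
  moreover have "cmod (\<Sum>f\<in>F n. of_real (b f) * cnj (\<theta> f)) \<le> (\<Sum>f\<in>F n. 1)"
    by (rule sum_norm_le) (auto simp: norm_mult cm intro!: b)
  ultimately have "cmod (\<Sum>f\<in>F n. g f * cnj (\<theta> f)) \<le> cmod (1 - \<theta> s) * real ?N"
    by (simp add: norm_mult mult_left_mono)
  then have "\<delta> * real ?N \<le> cmod (1 - \<theta> s) * real ?N" using \<delta>(1) by linarith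
  then have "\<delta> \<le> cmod (1 - \<theta> s)" using N by simp
  then have "\<delta> * \<delta> \<le> cmod (1 - \<theta> s) * cmod (h \<one>)" using hd \<delta>(2) by (intro mult_mono) auto
  also have "\<dots> = cmod (h s - h \<one>)"
    by (simp add: hf[OF s] norm_mult[symmetric] norm_minus_commute left_diff_distrib)
  finally show "\<delta>\<^sup>2 \<le> cmod (h s - h \<one>)" by (simp add: power2_eq_square)
qed

text \<open>At the identity the autocorrelation of \<open>g\<close> over \<open>F n\<close> is
  comparable to \<open>card (F n)\<close>, and uniform continuity keeps it so on a neighbourhood
  \<open>W\<close>. Since \<open>W\<close> holds a fixed proportion of \<open>F n\<close>, the bound
  of \<open>exists_large_fourier_coefficient\<close> does not degenerate as \<open>n\<close>
  grows.\<close>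

lemma uniform_large_coefficient:
  fixes g :: "'a \<Rightarrow> complex"
  assumes g: "continuous_map X euclidean g" and g1: "\<And>x. x \<in> carrier G \<Longrightarrow> cmod (g x) \<le> 1" and "cmod (g \<one>) = 1"
  obtains \<delta> where "\<delta> > 0" "\<forall>\<^sub>F n in sequentially. \<exists>\<theta>\<in>circle_chars (G\<lparr>carrier := F n\<rparr>).
     \<delta> * real (card (F n)) \<le> cmod (\<Sum>f\<in>F n. g f * cnj (\<theta> f))"
proof -
  define U where "U = {x \<in> topspace X. g x \<in> - cball 0 (1/2)}"
  have "openin X U" unfolding U_def by (rule openin_continuous_map_preimage[OF g]) (simp add: open_Compl)
  moreover have "\<one> \<in> U" using assms(3) by (simp add: U_def tsp)
  ultimately obtain K1 where K1: "K1 > 0" "\<forall>\<^sub>F n in sequentially. real (card (F n)) \<le> K1 * real (card (F n \<inter> U))"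
    using F_meets_open by (metis empty_iff)
  \<comment> \<open>On \<open>U\<close> the square of \<open>cmod (g x)\<close> is at least 1/4, and
    \<open>U\<close> holds the proportion 1/K1 of \<open>F n\<close>; so \<open>c\<close> bounds the
    mean square of \<open>g\<close> from below.\<close>
  define c where "c = 1 / (4 * K1)"
  have c: "c > 0" using K1 by (simp add: c_def)
  obtain W where W: "openin X W" "\<one> \<in> W" "\<And>x w. x \<in> carrier G \<Longrightarrow> w \<in> W \<Longrightarrow> cmod (g (x \<otimes> w) - g x) < c / 2"
    using uniformly_continuous[OF g, of "c / 2"] c by auto
  obtain K2 where K2: "K2 > 0" "\<forall>\<^sub>F n in sequentially. real (card (F n)) \<le> K2 * real (card (F n \<inter> W))"
    using F_meets_open[OF W(1)] W(2) by (metis empty_iff)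
  \<comment> \<open>Chosen so that \<open>\<delta>\<^sup>2 * K2 = (c / 2)\<^sup>2\<close>: the
    autocorrelation is at least \<open>card (F n) * c / 2\<close> on \<open>W\<close>, which holds
    the proportion 1/K2 of \<open>F n\<close>.\<close>
  define \<delta> where "\<delta> = c / (2 * sqrt K2)"
  have \<delta>: "\<delta> > 0" using c K2 by (simp add: \<delta>_def)
  have \<delta>2: "\<delta>\<^sup>2 * K2 = (c / 2)\<^sup>2" using K2 by (simp add: \<delta>_def power_divide power_mult_distrib)
  have "\<forall>\<^sub>F n in sequentially. \<exists>\<theta>\<in>circle_chars (G\<lparr>carrier := F n\<rparr>).
     \<delta> * real (card (F n)) \<le> cmod (\<Sum>f\<in>F n. g f * cnj (\<theta> f))"
    using K1(2) K2(2)
  proof eventually_elim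
    case (elim n)
    interpret S: subgroup "F n" G by (rule F_subgroup)
    interpret H: comm_group "G\<lparr>carrier := F n\<rparr>"
      by (rule group.group_comm_groupI[OF S.subgroup_is_group[OF group_axioms]]) (simp add: m_comm)
    let ?N = "real (card (F n))"
    have N: "?N > 0" using card_F_pos by simp
    define S2 where "S2 = (\<Sum>x\<in>F n. (cmod (g x))\<^sup>2)"
    define \<Phi> where "\<Phi> x = (\<Sum>y\<in>F n. g (x \<otimes> y) * cnj (g y))" for x
    obtain \<theta> where \<theta>: "\<theta> \<in> circle_chars (G\<lparr>carrier := F n\<rparr>)"
      and le: "(\<Sum>x\<in>F n. (cmod (\<Phi> x))\<^sup>2) \<le> (cmod (\<Sum>x\<in>F n. g x * cnj (\<theta> x)))\<^sup>2 * S2"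
      using H.exists_large_fourier_coefficient[of g] F_finite by (auto simp: S2_def \<Phi>_def)
    have "S2 \<le> (\<Sum>x\<in>F n. 1)" unfolding S2_def
      by (rule sum_mono) (use g1 in \<open>auto simp: power_le_one\<close>)
    then have S2: "S2 \<le> ?N" by simp
    have "?N * c \<le> real (card (F n \<inter> U)) / 4" using elim(1) K1(1) by (simp add: c_def field_simps)
    also have "\<dots> = (\<Sum>x\<in>F n \<inter> U. 1/4)" by simp
    also have "\<dots> \<le> (\<Sum>x\<in>F n \<inter> U. (cmod (g x))\<^sup>2)"
    proof (rule sum_mono)
      fix x assume "x \<in> F n \<inter> U"
      then have "1/2 \<le> cmod (g x)" by (simp add: U_def)
      then have "(1/2)\<^sup>2 \<le> (cmod (g x))\<^sup>2" by (intro power_mono) auto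
      then show "1/4 \<le> (cmod (g x))\<^sup>2" by (simp add: power2_eq_square)
    qed
    also have "\<dots> \<le> S2" unfolding S2_def by (rule sum_mono2) (use F_finite in auto)
    finally have S2l: "?N * c \<le> S2" .
    have \<Phi>: "?N * c / 2 \<le> cmod (\<Phi> x)" if x: "x \<in> F n \<inter> W" for x
    proof -
      have "cmod (\<Phi> x - (\<Sum>y\<in>F n. g y * cnj (g y))) \<le> (\<Sum>y\<in>F n. c / 2)"
        unfolding \<Phi>_def sum_subtractf[symmetric] left_diff_distrib[symmetric]
      proof (rule sum_norm_le)
        fix y assume y: "y \<in> F n"
        have "cmod (g (x \<otimes> y) - g y) < c / 2" using W(3)[of y x] x y m_comm[of x y] by simp
        then have "cmod (g (x \<otimes> y) - g y) * cmod (g y) \<le> c / 2 * 1"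
          using g1[of y] y c by (intro mult_mono) auto
        then show "cmod ((g (x \<otimes> y) - g y) * cnj (g y)) \<le> c / 2" by (simp add: norm_mult)
      qed
      moreover have "(\<Sum>y\<in>F n. g y * cnj (g y)) = complex_of_real S2"
        unfolding S2_def of_real_sum complex_norm_square ..
      ultimately have "cmod (\<Phi> x - complex_of_real S2) \<le> ?N * (c / 2)" by simp
      moreover have "S2 \<le> cmod (\<Phi> x) + cmod (\<Phi> x - complex_of_real S2)"
        using norm_triangle_ineq2[of "complex_of_real S2" "\<Phi> x"] by (simp add: norm_minus_commute)
      ultimately show ?thesis using S2l by simp
    qed
    have "\<delta>\<^sup>2 * ?N ^ 3 \<le> \<delta>\<^sup>2 * (?N\<^sup>2 * (K2 * real (card (F n \<inter> W))))"
      using elim(2) by (intro mult_left_mono) (auto simp: power3_eq_cube power2_eq_square mult_left_mono)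
    also have "\<dots> = (?N * c / 2)\<^sup>2 * real (card (F n \<inter> W))"
    proof -
      have "\<delta>\<^sup>2 * (?N\<^sup>2 * (K2 * real (card (F n \<inter> W)))) = (\<delta>\<^sup>2 * K2) * ?N\<^sup>2 * real (card (F n \<inter> W))" by simp
      then show ?thesis unfolding \<delta>2 by (simp add: power_divide power_mult_distrib)
    qed
    also have "\<dots> = (\<Sum>x\<in>F n \<inter> W. (?N * c / 2)\<^sup>2)" by simp
    also have "\<dots> \<le> (\<Sum>x\<in>F n \<inter> W. (cmod (\<Phi> x))\<^sup>2)"
      by (rule sum_mono, rule power_mono) (use \<Phi> c in auto)
    also have "\<dots> \<le> (\<Sum>x\<in>F n. (cmod (\<Phi> x))\<^sup>2)" by (rule sum_mono2) (use F_finite in auto)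
    also have "\<dots> \<le> (cmod (\<Sum>x\<in>F n. g x * cnj (\<theta> x)))\<^sup>2 * S2" by (rule le)
    also have "\<dots> \<le> (cmod (\<Sum>x\<in>F n. g x * cnj (\<theta> x)))\<^sup>2 * ?N" using S2 by (rule mult_left_mono) simp
    finally have "(\<delta> * ?N)\<^sup>2 * ?N \<le> (cmod (\<Sum>x\<in>F n. g x * cnj (\<theta> x)))\<^sup>2 * ?N"
      by (simp add: power_mult_distrib power3_eq_cube power2_eq_square mult_ac)
    then have "(\<delta> * ?N)\<^sup>2 \<le> (cmod (\<Sum>x\<in>F n. g x * cnj (\<theta> x)))\<^sup>2" using N by simp
    then have "\<delta> * ?N \<le> cmod (\<Sum>x\<in>F n. g x * cnj (\<theta> x))" by (rule power2_le_imp_le) simp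
    then show ?case using \<theta> by blast
  qed
  then show ?thesis using that \<delta> by blast
qed

theorem exists_nontrivial_character:
  assumes "carrier G \<noteq> {\<one>}"
  obtains \<theta> s where "cchar \<theta>" "s \<in> carrier G" "\<theta> s \<noteq> 1"
proof -
  have "closedin X {\<one>}" using closedin_Hausdorff_singleton[OF hausdorff] by (simp add: tsp)
  then have "openin X (topspace X - {\<one>})" by blast
  moreover have "topspace X - {\<one>} \<noteq> {}" using assms tsp by auto
  ultimately obtain n0 s where s: "s \<in> F n0" "s \<noteq> \<one>" using F_dense by blast
  have sG: "s \<in> carrier G" using F_carrier s by blast
  have "normal_space X" using compact_Hausdorff_or_regular_imp_normal_space compact hausdorff by blast
  moreover have "closedin X {s}" using closedin_Hausdorff_singleton[OF hausdorff] sG by (simp add: tsp)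
  ultimately obtain b where b: "continuous_map X (top_of_set {0..1::real}) b" "b ` {\<one>} \<subseteq> {0}" "b ` {s} \<subseteq> {1}"
    using Urysohn_lemma[of X "{\<one>}" "{s}" 0 1] \<open>closedin X {\<one>}\<close> s(2) by (auto simp: disjnt_def)
  have b01: "0 \<le> b x \<and> b x \<le> 1" if "x \<in> carrier G" for x
    using b(1) that by (auto simp: continuous_map_in_subtopology tsp)
  have bc: "continuous_map X euclidean b" using b(1) by (simp add: continuous_map_in_subtopology)
  \<comment> \<open>Here b is 0 at the identity and 1 at \<open>s\<close>, so \<open>g\<close> has
    modulus 1 at the identity, as the bound on its coefficients requires.\<close>
  define g where "g x = complex_of_real (b x - b (x \<otimes> s))" for x
  have "continuous_map X X (\<lambda>x. x \<otimes> s)" by (rule continuous_mult) (auto simp: tsp sG)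
  then have "continuous_map X euclidean (\<lambda>x. b (x \<otimes> s))"
    using continuous_map_compose[OF _ bc] by (auto simp: o_def)
  then have "continuous_map X euclidean (\<lambda>x. b x - b (x \<otimes> s))" by (intro continuous_map_diff bc)
  from continuous_map_compose[OF this, of euclidean complex_of_real]
  have g: "continuous_map X euclidean g" unfolding g_def
    by (simp add: o_def continuous_on_of_real continuous_on_id)
  have g1: "cmod (g x) \<le> 1" if "x \<in> carrier G" for x
    using b01[OF that] b01[of "x \<otimes> s"] that sG unfolding g_def norm_of_real by auto
  have "cmod (g \<one>) = 1" using b sG by (simp add: g_def)
  then obtain \<delta> where \<delta>: "\<delta> > 0" and ev: "\<forall>\<^sub>F n in sequentially. \<exists>\<theta>\<in>circle_chars (G\<lparr>carrier := F n\<rparr>).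
     \<delta> * real (card (F n)) \<le> cmod (\<Sum>f\<in>F n. g f * cnj (\<theta> f))"
    using uniform_large_coefficient[OF g g1] by blast
  have "\<exists>W. e > 0 \<longrightarrow> openin X W \<and> \<one> \<in> W \<and> (\<forall>x\<in>carrier G. \<forall>w\<in>W. cmod (g (x \<otimes> w) - g x) \<le> e)" for e
  proof (cases "e > 0")
    case True
    obtain W where "openin X W" "\<one> \<in> W" "\<And>x w. x \<in> carrier G \<Longrightarrow> w \<in> W \<Longrightarrow> cmod (g (x \<otimes> w) - g x) < e"
      using uniformly_continuous[OF g True] by blast
    then show ?thesis by (intro exI[of _ W]) (auto intro: less_imp_le)
  qed simp
  then have "\<forall>e. \<exists>W. e > 0 \<longrightarrow> openin X W \<and> \<one> \<in> W \<and> (\<forall>x\<in>carrier G. \<forall>w\<in>W. cmod (g (x \<otimes> w) - g x) \<le> e)" ..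
  \<comment> \<open>One neighbourhood per \<open>e\<close>, fixed before \<open>n\<close>, so that
    all the approximating functions share a modulus of continuity.\<close>
  from choice[OF this] obtain W where
    "\<forall>e. e > 0 \<longrightarrow> openin X (W e) \<and> \<one> \<in> W e \<and> (\<forall>x\<in>carrier G. \<forall>w\<in>W e. cmod (g (x \<otimes> w) - g x) \<le> e)" ..
  then have W: "\<And>e. e > 0 \<Longrightarrow> openin X (W e)" "\<And>e. e > 0 \<Longrightarrow> \<one> \<in> W e"
    "\<And>e x w. e > 0 \<Longrightarrow> x \<in> carrier G \<Longrightarrow> w \<in> W e \<Longrightarrow> cmod (g (x \<otimes> w) - g x) \<le> e"
    by blast+
  have WG: "w \<in> carrier G" if "e > 0" "w \<in> W e" for e w using openin_subset[OF W(1)] that tsp by blast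
  \<comment> \<open>Every clause is an equation or a non-strict inequality between finitely many
    values of \<open>h\<close>, hence preserved under pointwise limits.\<close>
  define Q where "Q n h \<longleftrightarrow> (\<forall>x. cmod (h x) \<le> 1) \<and> \<delta> \<le> cmod (h \<one>) \<and>
     (\<forall>x\<in>carrier G. \<forall>f\<in>F n. h (x \<otimes> f) * h \<one> = h x * h f) \<and> (\<forall>f\<in>F n. cmod (h f) = cmod (h \<one>)) \<and>
     (\<forall>e>0. \<forall>x\<in>carrier G. \<forall>w\<in>W e. cmod (h (x \<otimes> w) - h x) \<le> e) \<and> \<delta>\<^sup>2 \<le> cmod (h s - h \<one>)" for n h
  have "\<forall>\<^sub>F n in sequentially. \<exists>h. Q n h"
    using ev eventually_ge_at_top[of n0]
  proof eventually_elim
    case (elim n)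
    then obtain \<theta> where \<theta>: "\<theta> \<in> circle_chars (G\<lparr>carrier := F n\<rparr>)"
      "\<delta> * real (card (F n)) \<le> cmod (\<Sum>f\<in>F n. g f * cnj (\<theta> f))" by blast
    have sn: "s \<in> F n" using s(1) F_mono[OF elim(2)] by blast
    define h where "h = (\<lambda>x. if x \<in> carrier G then (\<Sum>f\<in>F n. g (x \<otimes> f) * cnj (\<theta> f)) / of_nat (card (F n)) else 0)"
    have babs: "\<bar>b x\<bar> \<le> 1" if "x \<in> carrier G" for x using b01[OF that] by auto
    note * = averaged_eigenfunction[OF sn babs \<theta>(1) g_def g1 h_def \<theta>(2) less_imp_le[OF \<delta>]]
    have "cmod (h (x \<otimes> w) - h x) \<le> e" if "e > 0" "x \<in> carrier G" "w \<in> W e" for e x w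
      by (rule *(5)) (use that WG W(3) in auto)
    then have "Q n h" unfolding Q_def using *(1-4,6) by auto
    then show ?case by blast
  qed
  then obtain n1 where n1: "\<And>n. n \<ge> n1 \<Longrightarrow> \<exists>h. Q n h" by (auto simp: eventually_sequentially)
  define H where "H n = (if n \<ge> n1 then (SOME h. Q n h) else (\<lambda>_. 0))" for n
  have QH: "Q n (H n)" if "n \<ge> n1" for n using someI_ex[OF n1[OF that]] that by (simp add: H_def)
  have "cmod (H n x) \<le> 1" for n x using QH[of n] by (cases "n \<ge> n1") (auto simp: Q_def H_def)
  then obtain U h where U: "U \<le> sequentially" "U \<noteq> bot" and lim: "\<And>x. ((\<lambda>n. H n x) \<longlongrightarrow> h x) U"
    using pointwise_cluster_point[of H] by blast
  have evU: "\<forall>\<^sub>F n in U. n \<ge> m" for m using filter_leD[OF U(1) eventually_ge_at_top] .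
  have Uev: "\<forall>\<^sub>F n in U. P n" if "\<And>n. n \<ge> n1 \<Longrightarrow> n \<ge> m \<Longrightarrow> Q n (H n) \<Longrightarrow> P n" for P m
    using evU[of "max n1 m"] by eventually_elim (use that QH in auto)
  have h1: "\<delta> \<le> cmod (h \<one>)"
    by (rule tendsto_lowerbound[OF tendsto_norm[OF lim] _ U(2)]) (rule Uev, auto simp: Q_def)
  then have h10: "h \<one> \<noteq> 0" using \<delta> by auto
  have hs: "\<delta>\<^sup>2 \<le> cmod (h s - h \<one>)"
    by (rule tendsto_lowerbound[OF tendsto_norm[OF tendsto_diff[OF lim lim]] _ U(2)]) (rule Uev, auto simp: Q_def)
  have he: "cmod (h (x \<otimes> w) - h x) \<le> e" if "e > 0" "x \<in> carrier G" "w \<in> W e" for e x w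
    by (rule tendsto_upperbound[OF tendsto_norm[OF tendsto_diff[OF lim lim]] _ U(2)])
       (rule Uev, use that in \<open>auto simp: Q_def\<close>)
  have hcont: "continuous_map X euclidean h"
  proof (rule continuous_if_uniform)
    fix e :: real assume "e > 0"
    then show "\<exists>W. openin X W \<and> \<one> \<in> W \<and> (\<forall>x\<in>carrier G. \<forall>w\<in>W. cmod (h (x \<otimes> w) - h x) \<le> e)"
      using W(1,2) he by (intro exI[of _ "W e"]) auto
  qed
  \<comment> \<open>For fixed \<open>f\<close> the relation holds for all large \<open>n\<close>,
    because the groups increase; so it holds in the limit, and density later replaces
    \<open>f\<close> by an arbitrary element.\<close>
  have hmF: "h (x \<otimes> f) * h \<one> = h x * h f" if "x \<in> carrier G" "f \<in> F m" for x f m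
  proof (rule tendsto_unique[OF U(2)])
    show "((\<lambda>n. H n (x \<otimes> f) * H n \<one>) \<longlongrightarrow> h (x \<otimes> f) * h \<one>) U" by (intro tendsto_mult lim)
    have "((\<lambda>n. H n x * H n f) \<longlongrightarrow> h x * h f) U" by (intro tendsto_mult lim)
    moreover have "\<forall>\<^sub>F n in U. H n x * H n f = H n (x \<otimes> f) * H n \<one>"
    proof (rule Uev[of m])
      fix n assume "n \<ge> m" "Q n (H n)"
      moreover have "f \<in> F n" using that F_mono[OF \<open>n \<ge> m\<close>] by blast
      ultimately show "H n x * H n f = H n (x \<otimes> f) * H n \<one>" using that unfolding Q_def by simp
    qed
    ultimately show "((\<lambda>n. H n (x \<otimes> f) * H n \<one>) \<longlongrightarrow> h x * h f) U" by (rule Lim_transform_eventually)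
  qed
  have hnF: "cmod (h f) = cmod (h \<one>)" if "f \<in> F m" for f m
  proof (rule tendsto_unique[OF U(2)])
    show "((\<lambda>n. cmod (H n f)) \<longlongrightarrow> cmod (h f)) U" by (intro tendsto_norm lim)
    have "((\<lambda>n. cmod (H n \<one>)) \<longlongrightarrow> cmod (h \<one>)) U" by (intro tendsto_norm lim)
    moreover have "\<forall>\<^sub>F n in U. cmod (H n \<one>) = cmod (H n f)"
    proof (rule Uev[of m])
      fix n assume "n \<ge> m" "Q n (H n)"
      moreover have "f \<in> F n" using that F_mono[OF \<open>n \<ge> m\<close>] by blast
      ultimately show "cmod (H n \<one>) = cmod (H n f)" using that unfolding Q_def by simp
    qed
    ultimately show "((\<lambda>n. cmod (H n f)) \<longlongrightarrow> cmod (h \<one>)) U" by (rule Lim_transform_eventually)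
  qed
  have hm: "h (x \<otimes> y) * h \<one> = h x * h y" if x: "x \<in> carrier G" and y: "y \<in> carrier G" for x y
  proof -
    have "continuous_map X euclidean (\<lambda>y. h (x \<otimes> y))"
      using continuous_map_compose[OF continuous_translation[OF x] hcont] by (simp add: o_def)
    then have "continuous_map X euclidean (\<lambda>y. h (x \<otimes> y) * h \<one> - h x * h y)"
      by (intro continuous_map_diff continuous_map_complex_mult hcont) auto
    from zero_on_F_imp_zero[OF this _ y] show ?thesis using hmF[OF x] by auto
  qed
  have hn: "cmod (h x) = cmod (h \<one>)" if x: "x \<in> carrier G" for x
  proof -
    have "continuous_map X euclidean (\<lambda>x. complex_of_real (cmod (h x) - cmod (h \<one>)))"
      using continuous_map_compose[OF hcont, of euclidean "\<lambda>z. complex_of_real (cmod z - cmod (h \<one>))"]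
      by (simp add: o_def continuous_intros)
    from zero_on_F_imp_zero[OF this _ x] show ?thesis using hnF by auto
  qed
  define \<theta> where "\<theta> x = h x * inverse (h \<one>)" for x
  have "cchar \<theta>" unfolding cchar_def
  proof (intro conjI ballI)
    show "continuous_map X euclidean \<theta>" unfolding \<theta>_def by (intro continuous_map_complex_mult hcont) auto
    show "cmod (\<theta> x) = 1" if "x \<in> carrier G" for x
      using hn[OF that] h10 by (simp add: \<theta>_def norm_mult norm_inverse)
    show "\<theta> (x \<otimes> y) = \<theta> x * \<theta> y" if "x \<in> carrier G" "y \<in> carrier G" for x y
      using hm[OF that] h10 by (simp add: \<theta>_def field_simps)
  qed
  moreover have "\<theta> s \<noteq> 1"
  proof
    assume "\<theta> s = 1"
    then have "h s = h \<one>" using h10 by (simp add: \<theta>_def field_simps)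
    then show False using hs \<delta> by simp
  qed
  ultimately show ?thesis using that sG by blast
qed

end

section \<open>Realising prescribed character values\<close>

text \<open>Pairs of trigonometric polynomials with the same coefficients, the first one twisted by \<open>\<eta>\<close>.\<close>

inductive twisted_pair :: "'a set \<Rightarrow> ('g \<Rightarrow> 'a \<Rightarrow> complex) \<Rightarrow> ('g \<Rightarrow> complex) \<Rightarrow> ('a \<Rightarrow> complex) \<Rightarrow> ('a \<Rightarrow> complex) \<Rightarrow> bool"
  for A \<psi> \<eta> where
  monomial: "(\<And>x. x \<in> A \<Longrightarrow> u x = c * \<psi> g x * cnj (\<eta> g)) \<Longrightarrow> (\<And>x. x \<in> A \<Longrightarrow> v x = c * \<psi> g x) \<Longrightarrow>
    twisted_pair A \<psi> \<eta> u v"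
| add: "twisted_pair A \<psi> \<eta> u v \<Longrightarrow> twisted_pair A \<psi> \<eta> u' v' \<Longrightarrow>
    twisted_pair A \<psi> \<eta> (\<lambda>x. u x + u' x) (\<lambda>x. v x + v' x)"

lemma twisted_pair_mult:
  fixes \<psi> :: "'g::ab_group_add \<Rightarrow> 'a \<Rightarrow> complex"
  assumes \<psi>: "\<And>g h x. x \<in> A \<Longrightarrow> \<psi> (g + h) x = \<psi> g x * \<psi> h x"
    and \<eta>: "\<And>g h. \<eta> (g + h) = \<eta> g * \<eta> h"
    and "twisted_pair A \<psi> \<eta> u v" "twisted_pair A \<psi> \<eta> u' v'"
  shows "twisted_pair A \<psi> \<eta> (\<lambda>x. u x * u' x) (\<lambda>x. v x * v' x)"
  using assms(3)
proof (induction rule: twisted_pair.induct)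
  case (monomial u c g v)
  show ?case using assms(4)
  proof (induction rule: twisted_pair.induct)
    case (monomial u' c' g' v')
    show ?case
      by (rule twisted_pair.monomial[where c = "c * c'" and g = "g + g'"])
         (simp_all add: monomial \<open>\<And>x. x \<in> A \<Longrightarrow> u x = c * \<psi> g x * cnj (\<eta> g)\<close> \<open>\<And>x. x \<in> A \<Longrightarrow> v x = c * \<psi> g x\<close> \<psi> \<eta>)
  next
    case (add u1 v1 u2 v2)
    then show ?case using twisted_pair.add[OF add.IH] by (simp add: distrib_left)
  qed
next
  case (add u1 v1 u2 v2)
  then show ?case using twisted_pair.add[OF add.IH] by (simp add: distrib_right)
qed

lemma power_ratio_bounded_imp:
  fixes r r' K :: real
  assumes "0 < r" "\<And>k::nat. r' ^ k \<le> K * r ^ k"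
  shows "r' \<le> r"
proof (rule ccontr)
  assume "\<not> r' \<le> r"
  then have "1 < r' / r" using assms(1) by simp
  then obtain k where "K < (r' / r) ^ k" using real_arch_pow by blast
  then have "K * r ^ k < r' ^ k" using assms(1) by (simp add: power_divide field_simps)
  then show False using assms(2)[of k] by simp
qed

context compact_group_dense_finite
begin

lemma ccharD:
  assumes "cchar \<theta>"
  shows "continuous_map X euclidean \<theta>"
    and "x \<in> carrier G \<Longrightarrow> cmod (\<theta> x) = 1"
    and "x \<in> carrier G \<Longrightarrow> y \<in> carrier G \<Longrightarrow> \<theta> (x \<otimes> y) = \<theta> x * \<theta> y"
  using assms by (auto simp: cchar_def)

lemma cchar_one:
  assumes "cchar \<theta>" shows "\<theta> \<one> = 1"
proof -
  have "\<theta> \<one> * \<theta> \<one> = \<theta> \<one>" using ccharD(3)[OF assms, of \<one> \<one>] by simp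
  moreover have "\<theta> \<one> \<noteq> 0" using ccharD(2)[OF assms, of \<one>] by auto
  ultimately show ?thesis by simp
qed

lemma sum_cchar_F:
  assumes \<theta>: "cchar \<theta>" and s: "s \<in> F n" "\<theta> s \<noteq> 1"
  shows "(\<Sum>x\<in>F n. \<theta> x) = 0"
proof -
  interpret S: subgroup "F n" G by (rule F_subgroup)
  have "bij_betw (\<lambda>x. s \<otimes> x) (F n) (F n)"
    by (rule bij_betwI[where g = "\<lambda>x. inv s \<otimes> x"]) (use s in \<open>auto simp: m_assoc[symmetric]\<close>)
  then have "(\<Sum>x\<in>F n. \<theta> x) = (\<Sum>x\<in>F n. \<theta> (s \<otimes> x))" by (rule sum.reindex_bij_betw[symmetric])
  also have "\<dots> = \<theta> s * (\<Sum>x\<in>F n. \<theta> x)"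
    unfolding sum_distrib_left by (rule sum.cong) (use s ccharD(3)[OF \<theta>] in auto)
  finally have "(1 - \<theta> s) * (\<Sum>x\<in>F n. \<theta> x) = 0" by (simp add: algebra_simps)
  then show ?thesis using s by simp
qed

text \<open>A nontrivial character is nontrivial on some \<open>F m\<close>, so its sums over all
  later groups vanish and the twist is invisible; for a trivial one the twisting factor is 1. The
  threshold depends on the characters involved, hence the filter.\<close>

lemma sum_twisted_pair:
  assumes \<psi>: "\<And>g. cchar (\<psi> g)" and ker: "\<And>g. (\<And>x. x \<in> carrier G \<Longrightarrow> \<psi> g x = 1) \<Longrightarrow> \<eta> g = 1"
    and "twisted_pair (carrier G) \<psi> \<eta> u v"
  shows "\<forall>\<^sub>F n in sequentially. (\<Sum>x\<in>F n. u x) = (\<Sum>x\<in>F n. v x)"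
  using assms(3)
proof (induction rule: twisted_pair.induct)
  case (monomial u c g v)
  have sums: "(\<Sum>x\<in>F n. u x) = c * cnj (\<eta> g) * (\<Sum>x\<in>F n. \<psi> g x)" "(\<Sum>x\<in>F n. v x) = c * (\<Sum>x\<in>F n. \<psi> g x)" for n
    unfolding sum_distrib_left
    by (intro sum.cong; use monomial F_carrier in auto)+
  show ?case
  proof (cases "\<forall>x\<in>carrier G. \<psi> g x = 1")
    case True
    then have "\<eta> g = 1" using ker by blast
    then show ?thesis by (simp add: sums)
  next
    case False
    have "\<exists>m. \<exists>s\<in>F m. \<psi> g s \<noteq> 1"
    proof (rule ccontr)
      assume neg: "\<not> ?thesis"
      have "continuous_map X euclidean (\<lambda>x. \<psi> g x - 1)"
        using ccharD(1)[OF \<psi>] by (intro continuous_map_diff) auto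
      from zero_on_F_imp_zero[OF this] neg False show False by auto
    qed
    then obtain m s where s: "s \<in> F m" "\<psi> g s \<noteq> 1" by blast
    have "(\<Sum>x\<in>F n. u x) = (\<Sum>x\<in>F n. v x)" if "n \<ge> m" for n
      using sum_cchar_F[OF \<psi>, of s n g] s F_mono[OF that] by (auto simp: sums)
    then show ?thesis by (auto simp: eventually_sequentially)
  qed
next
  case (add u v u' v')
  from add.IH show ?case by eventually_elim (simp add: sum.distrib)
qed

text \<open>If no point realises the values \<open>\<eta>\<close> on \<open>S\<close>, the twisted kernel \<open>q\<close> stays below some \<open>r < 1\<close>,
  while the untwisted kernel \<open>q0\<close> equals 1 at the identity; so the averages of their high powers
  over the finite subgroups differ, although the two kernels have the same resonant coefficients.\<close>

theorem exists_point_with_character_values: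
  fixes \<psi> :: "'g::ab_group_add \<Rightarrow> 'a \<Rightarrow> complex"
  assumes \<psi>: "\<And>g. cchar (\<psi> g)" and add: "\<And>g h x. x \<in> carrier G \<Longrightarrow> \<psi> (g + h) x = \<psi> g x * \<psi> h x"
    and \<eta>: "\<And>g h. \<eta> (g + h) = \<eta> g * \<eta> h" "\<And>g. cmod (\<eta> g) = 1"
    and ker: "\<And>g. (\<And>x. x \<in> carrier G \<Longrightarrow> \<psi> g x = 1) \<Longrightarrow> \<eta> g = 1"
    and S: "finite S"
  shows "\<exists>x\<in>carrier G. \<forall>g\<in>S. \<psi> g x = \<eta> g"
proof (rule ccontr)
  assume none: "\<not> ?thesis"
  let ?tp = "twisted_pair (carrier G) \<psi> \<eta>"
  have \<eta>0: "\<eta> 0 = 1" using \<eta>(1)[of 0 0] \<eta>(2)[of 0] by auto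
  have \<psi>0: "\<psi> 0 x = 1" if "x \<in> carrier G" for x
    using add[OF that, of 0 0] ccharD(2)[OF \<psi> that, of 0] by auto
  have cnj_eq: "w = cnj z" if "w * z = 1" "cmod z = 1" for w z :: complex
  proof -
    have "cnj z * z = 1" using that(2) by (simp add: complex_norm_square[symmetric] mult.commute)
    moreover have "z \<noteq> 0" using that(2) by auto
    ultimately show ?thesis using that(1) by (metis mult_right_cancel)
  qed
  have \<psi>m: "\<psi> (- g) x = cnj (\<psi> g x)" if "x \<in> carrier G" for g x
    using add[OF that, of "- g" g] \<psi>0[OF that] by (intro cnj_eq ccharD(2)[OF \<psi> that]) simp
  have \<eta>m: "\<eta> (- g) = cnj (\<eta> g)" for g
    using \<eta>(1)[of "- g" g] \<eta>0 by (intro cnj_eq \<eta>(2)) simp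
  \<comment> \<open>This lies between 0 and 1 and equals 1 only where
    \<open>\<psi> g x = \<eta> g\<close>; as a trigonometric polynomial it involves the indices 0, g
    and -g. The untwisted \<open>b\<close> has the same coefficients.\<close>
  define a where "a g x = (1 + Re (\<psi> g x * cnj (\<eta> g))) / 2" for g x
  define b where "b g x = (1 + Re (\<psi> g x)) / 2" for g x
  define q where "q x = (\<Prod>g\<in>S. a g x)" for x
  define q0 where "q0 x = (\<Prod>g\<in>S. b g x)" for x
  have re: "complex_of_real ((1 + Re z) / 2) = 1/2 + (z / 4 + cnj z / 4)" for z
    by (simp add: complex_eq_iff)
  have const: "?tp (\<lambda>_. c) (\<lambda>_. c)" for c
    by (rule twisted_pair.monomial[where c = c and g = 0]) (auto simp: \<eta>0 \<psi>0)
  have "?tp (\<lambda>x. 1/2 + (\<psi> g x * cnj (\<eta> g) / 4 + cnj (\<psi> g x * cnj (\<eta> g)) / 4))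
            (\<lambda>x. 1/2 + (\<psi> g x / 4 + cnj (\<psi> g x) / 4))" for g
    by (intro twisted_pair.add const twisted_pair.monomial[where c = "1/4" and g = g]
          twisted_pair.monomial[where c = "1/4" and g = "- g"]) (auto simp: \<psi>m \<eta>m)
  then have tab: "?tp (\<lambda>x. complex_of_real (a g x)) (\<lambda>x. complex_of_real (b g x))" for g
    unfolding a_def b_def re by simp
  have "?tp (\<lambda>x. complex_of_real (\<Prod>g\<in>T. a g x)) (\<lambda>x. complex_of_real (\<Prod>g\<in>T. b g x))" if "finite T" for T
    using that
  proof induction
    case empty
    then show ?case using const[of 1] by simp
  next
    case (insert g T)
    from twisted_pair_mult[OF add \<eta>(1) tab[of g] insert.IH] insert.hyps show ?case by simp
  qed
  then have tq: "?tp (\<lambda>x. complex_of_real (q x)) (\<lambda>x. complex_of_real (q0 x))"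
    using S by (simp add: q_def q0_def)
  have "?tp (\<lambda>x. complex_of_real (q x ^ k)) (\<lambda>x. complex_of_real (q0 x ^ k))" for k
  proof (induction k)
    case 0
    then show ?case using const[of 1] by simp
  next
    case (Suc k)
    from twisted_pair_mult[OF add \<eta>(1) tq Suc] show ?case by simp
  qed
  from sum_twisted_pair[OF \<psi> ker this]
  have eqs: "\<forall>\<^sub>F n in sequentially. (\<Sum>x\<in>F n. q x ^ k) = (\<Sum>x\<in>F n. q0 x ^ k)" for k
    by (simp only: of_real_sum[symmetric] of_real_eq_iff)
  have Re1: "\<bar>Re z\<bar> \<le> 1" if "cmod z = 1" for z using abs_Re_le_cmod[of z] that by simp
  have a01: "0 \<le> a g x \<and> a g x \<le> 1" "0 \<le> b g x \<and> b g x \<le> 1" if "x \<in> carrier G" for g x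
  proof -
    have "\<bar>Re (\<psi> g x * cnj (\<eta> g))\<bar> \<le> 1" "\<bar>Re (\<psi> g x)\<bar> \<le> 1"
      by (rule Re1, simp add: norm_mult ccharD(2)[OF \<psi> that] \<eta>(2))+
    moreover have "0 \<le> (1 + r) / 2 \<and> (1 + r) / 2 \<le> 1" if "\<bar>r\<bar> \<le> 1" for r :: real
      using that by (auto simp: abs_le_iff)
    ultimately show "0 \<le> a g x \<and> a g x \<le> 1" "0 \<le> b g x \<and> b g x \<le> 1"
      unfolding a_def b_def by blast+
  qed
  have q01: "0 \<le> q x" "0 \<le> q0 x" if "x \<in> carrier G" for x
    using a01[OF that] by (auto simp: q_def q0_def intro!: prod_nonneg)
  have q_less: "q x < 1" if x: "x \<in> carrier G" for x
  proof -
    obtain g where g: "g \<in> S" "\<psi> g x \<noteq> \<eta> g" using none x by blast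
    have "a g x < 1"
    proof (rule ccontr)
      assume "\<not> ?thesis"
      then have "Re (\<psi> g x * cnj (\<eta> g)) = 1" using a01(1)[OF x, of g] by (simp add: a_def)
      moreover have "cmod (\<psi> g x * cnj (\<eta> g)) = 1" using ccharD(2)[OF \<psi> x] \<eta>(2) by (simp add: norm_mult)
      moreover have "z = 1" if "Re z = 1" "cmod z = 1" for z
        using cmod_power2[of z] that by (simp add: complex_eq_iff)
      ultimately have "\<psi> g x * cnj (\<eta> g) = 1" by blast
      then have "\<psi> g x = cnj (cnj (\<eta> g))" by (rule cnj_eq) (simp add: \<eta>(2))
      then show False using g by simp
    qed
    moreover have "(\<Prod>g\<in>S - {g}. a g x) \<le> 1" by (rule prod_le_1) (use a01[OF x] in auto)
    moreover have "0 \<le> a g x" using a01[OF x] by blast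
    ultimately have "a g x * (\<Prod>g\<in>S - {g}. a g x) < 1"
      using mult_left_mono[of "\<Prod>g\<in>S - {g}. a g x" 1 "a g x"] by simp
    then show ?thesis using S g(1) by (simp add: q_def prod.remove)
  qed
  have cont: "continuous_map X euclidean (\<lambda>x. Re (\<psi> g x * c))" for g c
  proof -
    have "continuous_map euclidean euclidean (\<lambda>z. Re (z * c))"
      unfolding continuous_map_iff_continuous2 by (intro continuous_intros)
    from continuous_map_compose[OF ccharD(1)[OF \<psi>[of g]] this] show ?thesis by (simp only: o_def)
  qed
  have half: "continuous_map X euclidean (\<lambda>x. (1 + Re (\<psi> g x * c)) / 2)" for g c
    by (intro continuous_map_real_divide continuous_map_add cont) auto
  have qcont: "continuous_map X euclidean q" unfolding q_def a_def
    by (rule continuous_map_prod[OF S half])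
  have q0cont: "continuous_map X euclidean q0" unfolding q0_def b_def
    using continuous_map_prod[OF S half[of _ 1]] by (simp only: mult_1_right)
  obtain \<rho> where \<rho>: "\<rho> < 1" "\<And>x. x \<in> carrier G \<Longrightarrow> q x \<le> \<rho>"
  proof -
    have "compactin euclidean (q ` topspace X)"
      using image_compactin[OF _ qcont] compact by (simp add: compact_space_def)
    then have "compact (q ` carrier G)" by (simp add: tsp)
    moreover have "q ` carrier G \<noteq> {}" by auto
    ultimately obtain x where "x \<in> carrier G" "\<And>y. y \<in> carrier G \<Longrightarrow> q y \<le> q x"
      using compact_attains_sup[of "q ` carrier G"] by auto
    then show ?thesis using that q_less by blast
  qed
  \<comment> \<open>The value 1/2 keeps \<open>r\<close> positive, as
    \<open>power_ratio_bounded_imp\<close> requires; \<open>r'\<close> lies strictly between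
    \<open>r\<close> and 1, so that \<open>q0\<close> exceeds it near the identity.\<close>
  define r where "r = max \<rho> (1/2)"
  define r' where "r' = (1 + r) / 2"
  have r: "0 < r" "r < 1" "r < r'" "r' < 1" using \<rho> by (auto simp: r_def r'_def)
  define W where "W = {x \<in> topspace X. q0 x \<in> {r'<..}}"
  have "openin X W" unfolding W_def by (rule openin_continuous_map_preimage[OF q0cont]) simp
  moreover have "\<one> \<in> W" using r by (simp add: W_def tsp q0_def b_def cchar_one[OF \<psi>])
  ultimately obtain K where K: "K > 0" "\<forall>\<^sub>F n in sequentially. real (card (F n)) \<le> K * real (card (F n \<inter> W))"
    using F_meets_open by (metis empty_iff)
  have "r' ^ k \<le> K * r ^ k" for k
  proof -
    \<comment> \<open>The group used depends on \<open>k\<close>, as higher powers involve more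
      characters; \<open>K\<close> does not, and so \<open>k\<close> can be arbitrary in the final
      comparison.\<close>
    obtain n where n: "(\<Sum>x\<in>F n. q x ^ k) = (\<Sum>x\<in>F n. q0 x ^ k)" "real (card (F n)) \<le> K * real (card (F n \<inter> W))"
      using eventually_happens[OF eventually_conj[OF eqs[of k] K(2)]] by auto
    have "r' ^ k * real (card (F n)) \<le> r' ^ k * (K * real (card (F n \<inter> W)))"
      using n(2) r by (intro mult_left_mono) auto
    also have "\<dots> = K * (\<Sum>x\<in>F n \<inter> W. r' ^ k)" by simp
    also have "(\<Sum>x\<in>F n \<inter> W. r' ^ k) \<le> (\<Sum>x\<in>F n \<inter> W. q0 x ^ k)"
      by (rule sum_mono, rule power_mono) (use r in \<open>auto simp: W_def\<close>)
    also have "\<dots> \<le> (\<Sum>x\<in>F n. q0 x ^ k)"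
      by (rule sum_mono2) (use F_finite q01 F_carrier in auto)
    also have "\<dots> = (\<Sum>x\<in>F n. q x ^ k)" by (simp add: n(1))
    also have "\<dots> \<le> (\<Sum>x\<in>F n. r ^ k)"
    proof (rule sum_mono, rule power_mono)
      fix x assume "x \<in> F n"
      then have "x \<in> carrier G" by (rule F_carrier)
      then show "q x \<le> r" "0 \<le> q x" using \<rho>(2)[of x] q01(1)[of x] by (simp_all add: r_def)
    qed
    also have "\<dots> = r ^ k * real (card (F n))" by simp
    finally have "r' ^ k * real (card (F n)) \<le> K * r ^ k * real (card (F n))" using K(1) by simp
    then show ?thesis using card_F_pos[of n] by simp
  qed
  then have "r' \<le> r" by (rule power_ratio_bounded_imp[OF r(1)])
  then show False using r by simp
qed

end

section \<open>Fixed point groups and commutativity\<close>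

lemma zit_closed:
  assumes "bij_betw f S S" "x \<in> S"
  shows "zit S f n x \<in> S"
proof -
  have "(f ^^ k) x \<in> S" "(inv_into S f ^^ k) x \<in> S" for k
    using assms by (induction k) (auto simp: bij_betw_apply bij_betw_inv_into[THEN bij_betw_apply])
  then show ?thesis by (simp add: zit_def)
qed

lemma zit_0 [simp]: "zit S f 0 x = x"
  by (simp add: zit_def)

lemma zit_plus_1:
  assumes "bij_betw f S S" "x \<in> S"
  shows "zit S f (n + 1) x = f (zit S f n x)"
proof (cases "n \<ge> 0")
  case True
  then show ?thesis by (simp add: zit_def nat_add_distrib)
next
  case False
  then obtain k where k: "n = - int (Suc k)" by (metis negD not_le)
  have "zit S f (- int k) x = (inv_into S f ^^ k) x" by (simp add: zit_def)
  moreover have "(inv_into S f ^^ k) x \<in> S" using zit_closed[OF assms, of "- int k"] calculation by simp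
  then have "f (inv_into S f ((inv_into S f ^^ k) x)) = (inv_into S f ^^ k) x"
    using assms(1) by (intro bij_betw_inv_into_right)
  ultimately show ?thesis using k by (simp add: zit_def nat_add_distrib)
qed

lemma zit_add:
  assumes "bij_betw f S S" "x \<in> S"
  shows "zit S f (m + n) x = zit S f m (zit S f n x)"
proof (induction m rule: int_induct[where k = 0])
  case (step1 m)
  have "zit S f (m + 1 + n) x = f (zit S f (m + n) x)"
    using zit_plus_1[OF assms, of "m + n"] by (simp add: add_ac)
  then show ?case using step1 zit_plus_1[OF assms(1) zit_closed[OF assms]] by simp
next
  case (step2 m)
  have "f (zit S f (m - 1 + n) x) = f (zit S f (m - 1) (zit S f n x))"
    using zit_plus_1[OF assms, of "m - 1 + n"] zit_plus_1[OF assms(1) zit_closed[OF assms], of "m - 1" n] step2 by simp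
  then show ?case using assms zit_closed[OF assms(1)] by (meson bij_betw_imp_inj_on inj_onD)
qed simp

section \<open>Automorphisms of compact groups with the CAM property\<close>

locale cam_group = group G for G (structure) +
  fixes X :: "'a topology" and \<alpha> :: "'a \<Rightarrow> 'a"
  assumes top_group: "topological_group G X" and iso: "\<alpha> \<in> iso G G" and CAM: "CAM X \<alpha>"
begin

lemma topspace_eq: "topspace X = carrier G"
  using top_group by (simp add: topological_group_def)

lemma compact_X: "compact_space X" and hausdorff_X: "Hausdorff_space X" and homeo: "homeomorphic_map X X \<alpha>"
  using CAM by (auto simp: CAM_def zsystem_def metrizable_imp_Hausdorff_space)

lemma finite_if_invariant: "closedin X A \<Longrightarrow> \<alpha> ` A = A \<Longrightarrow> A \<noteq> carrier G \<Longrightarrow> finite A"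
  using CAM by (auto simp: CAM_def topspace_eq)

lemma alpha_bij: "bij_betw \<alpha> (carrier G) (carrier G)"
  using iso by (simp add: iso_def)

lemma alpha_mult: "x \<in> carrier G \<Longrightarrow> y \<in> carrier G \<Longrightarrow> \<alpha> (x \<otimes> y) = \<alpha> x \<otimes> \<alpha> y"
  using iso by (simp add: iso_def hom_def)

lemma alpha_closed [simp]: "x \<in> carrier G \<Longrightarrow> \<alpha> x \<in> carrier G"
  using alpha_bij by (rule bij_betw_apply)

lemma alpha_inj: "x \<in> carrier G \<Longrightarrow> y \<in> carrier G \<Longrightarrow> \<alpha> x = \<alpha> y \<longleftrightarrow> x = y"
  using alpha_bij by (meson bij_betw_imp_inj_on inj_on_eq_iff)

lemma alpha_surj: "x \<in> carrier G \<Longrightarrow> \<exists>y\<in>carrier G. x = \<alpha> y"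
  using alpha_bij by (metis bij_betw_imp_surj_on imageE)

lemma invariant_image:
  assumes "A \<subseteq> carrier G" "\<And>x. x \<in> carrier G \<Longrightarrow> \<alpha> x \<in> A \<longleftrightarrow> x \<in> A"
  shows "\<alpha> ` A = A"
proof
  show "\<alpha> ` A \<subseteq> A" using assms by auto
  show "A \<subseteq> \<alpha> ` A" using assms alpha_surj by blast
qed

abbreviation it :: "int \<Rightarrow> 'a \<Rightarrow> 'a" where "it \<equiv> zit (carrier G) \<alpha>"

lemmas it_closed [simp] = zit_closed[OF alpha_bij]
lemmas it_plus_1 = zit_plus_1[OF alpha_bij]
lemmas it_add = zit_add[OF alpha_bij]

lemma it_alpha: "x \<in> carrier G \<Longrightarrow> it n (\<alpha> x) = it (n + 1) x"
  using it_add[of x n 1] it_plus_1[of x 0] by simp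

lemma it_mult:
  assumes "x \<in> carrier G" "y \<in> carrier G"
  shows "it n (x \<otimes> y) = it n x \<otimes> it n y"
proof (induction n rule: int_induct[where k = 0])
  case (step1 n)
  then show ?case using assms by (simp add: it_plus_1 alpha_mult)
next
  case (step2 n)
  have "\<alpha> (it (n - 1) (x \<otimes> y)) = \<alpha> (it (n - 1) x \<otimes> it (n - 1) y)"
    using step2 assms it_plus_1[of _ "n - 1"] by (simp add: alpha_mult)
  then show ?case using assms by (simp add: alpha_inj)
qed simp

lemma it_one [simp]: "it n \<one> = \<one>"
proof -
  have "it n \<one> \<otimes> it n \<one> = it n \<one>" using it_mult[of \<one> \<one> n] by simp
  then show ?thesis using r_cancel_one[of "it n \<one>" "it n \<one>"] by simp
qed

lemma it_inv: "x \<in> carrier G \<Longrightarrow> it n (inv x) = inv (it n x)"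
  using it_mult[of "inv x" x n] by (intro inv_equality[symmetric]) auto

lemma it_continuous: "continuous_map X X (it n)"
proof -
  have a: "continuous_map X X \<alpha>" using homeo by (rule homeomorphic_imp_continuous_map)
  obtain \<beta> where \<beta>: "homeomorphic_maps X X \<alpha> \<beta>" using homeo homeomorphic_map_maps by blast
  then have b: "continuous_map X X \<beta>" by (simp add: homeomorphic_maps_def)
  have eq: "inv_into (carrier G) \<alpha> x = \<beta> x" if "x \<in> carrier G" for x
  proof (rule inv_into_f_eq)
    show "inj_on \<alpha> (carrier G)" using alpha_bij by (rule bij_betw_imp_inj_on)
    show "\<beta> x \<in> carrier G" using b that topspace_eq by (auto simp: continuous_map_def)
    show "\<alpha> (\<beta> x) = x" using \<beta> that topspace_eq by (auto simp: homeomorphic_maps_def)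
  qed
  have "continuous_map X X (inv_into (carrier G) \<alpha>)"
    by (rule continuous_map_eq[OF b]) (simp add: eq topspace_eq)
  then have "continuous_map X X (\<alpha> ^^ k)" "continuous_map X X (inv_into (carrier G) \<alpha> ^^ k)" for k
    using a by (induction k) (auto intro: continuous_map_compose simp: id_def)
  then show ?thesis by (simp add: zit_def)
qed

lemma it_multiple:
  assumes "x \<in> carrier G" "it k x = x"
  shows "it (k * int m) x = x"
proof (induction m)
  case (Suc m)
  have "it (k * int (Suc m)) x = it (k + k * int m) x" by (simp add: algebra_simps)
  also have "\<dots> = x" using Suc assms it_add[OF assms(1)] by simp
  finally show ?case .
qed simp

lemma faithful: "(\<And>x. x \<in> carrier G \<Longrightarrow> it n x = x) \<Longrightarrow> n = 0"
  using CAM unfolding CAM_def faithful_action_def topspace_eq by blast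

text \<open>On a finite carrier two iterates would coincide, and the difference of their exponents
  would contradict faithfulness.\<close>

lemma infinite_carrier: "infinite (carrier G)"
proof
  assume fin: "finite (carrier G)"
  define r where "r n = restrict (it (int n)) (carrier G)" for n
  have "range r \<subseteq> PiE (carrier G) (\<lambda>_. carrier G)" by (auto simp: r_def)
  then have "finite (range r)" using fin by (meson finite_PiE finite_subset)
  then have "\<not> inj r" using finite_imageD by auto
  then obtain i j where ij: "i < j" "r i = r j" unfolding inj_def by (metis linorder_neqE_nat)
  have "it (int j - int i) x = x" if x: "x \<in> carrier G" for x
  proof -
    define y where "y = it (- int i) x"
    have y: "y \<in> carrier G" using x by (simp add: y_def)
    have "x = it (int i) y" using it_add[OF x, of "int i" "- int i"] by (simp add: y_def)
    also have "\<dots> = it (int j) y" using ij(2) y by (metis r_def restrict_apply')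
    also have "\<dots> = it (int j - int i) (it (int i) y)" using it_add[OF y, of "int j - int i" "int i"] by simp
    also have "it (int i) y = x" using it_add[OF x, of "int i" "- int i"] by (simp add: y_def)
    finally show ?thesis by simp
  qed
  then have "int j - int i = 0" by (rule faithful)
  then show False using ij by simp
qed

lemma closed_fixed: "closedin X {x \<in> carrier G. it n x = x}"
  using closedin_continuous_maps_eq[OF hausdorff_X it_continuous[of n] continuous_map_id] by (simp add: topspace_eq)

text \<open>The factorial makes the groups nested and lets them exhaust the periodic points, since
  every positive period up to \<open>n\<close> divides \<open>fact n\<close>.\<close>

definition F :: "nat \<Rightarrow> 'a set" where "F n = {x \<in> carrier G. it (int (fact n)) x = x}"

lemma image_F: "\<alpha> ` F n = F n"
proof (rule invariant_image)
  fix x assume x: "x \<in> carrier G"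
  have "it (int (fact n)) (\<alpha> x) = \<alpha> (it (int (fact n)) x)" using x by (simp add: it_alpha it_plus_1)
  then show "\<alpha> x \<in> F n \<longleftrightarrow> x \<in> F n" using x by (simp add: F_def alpha_inj)
qed (auto simp: F_def)

text \<open>The set is closed and invariant, so only properness is at stake, and a nonzero power of
  \<alpha> equal to the identity would violate faithfulness.\<close>

lemma finite_F: "finite (F n)"
proof (rule finite_if_invariant[OF _ image_F])
  show "closedin X (F n)" unfolding F_def by (rule closed_fixed)
  show "F n \<noteq> carrier G"
  proof
    assume "F n = carrier G"
    then have "\<And>x. x \<in> carrier G \<Longrightarrow> it (int (fact n)) x = x" unfolding F_def by blast
    then have "int (fact n) = 0" by (rule faithful)
    then show False by simp
  qed
qed

lemma subgroup_F: "subgroup (F n) G"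
proof (rule subgroupI)
  have "\<one> \<in> F n" by (simp add: F_def)
  then show "F n \<noteq> {}" by blast
qed (auto simp: F_def it_mult it_inv)

lemma F_periodic_in: "x \<in> carrier G \<Longrightarrow> it (int k) x = x \<Longrightarrow> k > 0 \<Longrightarrow> k \<le> n \<Longrightarrow> x \<in> F n"
proof -
  assume x: "x \<in> carrier G" "it (int k) x = x" "k > 0" "k \<le> n"
  then have "k dvd fact n" by (intro dvd_fact) auto
  then obtain m where "fact n = k * m" by blast
  then have "int (fact n) = int k * int m" by (metis of_nat_mult)
  then show "x \<in> F n" using x it_multiple[of x "int k" m] by (simp add: F_def)
qed

lemma F_mono_Suc: "F n \<subseteq> F (Suc n)"
proof
  fix x assume x: "x \<in> F n"
  have "int (fact (Suc n)) = int (fact n) * int (Suc n)" by (simp add: algebra_simps)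
  then show "x \<in> F (Suc n)" using it_multiple[of x "int (fact n)" "Suc n"] x by (simp add: F_def)
qed

lemma orbit_finite_imp_period:
  assumes x: "x \<in> carrier G" and fin: "finite (range (\<lambda>n::int. it n x))"
  obtains k :: nat where "k > 0" "it (int k) x = x"
proof -
  have "finite (range (\<lambda>n::nat. it (int n) x))" by (rule finite_subset[OF _ fin]) auto
  then have "\<not> inj (\<lambda>n::nat. it (int n) x)" using finite_imageD by auto
  then obtain i j :: nat where ij: "i < j" "it (int i) x = it (int j) x"
    unfolding inj_def by (metis linorder_neqE_nat)
  have "it (int (j - i)) x = it (- int i) (it (int j) x)" using it_add[OF x, of "- int i" "int j"] ij(1)
    by (simp add: of_nat_diff)
  also have "\<dots> = x" using it_add[OF x, of "- int i" "int i"] ij(2) by simp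
  finally show ?thesis using that[of "j - i"] ij(1) by simp
qed

lemma dense_F: "openin X U \<Longrightarrow> U \<noteq> {} \<Longrightarrow> \<exists>n. F n \<inter> U \<noteq> {}"
proof -
  assume U: "openin X U" "U \<noteq> {}"
  then obtain u where u: "u \<in> U" by blast
  have cl: "X closure_of {x. periodic_point X \<alpha> x} = topspace X" using CAM by (simp add: CAM_def)
  have "u \<in> X closure_of {x. periodic_point X \<alpha> x}" unfolding cl using U u openin_subset by blast
  then obtain x where x: "periodic_point X \<alpha> x" "x \<in> U" using U(1) u by (auto simp: in_closure_of)
  then have xG: "x \<in> carrier G" by (simp add: periodic_point_def topspace_eq)
  have "{zit (topspace X) \<alpha> n x |n::int. True} = range (\<lambda>n::int. it n x)" by (auto simp: topspace_eq)
  then obtain k :: nat where "k > 0" "it (int k) x = x"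
    using orbit_finite_imp_period[OF xG] x(1) by (auto simp: periodic_point_def)
  then have "x \<in> F k" using F_periodic_in xG by blast
  then show ?thesis using x by blast
qed

lemma continuous_times:
  assumes "continuous_map Z X u" "continuous_map Z X v"
  shows "continuous_map Z X (\<lambda>z. u z \<otimes> v z)"
proof -
  have "continuous_map (prod_topology X X) X (\<lambda>p. fst p \<otimes> snd p)" using top_group by (simp add: topological_group_def)
  from continuous_map_compose[OF continuous_map_pairedI[OF assms] this] show ?thesis by (simp add: o_def)
qed

text \<open>By translation an isolated identity would make X discrete, and compactness would make it
  finite.\<close>

lemma one_not_open: "\<not> openin X {\<one>}"
proof
  assume o: "openin X {\<one>}"
  have "openin X {x}" if x: "x \<in> carrier G" for x
  proof -
    have "continuous_map X X (\<lambda>y. inv x \<otimes> y)" by (rule continuous_times) (use x in \<open>auto simp: topspace_eq\<close>)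
    from openin_continuous_map_preimage[OF this o]
    have "openin X {y \<in> carrier G. inv x \<otimes> y = \<one>}" by (simp add: topspace_eq)
    moreover have "{y \<in> carrier G. inv x \<otimes> y = \<one>} = {x}"
      using x by (auto simp: inv_solve_left')
    ultimately show ?thesis by simp
  qed
  then have "discrete_topology (carrier G) = X" by (simp add: discrete_topology_unique topspace_eq)
  then have "finite (carrier G)" using compact_X compact_space_discrete_topology[of "carrier G"] by simp
  then show False using infinite_carrier by simp
qed

text \<open>The union of all conjugates of the finite invariant set \<open>F n\<close> is closed and invariant.
  If it is everything, there are only finitely many conjugacy classes, all closed, and the identity
  is isolated; otherwise the centraliser of \<open>F n\<close> is infinite, hence everything.\<close>

lemma F_central:
  assumes f: "f \<in> F n" and x: "x \<in> carrier G"
  shows "x \<otimes> f = f \<otimes> x"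
proof -
  have FG: "f \<in> carrier G" if "f \<in> F n" for f using that by (simp add: F_def)
  define c where "c f g = g \<otimes> f \<otimes> inv g" for f g
  have cG: "c f g \<in> carrier G" if "f \<in> F n" "g \<in> carrier G" for f g using that FG by (simp add: c_def)
  define K where "K = (\<Union>f\<in>F n. c f ` carrier G)"
  have ccont: "continuous_map X X (c f)" if "f \<in> F n" for f
  proof -
    have "continuous_map X X (\<lambda>x. inv x)" using top_group by (simp add: topological_group_def)
    then show ?thesis unfolding c_def by (intro continuous_times) (use FG[OF that] in \<open>auto simp: topspace_eq\<close>)
  qed
  have cls: "closedin X (c f ` carrier G)" if "f \<in> F n" for f
    using image_compactin[OF _ ccont[OF that], of "carrier G"] compact_X compactin_imp_closedin[OF hausdorff_X]
    by (simp add: compact_space_def topspace_eq)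
  have Kclosed: "closedin X K" unfolding K_def using finite_F cls by (intro closedin_Union) auto
  have ac: "\<alpha> (c f g) = c (\<alpha> f) (\<alpha> g)" if "f \<in> F n" "g \<in> carrier G" for f g
  proof -
    have "\<alpha> (inv g) = inv (\<alpha> g)" using it_inv[OF that(2), of 1] it_plus_1[of _ 0] that by simp
    then show ?thesis using that FG by (simp add: c_def alpha_mult)
  qed
  have "\<alpha> ` K = K"
  proof
    show "\<alpha> ` K \<subseteq> K"
    proof
      fix y assume "y \<in> \<alpha> ` K"
      then obtain f g where fg: "f \<in> F n" "g \<in> carrier G" "y = \<alpha> (c f g)" by (auto simp: K_def)
      moreover have "\<alpha> f \<in> F n" using image_F fg(1) by blast
      ultimately show "y \<in> K" unfolding K_def using ac[of f g] alpha_closed[of g] by blast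
    qed
    show "K \<subseteq> \<alpha> ` K"
    proof
      fix y assume "y \<in> K"
      then obtain f g where fg: "f \<in> F n" "g \<in> carrier G" "y = c f g" by (auto simp: K_def)
      obtain f' where f': "f' \<in> F n" "f = \<alpha> f'" using image_F[of n] fg(1) by blast
      obtain g' where g': "g' \<in> carrier G" "g = \<alpha> g'" using alpha_surj fg(2) by blast
      have "y = \<alpha> (c f' g')" using ac[OF f'(1) g'(1)] fg f' g' by simp
      moreover have "c f' g' \<in> K" using f' g' by (auto simp: K_def)
      ultimately show "y \<in> \<alpha> ` K" by blast
    qed
  qed
  have KneG: "K \<noteq> carrier G"
  proof
    assume K: "K = carrier G"
    \<comment> \<open>Only the classes of nontrivial elements: a finite union of compact sets, whose
      complement is the identity alone.\<close>
    define U where "U = (\<Union>f\<in>F n - {\<one>}. c f ` carrier G)"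
    have "closedin X U" unfolding U_def using finite_F cls by (intro closedin_Union) auto
    moreover have "carrier G - U = {\<one>}"
    proof
      show "carrier G - U \<subseteq> {\<one>}"
      proof
        fix y assume y: "y \<in> carrier G - U"
        then have "y \<in> K" using K by simp
        then obtain f g where fg: "f \<in> F n" "g \<in> carrier G" "y = c f g" by (auto simp: K_def)
        then have "f = \<one>" using y by (auto simp: U_def)
        then show "y \<in> {\<one>}" using fg by (simp add: c_def)
      qed
      have "\<one> \<notin> U"
      proof
        assume "\<one> \<in> U"
        then obtain f g where fg: "f \<in> F n" "f \<noteq> \<one>" "g \<in> carrier G" "\<one> = c f g" unfolding U_def by blast
        have "g \<otimes> f = g" using fg FG[OF fg(1)] inv_solve_right[of \<one> "g \<otimes> f" g] by (simp add: c_def)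
        then show False using fg FG[OF fg(1)] by simp
      qed
      then show "{\<one>} \<subseteq> carrier G - U" by simp
    qed
    ultimately have "openin X {\<one>}" by (metis closedin_def topspace_eq)
    then show False using one_not_open by simp
  qed
  have finK: "finite K" by (rule finite_if_invariant[OF Kclosed \<open>\<alpha> ` K = K\<close> KneG])
  define Z where "Z = {y \<in> carrier G. \<forall>f\<in>F n. y \<otimes> f = f \<otimes> y}"
  have "Z = (\<Inter>f\<in>F n. {y \<in> topspace X. y \<otimes> f = f \<otimes> y})"
    using subgroup.one_closed[OF subgroup_F[of n]] by (auto simp: Z_def topspace_eq)
  moreover have "closedin X {y \<in> topspace X. y \<otimes> f = f \<otimes> y}" if "f \<in> F n" for f
    by (rule closedin_continuous_maps_eq[OF hausdorff_X]; rule continuous_times) (use FG[OF that] in \<open>auto simp: topspace_eq\<close>)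
  ultimately have Zclosed: "closedin X Z" using subgroup.one_closed[OF subgroup_F[of n]]
    by (simp only:) (intro closedin_INT, auto)
  have "\<alpha> ` Z = Z"
  proof (rule invariant_image)
    fix y assume y: "y \<in> carrier G"
    have "(\<forall>f\<in>F n. \<alpha> y \<otimes> f = f \<otimes> \<alpha> y) \<longleftrightarrow> (\<forall>f\<in>\<alpha> ` F n. \<alpha> y \<otimes> f = f \<otimes> \<alpha> y)" by (simp add: image_F)
    also have "\<dots> \<longleftrightarrow> (\<forall>f\<in>F n. \<alpha> (y \<otimes> f) = \<alpha> (f \<otimes> y))" using y FG by (simp add: alpha_mult)
    also have "\<dots> \<longleftrightarrow> (\<forall>f\<in>F n. y \<otimes> f = f \<otimes> y)" using y FG by (simp add: alpha_inj)
    finally show "\<alpha> y \<in> Z \<longleftrightarrow> y \<in> Z" using y by (simp add: Z_def)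
  qed (auto simp: Z_def)
  moreover have "infinite Z"
  proof
    assume finZ: "finite Z"
    \<comment> \<open>This records how \<open>g\<close> acts on \<open>F n\<close> by conjugation.
      Finiteness of \<open>K\<close> leaves finitely many such actions, and the quotient of two
      elements with the same action centralises \<open>F n\<close>.\<close>
    define \<tau> where "\<tau> g = restrict (\<lambda>f. c f g) (F n)" for g
    have "\<tau> ` carrier G \<subseteq> PiE (F n) (\<lambda>_. K)" by (auto simp: \<tau>_def K_def)
    then have "finite (\<tau> ` carrier G)" using finite_F finK by (meson finite_PiE finite_subset)
    then obtain g0 where g0: "g0 \<in> carrier G" "infinite {g \<in> carrier G. \<tau> g = \<tau> g0}"
      using pigeonhole_infinite[OF infinite_carrier] by auto
    have "(\<lambda>g. inv g0 \<otimes> g) ` {g \<in> carrier G. \<tau> g = \<tau> g0} \<subseteq> Z"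
    proof clarify
      fix g assume g: "g \<in> carrier G" "\<tau> g = \<tau> g0"
      have "inv g0 \<otimes> g \<otimes> f = f \<otimes> (inv g0 \<otimes> g)" if f: "f \<in> F n" for f
      proof -
        have "c f g = c f g0" using g(2) f by (metis \<tau>_def restrict_apply')
        then have "g \<otimes> f \<otimes> inv g \<otimes> g = g0 \<otimes> f \<otimes> inv g0 \<otimes> g" by (simp add: c_def)
        then have "g \<otimes> f = g0 \<otimes> f \<otimes> inv g0 \<otimes> g" using g(1) FG[OF f] by (simp add: m_assoc)
        then have "inv g0 \<otimes> (g \<otimes> f) = inv g0 \<otimes> (g0 \<otimes> (f \<otimes> (inv g0 \<otimes> g)))"
          using g(1) g0(1) FG[OF f] by (simp add: m_assoc)
        then show ?thesis using g(1) g0(1) FG[OF f] by (simp add: m_assoc[symmetric])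
      qed
      then show "inv g0 \<otimes> g \<in> Z" using g g0 by (simp add: Z_def)
    qed
    then have "finite ((\<lambda>g. inv g0 \<otimes> g) ` {g \<in> carrier G. \<tau> g = \<tau> g0})" using finZ finite_subset by blast
    moreover have "inj_on (\<lambda>g. inv g0 \<otimes> g) {g \<in> carrier G. \<tau> g = \<tau> g0}"
      using g0(1) by (auto simp: inj_on_def)
    ultimately show False using g0(2) finite_imageD by blast
  qed
  ultimately have "Z = carrier G" using finite_if_invariant[OF Zclosed] by blast
  then show ?thesis using f x by (auto simp: Z_def)
qed

lemma commutative:
  assumes x: "x \<in> carrier G" and y: "y \<in> carrier G"
  shows "x \<otimes> y = y \<otimes> x"
proof (rule ccontr)
  assume neq: "x \<otimes> y \<noteq> y \<otimes> x"
  have "closedin X {z \<in> topspace X. x \<otimes> z = z \<otimes> x}"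
    by (rule closedin_continuous_maps_eq[OF hausdorff_X]; rule continuous_times) (use x in \<open>auto simp: topspace_eq\<close>)
  then have "openin X (topspace X - {z \<in> topspace X. x \<otimes> z = z \<otimes> x})" by blast
  moreover have "y \<in> topspace X - {z \<in> topspace X. x \<otimes> z = z \<otimes> x}" using neq y by (simp add: topspace_eq)
  ultimately obtain n f where "f \<in> F n" "f \<in> topspace X - {z \<in> topspace X. x \<otimes> z = z \<otimes> x}"
    using dense_F by blast
  then show False using F_central x by auto
qed

end

sublocale cam_group \<subseteq> compact_group_dense_finite G X F
proof -
  have "comm_group G" by (rule group_comm_groupI) (rule commutative)
  moreover have "continuous_map (prod_topology X X) X (\<lambda>p. fst p \<otimes> snd p)"
    using top_group by (simp add: topological_group_def)
  ultimately show "compact_group_dense_finite G X F"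
    unfolding compact_group_dense_finite_def compact_group_dense_finite_axioms_def
    by (intro conjI allI impI) (auto simp: topspace_eq intro: compact_X hausdorff_X subgroup_F finite_F dense_F dest: subsetD[OF F_mono_Suc])
qed

section \<open>Itineraries and homoclinic points\<close>

lemma inverse_eq_cnj_if_unit: "cmod z = 1 \<Longrightarrow> inverse z = cnj z"
  by (rule inverse_unique) (simp add: complex_norm_square[symmetric])

context compact_group_dense_finite
begin

lemma cchar_trivial: "cchar (\<lambda>_. 1)"
  by (simp add: cchar_def)

lemma cchar_mult: "cchar \<theta> \<Longrightarrow> cchar \<theta>' \<Longrightarrow> cchar (\<lambda>x. \<theta> x * \<theta>' x)"
  by (auto simp: cchar_def norm_mult intro: continuous_map_complex_mult)

lemma cchar_pow: "cchar \<theta> \<Longrightarrow> cchar (\<lambda>x. \<theta> x ^ k)"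
  by (induction k) (auto simp: cchar_trivial cchar_mult)

lemma cchar_cnj:
  assumes "cchar \<theta>" shows "cchar (\<lambda>x. cnj (\<theta> x))"
proof -
  have "continuous_map euclidean euclidean cnj"
    unfolding continuous_map_iff_continuous2 by (intro continuous_intros)
  from continuous_map_compose[OF ccharD(1)[OF assms] this]
  have "continuous_map X euclidean (\<lambda>x. cnj (\<theta> x))" by (simp add: o_def)
  then show ?thesis using assms by (simp add: cchar_def)
qed

lemma cchar_cong:
  assumes "cchar \<theta>" "\<And>x. x \<in> carrier G \<Longrightarrow> \<theta> x = \<theta>' x"
  shows "cchar \<theta>'"
proof -
  have "continuous_map X euclidean \<theta>'"
    by (rule continuous_map_eq[OF ccharD(1)[OF assms(1)]]) (simp add: assms(2) tsp)
  moreover have "cmod (\<theta>' x) = 1" if "x \<in> carrier G" for x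
    using ccharD(2)[OF assms(1) that] assms(2)[OF that] by simp
  moreover have "\<theta>' (x \<otimes> y) = \<theta>' x * \<theta>' y" if "x \<in> carrier G" "y \<in> carrier G" for x y
    using ccharD(3)[OF assms(1) that] that by (simp add: assms(2))
  ultimately show ?thesis by (simp add: cchar_def)
qed

lemma cchar_powi:
  assumes "cchar \<theta>" shows "cchar (\<lambda>x. \<theta> x powi k)"
proof (cases "k \<ge> 0")
  case True
  then show ?thesis using cchar_pow[OF assms, of "nat k"] by (simp add: power_int_def)
next
  case False
  show ?thesis
  proof (rule cchar_cong[OF cchar_pow[OF cchar_cnj[OF assms], of "nat (- k)"]])
    fix x assume "x \<in> carrier G"
    then have "inverse (\<theta> x) = cnj (\<theta> x)" using ccharD(2)[OF assms] by (intro inverse_eq_cnj_if_unit)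
    then show "cnj (\<theta> x) ^ nat (- k) = \<theta> x powi k" using False by (simp add: power_int_def)
  qed
qed

lemma nontrivial_on_F:
  assumes "cchar \<theta>" "x \<in> carrier G" "\<theta> x \<noteq> 1"
  obtains n s where "s \<in> F n" "\<theta> s \<noteq> 1"
proof -
  have "continuous_map X euclidean (\<lambda>x. \<theta> x - 1)"
    using ccharD(1)[OF assms(1)] by (intro continuous_map_diff) auto
  then have "\<exists>n. \<exists>s\<in>F n. \<theta> s - 1 \<noteq> 0"
    using zero_on_F_imp_zero[of "\<lambda>x. \<theta> x - 1" x] assms(2,3) by auto
  then show ?thesis using that by auto
qed

lemma cchar_inv_mult:
  assumes "cchar \<theta>" "x \<in> carrier G" "y \<in> carrier G" "\<theta> x = \<theta> y"
  shows "\<theta> (x \<otimes> inv y) = 1"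
proof -
  have "\<theta> (x \<otimes> inv y) = \<theta> y * \<theta> (inv y)" using assms ccharD(3)[OF assms(1), of x "inv y"] by simp
  also have "\<dots> = \<theta> (y \<otimes> inv y)" using assms(3) ccharD(3)[OF assms(1), of y "inv y"] by simp
  finally show ?thesis using assms(3) cchar_one[OF assms(1)] by simp
qed

lemma infinite_Union_F:
  assumes "infinite (carrier G)"
  shows "infinite (\<Union>n. F n)"
proof
  assume fin: "finite (\<Union>n. F n)"
  have "closedin X {x}" if "x \<in> (\<Union>n. F n)" for x
    using that closedin_Hausdorff_singleton[OF hausdorff] F_carrier tsp by auto
  then have "closedin X (\<Union>x\<in>(\<Union>n. F n). {x})" using fin by (intro closedin_Union) auto
  then have "closedin X (\<Union>n. F n)" by simp
  then have o: "openin X (topspace X - (\<Union>n. F n))" by blast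
  have "topspace X - (\<Union>n. F n) \<noteq> {}"
  proof
    assume "topspace X - (\<Union>n. F n) = {}"
    then have "carrier G \<subseteq> (\<Union>n. F n)" by (simp add: tsp)
    then show False using finite_subset[OF _ fin] assms by simp
  qed
  then show False using F_dense[OF o] by blast
qed

end

section \<open>Itineraries, their relations and homoclinic points\<close>

context cam_group
begin

lemma cchar_it:
  assumes "cchar \<theta>" shows "cchar (\<lambda>x. \<theta> (it n x))"
proof -
  have "continuous_map X euclidean (\<lambda>x. \<theta> (it n x))"
    using continuous_map_compose[OF it_continuous ccharD(1)[OF assms]] by (simp add: o_def)
  then show ?thesis using assms by (simp add: cchar_def it_mult)
qed

lemma cchar_zev:
  assumes "cchar \<theta>" shows "cchar (\<lambda>x. zev g (\<lambda>n. \<theta> (it n x)) m)"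
proof (induction g arbitrary: m)
  case (pCons c g)
  show ?case unfolding zev_pCons by (intro cchar_mult cchar_powi cchar_it[OF assms] pCons.IH)
qed (simp add: cchar_trivial)

text \<open>The kernel of the homomorphism from Z[t] to the dual group that sends the i-th power of
  t to \<theta> composed with the i-th iterate of \<alpha>. Ordinary polynomials suffice: a relation
  at index 0 holds at every index, because the orbit can be shifted.\<close>

definition annihilator :: "('a \<Rightarrow> complex) \<Rightarrow> int poly set" where
  "annihilator \<theta> = {g. \<forall>x\<in>carrier G. zev g (\<lambda>n. \<theta> (it n x)) 0 = 1}"

lemma zev_orbit_shift:
  assumes "x \<in> carrier G"
  shows "zev g (\<lambda>n. \<theta> (it n x)) m = zev g (\<lambda>n. \<theta> (it n (it m x))) 0"
  by (rule zev_cong) (simp add: it_add[OF assms, symmetric] add.commute)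

lemma annihilatorD:
  assumes "g \<in> annihilator \<theta>" "x \<in> carrier G"
  shows "zev g (\<lambda>n. \<theta> (it n x)) m = 1"
  using assms zev_orbit_shift[OF assms(2)] by (simp add: annihilator_def)

lemma closed_character_condition:
  assumes "cchar \<theta>" "closed C"
  shows "closedin X {x \<in> carrier G. \<theta> (it n x) \<in> C}"
  using closedin_continuous_map_preimage[OF ccharD(1)[OF cchar_it[OF assms(1)]], of C n] assms(2) by (simp add: tsp)

text \<open>Each finite window is handled by \<open>exists_point_with_character_values\<close> for
  the additive group of integer polynomials, whose condition on trivial characters becomes the
  hypothesis on the annihilator. Compactness joins the windows.\<close>

lemma realise_itinerary:
  assumes \<theta>: "cchar \<theta>" and y: "\<And>n. cmod (y n) = 1"
    and ann: "\<And>g n. g \<in> annihilator \<theta> \<Longrightarrow> zev g y n = 1"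
  obtains x where "x \<in> carrier G" "\<And>n. \<theta> (it n x) = y n"
proof -
  define C where "C N = {x \<in> carrier G. \<forall>n\<in>{- int N..int N}. \<theta> (it n x) = y n}" for N :: nat
  have y0: "y n \<noteq> 0" for n using y[of n] by auto
  have "C N \<noteq> {}" for N
  proof -
    \<comment> \<open>Polynomials have no negative exponents, so the window from -N to N is read
      from base index -N by the monomials of degree at most 2N.\<close>
    have "\<exists>x\<in>carrier G. \<forall>g\<in>monom 1 ` {..2 * N}. zev g (\<lambda>n. \<theta> (it n x)) (- int N) = zev g y (- int N)"
    proof (rule exists_point_with_character_values[where \<psi> = "\<lambda>g x. zev g (\<lambda>n. \<theta> (it n x)) (- int N)"
          and \<eta> = "\<lambda>g. zev g y (- int N)"])
      show "cchar (\<lambda>x. zev g (\<lambda>n. \<theta> (it n x)) (- int N))" for g by (rule cchar_zev[OF \<theta>])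
      show "zev (g + h) (\<lambda>n. \<theta> (it n x)) (- int N) = zev g (\<lambda>n. \<theta> (it n x)) (- int N) * zev h (\<lambda>n. \<theta> (it n x)) (- int N)"
        if "x \<in> carrier G" for g h x
      proof (rule zev_add)
        show "\<theta> (it n x) \<noteq> 0" for n using ccharD(2)[OF \<theta>, of "it n x"] that by auto
      qed
      show "zev (g + h) y (- int N) = zev g y (- int N) * zev h y (- int N)" for g h by (rule zev_add[OF y0])
      show "cmod (zev g y (- int N)) = 1" for g by (rule norm_zev[OF y])
      show "zev g y (- int N) = 1" if triv: "\<And>x. x \<in> carrier G \<Longrightarrow> zev g (\<lambda>n. \<theta> (it n x)) (- int N) = 1" for g
      proof (rule ann)
        show "g \<in> annihilator \<theta>" unfolding annihilator_def
        proof (intro CollectI ballI)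
          fix x assume x: "x \<in> carrier G"
          have "zev g (\<lambda>n. \<theta> (it n (it (- int N) (it (int N) x)))) 0 = 1"
            using triv[of "it (int N) x"] zev_orbit_shift[of "it (int N) x" g \<theta> "- int N"] x by simp
          then show "zev g (\<lambda>n. \<theta> (it n x)) 0 = 1" using it_add[OF x, of "- int N" "int N"] by simp
        qed
      qed
    qed simp
    then obtain x where x: "x \<in> carrier G"
      "\<And>k. k \<le> 2 * N \<Longrightarrow> \<theta> (it (- int N + int k) x) = y (- int N + int k)" by auto
    have "\<theta> (it n x) = y n" if "n \<in> {- int N..int N}" for n
    proof -
      have "nat (n + int N) \<le> 2 * N" using that by auto
      then show ?thesis using x(2)[of "nat (n + int N)"] that by simp
    qed
    then show ?thesis using x(1) by (auto simp: C_def)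
  qed
  moreover have "closedin X (C N)" for N
  proof -
    have "C N = (\<Inter>n\<in>{- int N..int N}. {x \<in> carrier G. \<theta> (it n x) \<in> {y n}})" by (auto simp: C_def)
    also have "closedin X \<dots>"
      by (intro closedin_INT closed_character_condition[OF \<theta>]) auto
    finally show ?thesis .
  qed
  moreover have "decseq C" unfolding decseq_def C_def by auto
  ultimately have "(\<Inter>N. C N) \<noteq> {}" using compact_space_imp_nest[OF compact] by blast
  then obtain x where x: "\<And>N. x \<in> C N" by blast
  have "\<theta> (it n x) = y n" for n
  proof -
    have "n \<in> {- int (nat \<bar>n\<bar>)..int (nat \<bar>n\<bar>)}" by auto
    then show ?thesis using x[of "nat \<bar>n\<bar>"] unfolding C_def by blast
  qed
  moreover have "x \<in> carrier G" using x[of 0] unfolding C_def by blast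
  ultimately show ?thesis by (intro that)
qed

text \<open>The orbit of a homoclinic point is infinite, hence dense; but near a periodic point \<open>s\<close> with
  \<open>\<theta> s \<noteq> 1\<close> it would have to stay away from the identity for arbitrarily many times.\<close>

lemma no_homoclinic:
  assumes \<theta>: "cchar \<theta>" and x: "x \<in> carrier G" and lim: "((\<lambda>n. \<theta> (it n x)) \<longlongrightarrow> 1) cofinite"
  shows "\<theta> (it m x) = 1"
proof (rule ccontr)
  assume neq: "\<theta> (it m x) \<noteq> 1"
  have fin: "finite {n. e \<le> cmod (\<theta> (it n x) - 1)}" if "e > 0" for e
    using tendstoD[OF lim that] by (simp add: eventually_cofinite dist_norm not_less)
  have inf: "infinite (range (\<lambda>n. it n x))"
  proof
    assume "finite (range (\<lambda>n. it n x))"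
    then obtain k :: nat where k: "k > 0" "it (int k) x = x" using orbit_finite_imp_period[OF x] by blast
    have "it (m + int k * int j) x = it m x" for j
      using it_multiple[OF x k(2), of j] it_add[OF x, of m "int k * int j"] by simp
    \<comment> \<open>A period would repeat the value at time \<open>m\<close>, which is not 1,
      infinitely often.\<close>
    then have "range (\<lambda>j::nat. m + int k * int j) \<subseteq> {n. cmod (\<theta> (it m x) - 1) \<le> cmod (\<theta> (it n x) - 1)}" by auto
    moreover have "inj (\<lambda>j::nat. m + int k * int j)" using k by (auto simp: inj_def)
    moreover have "finite {n. cmod (\<theta> (it m x) - 1) \<le> cmod (\<theta> (it n x) - 1)}" by (rule fin) (use neq in simp)
    ultimately have "finite (range (\<lambda>j::nat. m + int k * int j))" using finite_subset[of "range (\<lambda>j::nat. m + int k * int j)"] by simp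
    then show False using range_inj_infinite[OF \<open>inj (\<lambda>j::nat. m + int k * int j)\<close>] by simp
  qed
  define A where "A = X closure_of (range (\<lambda>n. it n x))"
  have sub: "range (\<lambda>n. it n x) \<subseteq> topspace X" using x by (auto simp: tsp)
  have "\<alpha> ` range (\<lambda>n. it n x) = range (\<lambda>n. it n x)"
  proof
    show "\<alpha> ` range (\<lambda>n. it n x) \<subseteq> range (\<lambda>n. it n x)" by (auto simp: it_plus_1[OF x, symmetric])
    show "range (\<lambda>n. it n x) \<subseteq> \<alpha> ` range (\<lambda>n. it n x)"
    proof
      fix y assume "y \<in> range (\<lambda>n. it n x)"
      then obtain n where "y = it n x" by blast
      then have "y = \<alpha> (it (n - 1) x)" using it_plus_1[OF x, of "n - 1"] by simp
      then show "y \<in> \<alpha> ` range (\<lambda>n. it n x)" by blast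
    qed
  qed
  then have "\<alpha> ` A = A" unfolding A_def using homeomorphic_map_closure_of[OF homeo sub] by simp
  moreover have "closedin X A" by (simp add: A_def)
  moreover have "infinite A"
  proof
    assume "finite A"
    then have "finite (range (\<lambda>n. it n x))" unfolding A_def by (rule finite_subset[OF closure_of_subset[OF sub]])
    then show False using inf by simp
  qed
  ultimately have AG: "A = carrier G" using finite_if_invariant by blast
  obtain n0 s where s: "s \<in> F n0" "\<theta> s \<noteq> 1" using nontrivial_on_F[OF \<theta> it_closed[OF x] neq] by blast
  have sG: "s \<in> carrier G" using s F_carrier by blast
  define k where "k = int (fact n0)"
  have k: "k > 0" "it k s = s" using s(1) by (auto simp: k_def F_def)
  define d where "d = cmod (\<theta> s - 1)"
  have d: "d > 0" using s(2) by (simp add: d_def)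
  define B where "B = {n. d / 2 \<le> cmod (\<theta> (it n x) - 1)}"
  have finB: "finite B" unfolding B_def by (rule fin) (use d in simp)
  \<comment> \<open>A point of \<open>V\<close> stays near the orbit of \<open>s\<close> at
    \<open>card B + 1\<close> times spaced by the period, one more than the number of times at which
    the orbit of \<open>x\<close> is that far from 1.\<close>
  define V where "V = (\<Inter>j\<in>{..card B}. {v \<in> topspace X. \<theta> (it (k * int j) v) \<in> ball (\<theta> s) (d / 2)})"
  have "openin X {v \<in> topspace X. \<theta> (it (k * int j) v) \<in> ball (\<theta> s) (d / 2)}" for j
    by (rule openin_continuous_map_preimage[OF ccharD(1)[OF cchar_it[OF \<theta>]]]) simp
  then have "openin X V" unfolding V_def by (intro openin_Inter) auto
  moreover have "s \<in> V" using sG d it_multiple[OF sG k(2)] by (simp add: V_def tsp)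
  moreover have "s \<in> A" using AG sG by simp
  ultimately have "\<exists>y\<in>range (\<lambda>n. it n x). y \<in> V" unfolding A_def in_closure_of by metis
  then obtain l where l: "it l x \<in> V" by blast
  have "(\<lambda>j. k * int j + l) ` {..card B} \<subseteq> B"
  proof (rule image_subsetI)
    fix j assume "j \<in> {..card B}"
    then have "\<theta> (it (k * int j) (it l x)) \<in> ball (\<theta> s) (d / 2)" using l by (auto simp: V_def)
    then have "cmod (\<theta> s - \<theta> (it (k * int j + l) x)) < d / 2" using it_add[OF x] by (simp add: dist_norm)
    moreover have "d \<le> cmod (\<theta> s - \<theta> (it (k * int j + l) x)) + cmod (\<theta> (it (k * int j + l) x) - 1)"
      unfolding d_def using norm_triangle_ineq[of "\<theta> s - \<theta> (it (k * int j + l) x)" "\<theta> (it (k * int j + l) x) - 1"] by simp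
    ultimately show "k * int j + l \<in> B" by (simp add: B_def)
  qed
  then have "card ((\<lambda>j. k * int j + l) ` {..card B}) \<le> card B" by (rule card_mono[OF finB])
  moreover have "inj_on (\<lambda>j. k * int j + l) {..card B}" using k by (auto simp: inj_on_def)
  ultimately show False by (simp add: card_image)
qed

text \<open>With prime order, relations can be read over the field with \<open>p\<close> elements,
  where a nonzero coefficient is invertible. This is the base of
  \<open>character_torsion_free\<close>.\<close>

lemma no_character_of_prime_order:
  assumes \<theta>: "cchar \<theta>" and p: "prime p" and tor: "\<And>x. x \<in> carrier G \<Longrightarrow> \<theta> x ^ p = 1"
    and s: "s \<in> carrier G" "\<theta> s \<noteq> 1"
  shows False
proof (cases "\<forall>g\<in>annihilator \<theta>. \<forall>i. int p dvd coeff g i")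
  case True
  define \<zeta> where "\<zeta> = cis (2 * pi / real p)"
  have p2: "p \<ge> 2" using p by (rule prime_ge_2_nat)
  have \<zeta>p: "\<zeta> ^ p = 1" 
  proof -
    have "\<zeta> ^ p = cis (real p * (2 * pi / real p))" unfolding \<zeta>_def by (rule Complex.DeMoivre)
    also have "real p * (2 * pi / real p) = 2 * pi" using p2 by simp
    finally show ?thesis by simp
  qed
  have "2 * pi / real p > 0" "2 * pi / real p \<le> pi" using p2 by (auto simp: field_simps)
  then have "cos (2 * pi / real p) < cos 0" by (intro cos_monotone_0_pi) auto
  then have \<zeta>1: "\<zeta> \<noteq> 1" by (auto simp: \<zeta>_def complex_eq_iff)
  \<comment> \<open>All exponents in a relation are multiples of \<open>p\<close>, so no relation
    constrains a spike whose value is a p-th root of unity.\<close>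
  define y where "y n = (if n = 0 then \<zeta> else 1)" for n :: int
  have yp: "y n powi (int p * i) = 1" for n i
    using \<zeta>p by (simp add: y_def power_int_mult)
  have "zev g y n = 1" if g: "g \<in> annihilator \<theta>" for g n
    unfolding zev_def
  proof (rule prod.neutral, rule ballI)
    fix i
    obtain j where "coeff g i = int p * j" using True g by (meson dvdE)
    then show "y (n + int i) powi coeff g i = 1" using yp by simp
  qed
  moreover have "cmod (y n) = 1" for n by (simp add: y_def \<zeta>_def)
  ultimately obtain x where x: "x \<in> carrier G" "\<And>n. \<theta> (it n x) = y n"
    using realise_itinerary[OF \<theta>, of y] by blast
  have "((\<lambda>n. \<theta> (it n x)) \<longlongrightarrow> 1) cofinite" unfolding x(2)
    by (rule tendsto_eventually) (auto simp: eventually_cofinite y_def)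
  from no_homoclinic[OF \<theta> x(1) this, of 0] show False using x(2)[of 0] \<zeta>1 by (simp add: y_def)
next
  case False
  then obtain g where g: "g \<in> annihilator \<theta>" "\<exists>i. \<not> int p dvd coeff g i" by blast
  \<comment> \<open>Terms above this index drop out because \<theta> has exponent \<open>p\<close>;
    what remains is a recurrence of order \<open>m\<close>.\<close>
  define m where "m = Max {i. i \<le> degree g \<and> \<not> int p dvd coeff g i}"
  have ne: "{i. i \<le> degree g \<and> \<not> int p dvd coeff g i} \<noteq> {}"
  proof -
    obtain i where i: "\<not> int p dvd coeff g i" using g(2) by blast
    then have "i \<le> degree g" by (intro le_degree) auto
    then show ?thesis using i by blast
  qed
  have mfin: "finite {i. i \<le> degree g \<and> \<not> int p dvd coeff g i}" by simp
  have m: "m \<le> degree g" "\<not> int p dvd coeff g m" using Max_in[OF mfin ne] by (auto simp: m_def)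
  have mm: "int p dvd coeff g i" if "m < i" "i \<le> degree g" for i
  proof (rule ccontr)
    assume "\<not> ?thesis"
    then have "i \<le> m" using Max_ge[OF mfin, of i] that(2) by (simp add: m_def)
    then show False using that(1) by simp
  qed
  have powp: "\<theta> x powi (int p * j) = 1" if "x \<in> carrier G" for x j
    using tor[OF that] by (simp add: power_int_mult)
  \<comment> \<open>Read at index \<open>i - m\<close>, the relation leaves only time
    \<open>i\<close> undecided, and its exponent there is invertible modulo \<open>p\<close>. The
    recurrence runs forward in time only.\<close>
  have det: "\<theta> (it (int i) z) = 1" if z: "z \<in> carrier G" and init: "\<And>i. i < m \<Longrightarrow> \<theta> (it (int i) z) = 1" for z i
  proof (induction i rule: less_induct)
    case (less i)
    show ?case
    proof (cases "i < m")
      case False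
      have "1 = zev g (\<lambda>n. \<theta> (it n z)) (int (i - m))" using annihilatorD[OF g(1) z] by simp
      also have "\<dots> = (\<Prod>j\<le>degree g. if j = m then \<theta> (it (int i) z) powi coeff g m else 1)"
        unfolding zev_def
      proof (rule prod.cong[OF refl])
        fix j assume j: "j \<in> {..degree g}"
        consider "j < m" | "j = m" | "j > m" by linarith
        then show "\<theta> (it (int (i - m) + int j) z) powi coeff g j = (if j = m then \<theta> (it (int i) z) powi coeff g m else 1)"
        proof cases
          case 1
          then have "\<theta> (it (int (i - m + j)) z) = 1" using less[of "i - m + j"] False by simp
          then show ?thesis using 1 by simp
        next
          case 2
          then show ?thesis using False by (simp add: of_nat_diff)
        next
          case 3
          then obtain l where "coeff g j = int p * l" using mm[of j] j by (auto elim: dvdE)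
          then show ?thesis using 3 powp[of "it (int (i - m) + int j) z" l] z by simp
        qed
      qed
      also have "\<dots> = \<theta> (it (int i) z) powi coeff g m" using m(1) by simp
      finally have 1: "\<theta> (it (int i) z) powi coeff g m = 1" by simp
      have "coprime (int p) (coeff g m)" using p m(2) by (simp add: prime_imp_coprime)
      then obtain a b where ab: "a * int p + b * coeff g m = 1" using bezout_int[of "int p" "coeff g m"] by auto
      have nz: "\<theta> (it (int i) z) \<noteq> 0" using ccharD(2)[OF \<theta>, of "it (int i) z"] z by auto
      have "\<theta> (it (int i) z) = \<theta> (it (int i) z) powi (int p * a + coeff g m * b)" using ab by (simp add: mult.commute)
      also have "\<dots> = 1" using nz powp[of "it (int i) z" a] z 1 by (simp add: power_int_add power_int_mult)
      finally show ?thesis .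
    qed (rule init)
  qed
  define N where "N = {z \<in> carrier G. \<forall>n. \<theta> (it n z) = 1}"
  have finN: "finite N"
  proof (rule finite_if_invariant)
    have "N = (\<Inter>n. {z \<in> carrier G. \<theta> (it n z) \<in> {1}})" by (auto simp: N_def)
    also have "closedin X \<dots>"
      by (intro closedin_INT closed_character_condition[OF \<theta>]) auto
    finally show "closedin X N" .
    show "\<alpha> ` N = N"
    proof (rule invariant_image)
      fix z assume z: "z \<in> carrier G"
      have "(\<forall>n. \<theta> (it (n + 1) z) = 1) \<longleftrightarrow> (\<forall>n. \<theta> (it n z) = 1)" 
      proof (intro iffI allI)
        fix n assume "\<forall>n. \<theta> (it (n + 1) z) = 1"
        from this[rule_format, of "n - 1"] show "\<theta> (it n z) = 1" by simp
      qed blast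
      then show "\<alpha> z \<in> N \<longleftrightarrow> z \<in> N" using z by (simp add: N_def it_alpha)
    qed (auto simp: N_def)
    have "\<theta> (it 0 s) \<noteq> 1" using s by simp
    then have "s \<notin> N" unfolding N_def by blast
    then show "N \<noteq> carrier G" using s by blast
  qed
  \<comment> \<open>For periodic points the forward recurrence controls negative times as well. They
    fall into finitely many classes by their first \<open>m\<close> values, and two points of a
    class differ by an element of the finite set \<open>N\<close>.\<close>
  define P where "P = (\<Union>n. F n)"
  have infP: "infinite P" unfolding P_def by (rule infinite_Union_F[OF infinite_carrier])
  have PG: "x \<in> carrier G" if "x \<in> P" for x using that F_carrier by (auto simp: P_def)
  define \<tau> where "\<tau> x = restrict (\<lambda>i. \<theta> (it (int i) x)) {..<m}" for x
  have "\<tau> ` P \<subseteq> PiE {..<m} (\<lambda>_. {z. z ^ p = 1})"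
    unfolding \<tau>_def by (rule image_subsetI) (use tor PG in \<open>simp only: restrict_PiE_iff, simp\<close>)
  moreover have "finite (PiE {..<m} (\<lambda>_. {z::complex. z ^ p = 1}))"
    using prime_gt_0_nat[OF p] by (intro finite_PiE finite_roots_unity) auto
  ultimately have "finite (\<tau> ` P)" using finite_subset by blast
  then obtain x0 where x0: "x0 \<in> P" "infinite {x \<in> P. \<tau> x = \<tau> x0}"
    using pigeonhole_infinite[OF infP] by auto
  have "(\<lambda>x. x \<otimes> inv x0) ` {x \<in> P. \<tau> x = \<tau> x0} \<subseteq> N"
  proof clarify
    fix x assume x: "x \<in> P" "\<tau> x = \<tau> x0"
    obtain a b where ab: "x \<in> F a" "x0 \<in> F b" using x x0 by (auto simp: P_def)
    define z where "z = x \<otimes> inv x0"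
    have "x \<in> F (max a b)" "x0 \<in> F (max a b)" using ab F_mono[of a "max a b"] F_mono[of b "max a b"] by auto
    then have zF: "z \<in> F (max a b)" unfolding z_def
      using subgroup.m_closed[OF F_subgroup] subgroup.m_inv_closed[OF F_subgroup] by blast
    then have zG: "z \<in> carrier G" by (rule F_carrier)
    have xG: "x \<in> carrier G" "x0 \<in> carrier G" using x x0 PG by auto
    have pos: "\<theta> (it (int i) z) = 1" for i
    proof (rule det[OF zG])
      fix i assume "i < m"
      then have "\<theta> (it (int i) x) = \<theta> (it (int i) x0)" using x(2) by (metis \<tau>_def lessThan_iff restrict_apply')
      then show "\<theta> (it (int i) z) = 1" unfolding z_def by (rule cchar_inv_mult[OF cchar_it[OF \<theta>] xG])
    qed
    have "\<theta> (it n z) = 1" for n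
    proof -
      define k where "k = int (fact (max a b))"
      have k: "k \<ge> 1" "it k z = z" using zF by (auto simp: k_def F_def simp del: of_nat_fact)
      have "it n z = it (n + k * int (nat \<bar>n\<bar>)) z"
        using it_multiple[OF zG k(2), of "nat \<bar>n\<bar>"] it_add[OF zG, of n "k * int (nat \<bar>n\<bar>)"] by simp
      moreover have "n + k * int (nat \<bar>n\<bar>) \<ge> 0"
      proof -
        have "1 * \<bar>n\<bar> \<le> k * \<bar>n\<bar>" using k(1) by (intro mult_right_mono) auto
        then show ?thesis by simp
      qed
      ultimately show ?thesis using pos[of "nat (n + k * int (nat \<bar>n\<bar>))"] by simp
    qed
    then show "x \<otimes> inv x0 \<in> N" using zG by (simp add: N_def z_def)
  qed
  then have "finite ((\<lambda>x. x \<otimes> inv x0) ` {x \<in> P. \<tau> x = \<tau> x0})" using finN finite_subset by blast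
  moreover have "inj_on (\<lambda>x. x \<otimes> inv x0) {x \<in> P. \<tau> x = \<tau> x0}"
    using PG x0(1) by (auto simp: inj_on_def)
  ultimately show False using x0(2) finite_imageD by blast
qed

text \<open>Splitting a prime \<open>p\<close> off \<open>c\<close> leaves a power of \<theta>
  killed by \<open>p\<close>, which is trivial by the prime case; so the exponent descends.\<close>

lemma character_torsion_free:
  assumes \<theta>: "cchar \<theta>" and c: "c > (0::nat)" and tor: "\<And>x. x \<in> carrier G \<Longrightarrow> \<theta> x ^ c = 1" and x: "x \<in> carrier G"
  shows "\<theta> x = 1"
  using \<theta> c tor x
proof (induction c arbitrary: \<theta> x rule: less_induct)
  case (less c)
  show ?case
  proof (cases "c = 1")
    case False
    then obtain p where p: "prime p" "p dvd c" using prime_factor_nat by blast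
    then obtain d where d: "c = d * p" by (metis dvdE mult.commute)
    have dc: "d < c" "d > 0" using d less.prems(2) prime_gt_1_nat[OF p(1)] by auto
    have "\<theta> y ^ d = 1" if "y \<in> carrier G" for y
    proof (rule ccontr)
      assume "\<theta> y ^ d \<noteq> 1"
      from no_character_of_prime_order[OF cchar_pow[OF less.prems(1)] p(1) _ that this]
      show False using less.prems(3) by (simp add: d power_mult)
    qed
    then show ?thesis using less.IH[OF dc(1) less.prems(1) dc(2) _ less.prems(4)] by blast
  qed (use less.prems in auto)
qed

end

section \<open>The relation ideal of a character\<close>

context cam_group
begin

lemma annihilator_iff: "g \<in> annihilator \<theta> \<longleftrightarrow> (\<forall>x\<in>carrier G. \<forall>m. zev g (\<lambda>n. \<theta> (it n x)) m = 1)"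
  using annihilatorD by (auto simp: annihilator_def)

context
  fixes \<theta> assumes \<theta>: "cchar \<theta>"
begin

lemma itinerary_nonzero: "x \<in> carrier G \<Longrightarrow> \<theta> (it n x) \<noteq> 0"
  using ccharD(2)[OF \<theta>, of "it n x"] by auto

lemma annihilator_add:
  assumes "f \<in> annihilator \<theta>" "g \<in> annihilator \<theta>"
  shows "f + g \<in> annihilator \<theta>"
  unfolding annihilator_iff
proof (intro ballI allI)
  fix x m assume "x \<in> carrier G"
  then show "zev (f + g) (\<lambda>n. \<theta> (it n x)) m = 1"
    using zev_add[of "\<lambda>n. \<theta> (it n x)" f g m] itinerary_nonzero annihilatorD assms by simp
qed

lemma annihilator_smult: "f \<in> annihilator \<theta> \<Longrightarrow> smult c f \<in> annihilator \<theta>"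
  by (simp add: annihilator_iff zev_smult)

text \<open>Cancelling the variable is possible because \<alpha> is invertible; this later provides
  the nonzero constant coefficient.\<close>

lemma annihilator_shift: "pCons 0 f \<in> annihilator \<theta> \<longleftrightarrow> f \<in> annihilator \<theta>"
proof
  assume f: "pCons 0 f \<in> annihilator \<theta>"
  show "f \<in> annihilator \<theta>" unfolding annihilator_iff
  proof (intro ballI allI)
    fix x m assume "x \<in> carrier G"
    then have "zev (pCons 0 f) (\<lambda>n. \<theta> (it n x)) (m - 1) = 1" using f unfolding annihilator_iff by blast
    then show "zev f (\<lambda>n. \<theta> (it n x)) m = 1" by simp
  qed
qed (simp add: annihilator_iff)

lemma annihilator_mult:
  assumes "f \<in> annihilator \<theta>"
  shows "g * f \<in> annihilator \<theta>"
proof (induction g)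
  case 0
  then show ?case by (simp add: annihilator_iff)
next
  case (pCons c g)
  show ?case unfolding mult_pCons_left
    by (intro annihilator_add annihilator_smult assms) (simp only: annihilator_shift pCons.IH)
qed

text \<open>The product of characters described by \<open>f\<close> is itself a continuous
  character, killed by the absolute value of \<open>c\<close>, hence trivial by
  torsion-freeness.\<close>

lemma annihilator_saturated:
  assumes "smult c f \<in> annihilator \<theta>" "c \<noteq> 0"
  shows "f \<in> annihilator \<theta>"
  unfolding annihilator_iff
proof (intro ballI allI)
  fix x m assume x: "x \<in> carrier G"
  have "zev f (\<lambda>n. \<theta> (it n z)) m ^ nat \<bar>c\<bar> = 1" if "z \<in> carrier G" for z
  proof -
    have "zev f (\<lambda>n. \<theta> (it n z)) m powi c = 1"
      using assms(1) that by (simp add: annihilator_iff zev_smult)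
    then show ?thesis by (cases "c \<ge> 0") (auto simp: power_int_def power_inverse)
  qed
  from character_torsion_free[OF cchar_zev[OF \<theta>] _ this x] assms(2)
  show "zev f (\<lambda>n. \<theta> (it n x)) m = 1" by simp
qed

text \<open>A nonzero element of least degree has its primitive part in the ideal by saturation.
  Pseudo-division by it leaves no remainder, by minimality, and Gauss's lemma removes the
  multiplier. Degree 0 would put 1 into the ideal and make \<theta> trivial; a zero constant term
  would allow a smaller degree.\<close>

lemma annihilator_principal:
  assumes nontriv: "s \<in> carrier G" "\<theta> s \<noteq> 1" and ne: "annihilator \<theta> \<noteq> {0}"
  obtains f where "degree f > 0" "coeff f 0 \<noteq> 0" "\<And>g. g \<in> annihilator \<theta> \<Longrightarrow> f dvd g"
proof -
  have "0 \<in> annihilator \<theta>" by (simp add: annihilator_iff)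
  then obtain h where "h \<in> annihilator \<theta>" "h \<noteq> 0" using ne by blast
  then obtain f0 where f0: "f0 \<in> annihilator \<theta>" "f0 \<noteq> 0"
    and min: "\<And>g. g \<in> annihilator \<theta> \<Longrightarrow> g \<noteq> 0 \<Longrightarrow> degree f0 \<le> degree g"
    using ex_has_least_nat[of "\<lambda>g. g \<in> annihilator \<theta> \<and> g \<noteq> 0" h degree] by blast
  define f where "f = primitive_part f0"
  have f0f: "smult (content f0) f = f0" by (simp add: f_def)
  then have f: "f \<in> annihilator \<theta>" using f0 annihilator_saturated[of "content f0" f] by simp
  have fne: "f \<noteq> 0" using f0(2) by (simp add: f_def)
  have df: "degree f = degree f0" by (simp add: f_def)
  have cf: "content f = 1" using f0(2) by (simp add: f_def)
  have "degree f > 0"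
  proof (rule ccontr)
    assume "\<not> degree f > 0"
    then obtain c where c: "f = [:c:]" using degree_eq_zeroE by blast
    then have "smult c 1 \<in> annihilator \<theta>" using f by simp
    then have "1 \<in> annihilator \<theta>" using annihilator_saturated c fne by auto
    then have "zev [:1:] (\<lambda>n. \<theta> (it n s)) 0 = 1" using nontriv(1) unfolding annihilator_iff one_pCons by blast
    then show False using nontriv(2) by simp
  qed
  moreover have "coeff f 0 \<noteq> 0"
  proof
    assume 0: "coeff f 0 = 0"
    obtain c g where g: "f = pCons c g" by (cases f)
    then have fg: "f = pCons 0 g" using 0 by simp
    then have "g \<in> annihilator \<theta>" "g \<noteq> 0" using f fne annihilator_shift by auto
    then have "degree f \<le> degree g" using min df by simp
    then show False using fg \<open>g \<noteq> 0\<close> by simp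
  qed
  moreover have "f dvd g" if g: "g \<in> annihilator \<theta>" for g
  proof -
    obtain q r where qr: "pseudo_divmod g f = (q, r)" by (cases "pseudo_divmod g f")
    define c where "c = lead_coeff f ^ (Suc (degree g) - degree f)"
    have c: "c \<noteq> 0" using fne by (simp add: c_def)
    have eq: "smult c g = f * q + r" and r: "r = 0 \<or> degree r < degree f"
      using pseudo_divmod[OF fne qr] by (auto simp: c_def)
    have "r = smult c g + smult (- 1) (q * f)" using eq by (simp add: mult.commute)
    then have "r \<in> annihilator \<theta>" by (simp only:) (intro annihilator_add annihilator_smult annihilator_mult g f)
    then have "r = 0" using r min[of r] unfolding df by linarith
    then obtain q' where "g = f * q'" using primitive_dvd_smult_cancel[OF cf c, of g q] eq by auto
    then show ?thesis by simp
  qed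
  ultimately show ?thesis by (rule that)
qed

text \<open>Passing to angles turns the multiplicative relations into integrality, so real sequences
  can be handled modulo 1.\<close>

lemma real_itinerary:
  fixes r :: "int \<Rightarrow> real"
  assumes "\<And>g n. g \<in> annihilator \<theta> \<Longrightarrow> iconv g r n \<in> \<int>"
  obtains x where "x \<in> carrier G" "\<And>n. \<theta> (it n x) = cis (2 * pi * r n)"
proof (rule realise_itinerary[OF \<theta>, of "\<lambda>n. cis (2 * pi * r n)"])
  show "zev g (\<lambda>n. cis (2 * pi * r n)) n = 1" if g: "g \<in> annihilator \<theta>" for g n
  proof -
    obtain k where "iconv g r n = of_int k" using assms[OF g] by (auto elim: Ints_cases)
    then show ?thesis unfolding zev_cis by (simp add: cis_multiple_2pi)
  qed
qed (use that in auto)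

text \<open>Modulo 1 the sequence is the itinerary of a homoclinic point, which
  \<open>no_homoclinic\<close> forces to be constantly 1.\<close>

lemma no_itinerary_tending_to_zero:
  fixes w :: "int \<Rightarrow> real"
  assumes "\<And>g n. g \<in> annihilator \<theta> \<Longrightarrow> iconv g w n \<in> \<int>" and lim: "(w \<longlongrightarrow> 0) cofinite"
  shows "w n \<in> \<int>"
proof -
  obtain x where x: "x \<in> carrier G" "\<And>n. \<theta> (it n x) = cis (2 * pi * w n)"
    using real_itinerary[OF assms(1)] by blast
  have "((\<lambda>n. cis (2 * pi * w n)) \<longlongrightarrow> cis (2 * pi * 0)) cofinite"
    by (intro tendsto_cis tendsto_mult tendsto_const lim)
  then have "((\<lambda>n. \<theta> (it n x)) \<longlongrightarrow> 1) cofinite" by (simp add: x(2))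
  from no_homoclinic[OF \<theta> x(1) this, of n] have "cis (2 * pi * w n) = 1" by (simp add: x(2))
  then have "cos (2 * pi * w n) = 1" by (simp add: complex_eq_iff)
  then obtain k :: int where "2 * pi * w n = of_int k * 2 * pi" unfolding cos_one_2pi_int by blast
  then have "w n = of_int k" by simp
  then show ?thesis by simp
qed

text \<open>A root on the unit circle makes \<open>\<alpha>\<close> non-expansive: it yields a whole continuum of points whose
  itineraries stay close to 1.\<close>

lemma no_root_on_unit_circle:
  assumes nontriv: "s \<in> carrier G" "\<theta> s \<noteq> 1"
    and f: "\<And>g. g \<in> annihilator \<theta> \<Longrightarrow> f dvd g" and z: "cmod z = 1" "poly (map_poly of_int f) z = 0"
  shows False
proof -
  have z0: "z \<noteq> 0" using z(1) by auto
  have "\<exists>x\<in>carrier G. \<forall>n. \<theta> (it n x) = cis (2 * pi * (e * Re (z powi n)))" for e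
  proof -
    have "iconv g (\<lambda>n. e * Re (z powi n)) n \<in> \<int>" if "g \<in> annihilator \<theta>" for g n
    proof -
      obtain q where "g = q * f" using f[OF \<open>g \<in> annihilator \<theta>\<close>] by (metis dvdE mult.commute)
      moreover have "iconv f (\<lambda>n. e * Re (z powi n)) = (\<lambda>n. 0)"
        using iconv_Re_powi[OF z0, of f e] z(2) by (auto simp: fun_eq_iff)
      ultimately show ?thesis by (simp add: iconv_mult)
    qed
    from real_itinerary[OF this] show ?thesis by blast
  qed
  then have "\<forall>e. \<exists>x. x \<in> carrier G \<and> (\<forall>n. \<theta> (it n x) = cis (2 * pi * (e * Re (z powi n))))" by blast
  from choice[OF this] obtain x where x: "\<And>e. x e \<in> carrier G"
    "\<And>e n. \<theta> (it n (x e)) = cis (2 * pi * (e * Re (z powi n)))" by blast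
  \<comment> \<open>For 0 < e < 1/4 all angles stay within pi/2 of 0, which puts \<open>x e\<close>
    into \<open>B\<close>; the value at time 0 determines e, so \<open>B\<close> is
    infinite.\<close>
  define B where "B = {x \<in> carrier G. \<forall>n. Re (\<theta> (it n x)) \<ge> 0}"
  have "x ` {0<..<1/4} \<subseteq> B"
  proof (rule image_subsetI)
    fix e :: real assume e: "e \<in> {0<..<1/4}"
    have "Re (\<theta> (it n (x e))) \<ge> 0" for n
    proof -
      have "\<bar>Re (z powi n)\<bar> \<le> 1" using abs_Re_le_cmod[of "z powi n"] z(1) by (simp add: norm_power_int)
      then have "\<bar>e * Re (z powi n)\<bar> \<le> 1/4 * 1" unfolding abs_mult using e by (intro mult_mono) auto
      then have "\<bar>2 * pi * (e * Re (z powi n))\<bar> \<le> 2 * pi * (1/4)" unfolding abs_mult[of "2 * pi"] by (intro mult_mono) auto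
      then have "\<bar>2 * pi * (e * Re (z powi n))\<bar> \<le> pi / 2" by simp
      then have "cos (2 * pi * (e * Re (z powi n))) \<ge> 0" by (intro cos_ge_zero; linarith)
      then show ?thesis by (simp add: x(2))
    qed
    then show "x e \<in> B" using x(1) by (simp add: B_def)
  qed
  moreover have "inj_on x {0<..<1/4}"
  proof (rule inj_onI)
    fix e e' :: real assume e: "e \<in> {0<..<1/4}" "e' \<in> {0<..<1/4}" and eq: "x e = x e'"
    have "cis (2 * pi * e) = cis (2 * pi * e')" using x(2)[of 0 e] x(2)[of 0 e'] eq by simp
    then have "cos (2 * pi * e) = cos (2 * pi * e')" by (simp add: complex_eq_iff)
    then have "2 * pi * e = 2 * pi * e'" by (rule cos_inj_pi[rotated -1]) (use e in \<open>auto simp: field_simps\<close>)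
    then show "e = e'" by simp
  qed
  moreover have "infinite {0<..<1/4::real}" by (rule infinite_Ioo) simp
  ultimately have "infinite B" using finite_imageD finite_subset by blast
  moreover have "closedin X B"
  proof -
    have "B = (\<Inter>n. {x \<in> carrier G. \<theta> (it n x) \<in> {w. Re w \<ge> 0}})" by (auto simp: B_def)
    also have "closedin X \<dots>"
      by (intro closedin_INT closed_character_condition[OF \<theta>]) (auto simp: closed_halfspace_Re_ge)
    finally show ?thesis .
  qed
  moreover have "\<alpha> ` B = B"
  proof (rule invariant_image)
    fix z assume z: "z \<in> carrier G"
    have "(\<forall>n. Re (\<theta> (it (n + 1) z)) \<ge> 0) \<longleftrightarrow> (\<forall>n. Re (\<theta> (it n z)) \<ge> 0)"
    proof (intro iffI allI)
      fix n assume "\<forall>n. Re (\<theta> (it (n + 1) z)) \<ge> 0"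
      from this[rule_format, of "n - 1"] show "Re (\<theta> (it n z)) \<ge> 0" by simp
    qed blast
    then show "\<alpha> z \<in> B \<longleftrightarrow> z \<in> B" using z by (simp add: B_def it_alpha)
  qed (auto simp: B_def)
  ultimately have BG: "B = carrier G" using finite_if_invariant by blast
  \<comment> \<open>The set \<open>B\<close> cannot be everything: over a finite subgroup on which
    \<theta> is nontrivial the values sum to 0, while their real parts would be nonnegative with a 1
    among them.\<close>
  obtain n t where t: "t \<in> F n" "\<theta> t \<noteq> 1" using nontrivial_on_F[OF \<theta> nontriv] by blast
  have "(\<Sum>y\<in>F n. \<theta> y) = 0" by (rule sum_cchar_F[OF \<theta> t])
  then have "(\<Sum>y\<in>F n. Re (\<theta> y)) = 0" by (metis Re_sum zero_complex.sel(1))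
  moreover have "(\<Sum>y\<in>F n. Re (\<theta> y)) > 0"
  proof (rule sum_pos2[where i = \<one>])
    show "finite (F n)" by (rule F_finite)
    show "\<one> \<in> F n" using subgroup.one_closed[OF F_subgroup] .
    show "0 < Re (\<theta> \<one>)" by (simp add: cchar_one[OF \<theta>])
    fix y assume "y \<in> F n"
    then have "y \<in> B" using BG F_carrier by blast
    then have "Re (\<theta> (it 0 y)) \<ge> 0" unfolding B_def by blast
    then show "0 \<le> Re (\<theta> y)" by simp
  qed
  ultimately show False by simp
qed

text \<open>Without relations any sequence is an itinerary. Otherwise the real convolution inverse
  of \<open>f\<close> has integral image under every relation, so it must itself be integral; being
  also null, it would make \<open>f\<close> invertible as a Laurent polynomial, although
  \<open>f\<close> has at least two nonzero terms.\<close>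

lemma no_nontrivial_character:
  assumes s: "s \<in> carrier G" "\<theta> s \<noteq> 1"
  shows False
proof (cases "annihilator \<theta> = {0}")
  case True
  \<comment> \<open>The value 1/2 is the point -1 of the circle; any non-integer would
    serve.\<close>
  define w :: "int \<Rightarrow> real" where "w n = (if n = 0 then 1/2 else 0)" for n
  have "{n. w n \<noteq> 0} \<subseteq> {0}" by (auto simp: w_def)
  then have "finite {n. w n \<noteq> 0}" by (rule finite_subset) simp
  then have lim: "(w \<longlongrightarrow> 0) cofinite"
    by (intro tendsto_eventually) (simp add: eventually_cofinite)
  have "iconv g w n \<in> \<int>" if "g \<in> annihilator \<theta>" for g n
  proof -
    have "g = 0" using that True by blast
    then show ?thesis by simp
  qed
  then have "w 0 \<in> \<int>" by (rule no_itinerary_tending_to_zero[OF _ lim])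
  then have "1 \<le> \<bar>w 0\<bar>" by (rule Ints_nonzero_abs_ge1) (simp add: w_def)
  then show False by (simp add: w_def)
next
  case False
  obtain f where f: "degree f > 0" "coeff f 0 \<noteq> 0" "\<And>g. g \<in> annihilator \<theta> \<Longrightarrow> f dvd g"
    using annihilator_principal[OF s False] by blast
  have f0: "f \<noteq> 0" using f(1) by auto
  have "poly (map_poly of_int f) z \<noteq> 0" if "cmod z = 1" for z
  proof
    assume "poly (map_poly of_int f) z = 0"
    from no_root_on_unit_circle[OF s f(3) that this] show False .
  qed
  then obtain w :: "int \<Rightarrow> real" where w: "(w \<longlongrightarrow> 0) cofinite"
    "\<And>n. seq_conv (map_poly of_int f) w n = (if n = 0 then 1 else 0)"
    using int_poly_convolution_inverse[OF f0] by blast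
  have wf: "iconv f w n = (if n = 0 then 1 else 0)" for n unfolding iconv_eq_seq_conv by (rule w(2))
  have "iconv g w n \<in> \<int>" if g: "g \<in> annihilator \<theta>" for g n
  proof -
    obtain q where "g = q * f" using f(3)[OF g] by (metis dvdE mult.commute)
    then have "iconv g w n = iconv q (iconv f w) n" by (simp add: iconv_mult)
    also have "\<dots> \<in> \<int>" by (rule iconv_Ints) (simp add: wf)
    finally show ?thesis .
  qed
  \<comment> \<open>The homoclinic point is excluded only modulo 1, so integrality is all that
    follows; an integer-valued sequence tending to 0 then has finite support.\<close>
  then have wZ: "w n \<in> \<int>" for n by (rule no_itinerary_tending_to_zero[OF _ w(1)])
  have "\<forall>\<^sub>F n in cofinite. dist (w n) 0 < 1" using w(1) by (rule tendstoD) simp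
  then have "finite {n. \<not> \<bar>w n\<bar> < 1}" by (simp add: eventually_cofinite)
  moreover have "{n. w n \<noteq> 0} \<subseteq> {n. \<not> \<bar>w n\<bar> < 1}"
  proof clarify
    fix n assume "w n \<noteq> 0" "\<bar>w n\<bar> < 1"
    then show False using Ints_nonzero_abs_ge1[OF wZ, of n] by simp
  qed
  ultimately have "finite {n. w n \<noteq> 0}" by (rule finite_subset[rotated])
  from finite_support_not_convolution_unit[OF this f(1,2)] show False using wf by simp
qed

end

end

theorem theorem2p12:
  fixes G :: "('a, 'b) monoid_scheme" and X :: "'a topology" and \<alpha> :: "'a \<Rightarrow> 'a"
  assumes "topological_group G X"
    and "compact_space X" and "metrizable_space X"
    and "\<alpha> \<in> iso G G"
    and "continuous_map X X \<alpha>"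
  shows "\<not> CAM X \<alpha>"
proof
  assume "CAM X \<alpha>"
  then interpret cam_group G X \<alpha>
    using assms(1,4) unfolding cam_group_def cam_group_axioms_def by (auto simp: topological_group_def)
  have "carrier G \<noteq> {\<one>\<^bsub>G\<^esub>}" using infinite_carrier by auto
  then obtain \<theta> s where "cchar \<theta>" "s \<in> carrier G" "\<theta> s \<noteq> 1" by (rule exists_nontrivial_character)
  then show False by (rule no_nontrivial_character)
qed

end
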